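(* Let $1\le r\le n$ be integers, let $\rho\vdash n-r$, and let $\psi_{\rho,n}=\sum_{S}(-1)^{\ell(S)}\chi^{\rho*S}$, where the sum runs over all rim hooks $S$ of length $r$ that can be added to $\rho$ so that $\rho*S$ is a partition of $n$. Let $\mu\in P(n)$. If $\mu=c\bar\mu$, where $c$ is a cycle of length $r$ and $\bar\mu\in P(n-r)$ (that is, $\mu$ has a part equal to $r$ and $\bar\mu$ is obtained from $\mu$ by deleting one such part), then $$\psi_{\rho,n}(\mu)=r\,m_{r,\mu}\cdot\chi^{\rho}(\bar\mu),$$ where $m_{r,\mu}$ is the multiplicity of $r$-cycles in $\mu$. In particular, if the cycle type of $\mu$ contains no $r$-cycle (i.e. $m_{r,\mu}=0$), then $\psi_{\rho,n}(\mu)=0$.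
   Context: $P(n)$ is the set of partitions of $n$; $\lambda\vdash n$ means $\lambda\in P(n)$. Partitions are identified with their Young diagrams, and also with conjugacy classes of $S_n$ via cycle type. $\chi^\lambda$ is the irreducible character of $S_n$ indexed by $\lambda$ and $\chi^\lambda(\mu)$ its value on the class of cycle type $\mu$. A rim hook (border strip) is a connected skew diagram containing no $2\times2$ square; its length is its number of boxes and its leg length $\ell(S)$ is its number of rows minus one. If $\rho\subseteq\mu$ and $S$ is a rim hook of $\mu$ with $\mu\setminus S=\rho$, one writes $\mu=\rho*S$. $m_{r,\mu}$ denotes the number of parts of $\mu$ equal to $r$. *)

theory Defs
  imports
    Complex_Main
    "HOL-Library.Multiset"
    "HOL-Library.Function_Algebras"
    "HOL-Combinatorics.Combinatorics"
begin

text \<open>Partitions are weakly decreasing lists of positive integers.\<close>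

definition partitions :: "nat \<Rightarrow> nat list set" where
  "partitions n = {\<nu>. sorted_wrt (\<ge>) \<nu> \<and> 0 \<notin> set \<nu> \<and> sum_list \<nu> = n}"

text \<open>Boxes are pairs (row, column), both counted from 0.\<close>

definition diagram :: "nat list \<Rightarrow> (nat \<times> nat) set" where
  "diagram \<nu> = {(i, j). i < length \<nu> \<and> j < \<nu> ! i}"

definition skew_diagram :: "(nat \<times> nat) set \<Rightarrow> bool" where
  "skew_diagram S \<longleftrightarrow>
     (\<exists>m k. \<exists>\<nu>\<in>partitions m. \<exists>\<rho>\<in>partitions k.
        diagram \<rho> \<subseteq> diagram \<nu> \<and> S = diagram \<nu> - diagram \<rho>)"

definition adjacent :: "nat \<times> nat \<Rightarrow> nat \<times> nat \<Rightarrow> bool" where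
  "adjacent a b \<longleftrightarrow>
     (fst a = fst b \<and> (snd a = Suc (snd b) \<or> snd b = Suc (snd a))) \<or>
     (snd a = snd b \<and> (fst a = Suc (fst b) \<or> fst b = Suc (fst a)))"

definition connected_boxes :: "(nat \<times> nat) set \<Rightarrow> bool" where
  "connected_boxes S \<longleftrightarrow>
     S \<noteq> {} \<and> (\<forall>a\<in>S. \<forall>b\<in>S. (a, b) \<in> {(x, y). x \<in> S \<and> y \<in> S \<and> adjacent x y}\<^sup>*)"

definition rim_hook :: "(nat \<times> nat) set \<Rightarrow> bool" where
  "rim_hook S \<longleftrightarrow>
     skew_diagram S \<and> connected_boxes S \<and>
     \<not> (\<exists>i j. {(i, j), (Suc i, j), (i, Suc j), (Suc i, Suc j)} \<subseteq> S)"

definition leg_length :: "(nat \<times> nat) set \<Rightarrow> nat" where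
  "leg_length S = card (fst ` S) - 1"

definition Sym :: "nat \<Rightarrow> (nat \<Rightarrow> nat) set" where
  "Sym n = {g. g permutes {1..n}}"

text \<open>Fixed points of \<open>g\<close> in \<open>{1..n}\<close> contribute orbits of size 1, that is, parts equal to 1.\<close>

definition cycle_type :: "nat \<Rightarrow> (nat \<Rightarrow> nat) \<Rightarrow> nat multiset" where
  "cycle_type n g = image_mset card (mset_set (orbit g ` {1..n}))"

definition cycle_class :: "nat list \<Rightarrow> (nat \<Rightarrow> nat) set" where
  "cycle_class \<mu> = {g \<in> Sym (sum_list \<mu>). cycle_type (sum_list \<mu>) g = mset \<mu>}"

text \<open>
  An element \<open>\<Sum>g. x g \<cdot> g\<close> of the complex group algebra of \<open>Sym n\<close> is its coefficient
  function \<open>x\<close>, which vanishes outside \<open>Sym n\<close>. The product of group elements is composition,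
  and \<open>conv n\<close> is the resulting product in the group algebra.
\<close>

definition group_algebra :: "nat \<Rightarrow> ((nat \<Rightarrow> nat) \<Rightarrow> complex) set" where
  "group_algebra n = {x. \<forall>g. g \<notin> Sym n \<longrightarrow> x g = 0}"

definition conv ::
  "nat \<Rightarrow> ((nat \<Rightarrow> nat) \<Rightarrow> complex) \<Rightarrow> ((nat \<Rightarrow> nat) \<Rightarrow> complex) \<Rightarrow> ((nat \<Rightarrow> nat) \<Rightarrow> complex)"
  where
  "conv n x y = (\<lambda>g. \<Sum>h\<in>Sym n. x h * y (inv h \<circ> g))"

definition delta :: "(nat \<Rightarrow> nat) \<Rightarrow> ((nat \<Rightarrow> nat) \<Rightarrow> complex)" where
  "delta g = (\<lambda>h. if h = g then 1 else 0)"

global_interpretation cfun: vector_space "\<lambda>(a::complex) (x::'x \<Rightarrow> complex) t. a * x t"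
  by unfold_locales (auto simp: fun_eq_iff algebra_simps)

text \<open>
  The trace of a linear operator \<open>f\<close> on a finite-dimensional invariant subspace \<open>V\<close>,
  computed in some basis \<open>B\<close> of \<open>V\<close>; it does not depend on the choice of \<open>B\<close>.
\<close>

definition trace_on ::
  "('x \<Rightarrow> complex) set \<Rightarrow> (('x \<Rightarrow> complex) \<Rightarrow> ('x \<Rightarrow> complex)) \<Rightarrow> complex" where
  "trace_on V f =
     (let B = (SOME B. cfun.independent B \<and> cfun.span B = V)
      in \<Sum>b\<in>B. cfun.representation B (f b) b)"

text \<open>
  The canonical tableau of shape \<open>\<nu>\<close> has the entries \<open>1, 2, \<dots>\<close> row by row;
  \<open>tab_box \<nu> k\<close> is the box containing the entry \<open>k\<close>.
\<close>

definition tab_box :: "nat list \<Rightarrow> nat \<Rightarrow> nat \<times> nat" where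
  "tab_box \<nu> k = concat (map (\<lambda>i. map (Pair i) [0..<\<nu> ! i]) [0..<length \<nu>]) ! (k - 1)"

definition row_group :: "nat list \<Rightarrow> (nat \<Rightarrow> nat) set" where
  "row_group \<nu> =
     {g \<in> Sym (sum_list \<nu>). \<forall>k\<in>{1..sum_list \<nu>}. fst (tab_box \<nu> (g k)) = fst (tab_box \<nu> k)}"

definition col_group :: "nat list \<Rightarrow> (nat \<Rightarrow> nat) set" where
  "col_group \<nu> =
     {g \<in> Sym (sum_list \<nu>). \<forall>k\<in>{1..sum_list \<nu>}. snd (tab_box \<nu> (g k)) = snd (tab_box \<nu> k)}"

definition young_symmetrizer :: "nat list \<Rightarrow> ((nat \<Rightarrow> nat) \<Rightarrow> complex)" where
  "young_symmetrizer \<nu> =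
     conv (sum_list \<nu>)
       (\<lambda>g. if g \<in> row_group \<nu> then 1 else 0)
       (\<lambda>g. if g \<in> col_group \<nu> then of_int (sign g) else 0)"

text \<open>
  The irreducible module indexed by \<open>\<nu>\<close> is the left ideal generated by the Young symmetrizer
  (a copy of the Specht module). In this convention a single row gives the trivial module and
  a single column the sign module.
\<close>

definition irr_module :: "nat list \<Rightarrow> ((nat \<Rightarrow> nat) \<Rightarrow> complex) set" where
  "irr_module \<nu> =
     (\<lambda>x. conv (sum_list \<nu>) x (young_symmetrizer \<nu>)) ` group_algebra (sum_list \<nu>)"

definition irr_char :: "nat list \<Rightarrow> (nat \<Rightarrow> nat) \<Rightarrow> complex" where
  "irr_char \<nu> g = trace_on (irr_module \<nu>) (conv (sum_list \<nu>) (delta g))"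

text \<open>
  A rim hook \<open>S\<close> that can be added to \<open>\<rho>\<close> is
  determined by the partition \<open>\<nu> = \<rho> * S\<close> via \<open>S = diagram \<nu> - diagram \<rho>\<close>, so the sum is taken
  over these \<open>\<nu>\<close>; the hooks have length \<open>n\<close> minus the size of \<open>\<rho>\<close>.
\<close>

definition hook_extensions :: "nat list \<Rightarrow> nat \<Rightarrow> nat list set" where
  "hook_extensions \<rho> n =
     {\<nu> \<in> partitions n. diagram \<rho> \<subseteq> diagram \<nu> \<and> rim_hook (diagram \<nu> - diagram \<rho>) \<and>
        card (diagram \<nu> - diagram \<rho>) = n - sum_list \<rho>}"

definition psi :: "nat list \<Rightarrow> nat \<Rightarrow> (nat \<Rightarrow> nat) \<Rightarrow> complex" where
  "psi \<rho> n g =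
     (\<Sum>\<nu>\<in>hook_extensions \<rho> n. (-1) ^ leg_length (diagram \<nu> - diagram \<rho>) * irr_char \<nu> g)"

end

theory Submission
  imports Defs "HOL-Library.FuncSet"
begin

text \<open>
  Write \<open>\<beta> i = \<lambda> i - i\<close> for the beads of a partition \<open>\<lambda>\<close> padded to \<open>k\<close> parts, and let
  \<open>frob k \<mu> \<beta>\<close> be the coefficient with which the power sum of cycle type \<open>\<mu>\<close>, multiplied by
  the Vandermonde determinant in \<open>k\<close> variables, contains the monomial given by \<open>\<beta>\<close>. This is an
  alternating function of the beads, and removing a part \<open>r\<close> from \<open>\<mu>\<close> lowers one bead by \<open>r\<close>.
  The adjoint operation, raising a bead by \<open>r\<close>, commutes with all lowerings except for the beads
  near the lower end, and these contribute the factor \<open>r\<close> times the multiplicity of \<open>r\<close>. Raising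
  a bead of \<open>\<rho>\<close> by \<open>r\<close> is adding a rim hook of length \<open>r\<close>, the leg length being the number of beads
  that are passed, so the theorem follows once \<open>frob\<close> is identified with the irreducible
  character (Frobenius' formula).

  For this identification, the inner product of the character of the module generated by the Young
  symmetrizer of \<open>\<nu>\<close> with the Frobenius expression of \<open>\<lambda>\<close> is computed by expanding the latter into
  permutation characters. Young symmetrizers make it vanish unless \<open>\<nu>\<close> dominates \<open>\<lambda>\<close>; complementing
  the beads, which amounts to a twist by the sign character, makes it vanish unless the conjugate of
  \<open>\<nu>\<close> dominates the conjugate of \<open>\<lambda>\<close>. So only \<open>\<lambda> = \<nu>\<close> survives. The column orthogonality of
  \<open>frob\<close>, a formal consequence of the commutation above, then gives that character and
  Frobenius expression are proportional on each class, with a factor that does not depend on the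
  partition and is seen to be 1 on the trivial character.
\<close>

section \<open>Alternating bead coefficients\<close>

text \<open>The definition of \<open>irr_char\<close> gives only one-sided information: a Young
  symmetrizer controls sums of a character over stabilizers of words, that is, inner products with
  permutation characters. The determinantal expansion of \<open>frob\<close> is triangular in the
  same direction, so an inner product of \<nu> with \<theta> could still survive when \<nu> strictly
  dominates \<theta>. The sign twist supplies the opposite triangularity.

  The number \<open>k\<close> of beads stays a parameter. If \<open>2 * n \<le> k\<close>, every
  configuration with a nonzero coefficient for a cycle type of size \<open>n\<close> has its lowest
  \<open>n\<close> admissible positions filled: they lie at or below \<open>- n\<close>, and
  lowerings of total size \<open>n\<close> cannot have disturbed them. This filled bottom is what
  makes the correction term in the commutation of raising and lowering count exactly
  \<open>r\<close> beads; without it the count could depend on the configuration.\<close>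

text \<open>
  Exponents are shifted by the staircase: in the monomial belonging to \<open>\<beta>\<close> the \<open>i\<close>-th variable has
  exponent \<open>\<beta> i + k - 1\<close>, so the Vandermonde determinant is the sum over the \<open>\<beta> = - \<sigma>\<close>. Beads
  below \<open>1 - k\<close> are harmless, since the coefficient vanishes there.
\<close>

fun frob :: "nat \<Rightarrow> nat list \<Rightarrow> (nat \<Rightarrow> int) \<Rightarrow> int" where
  "frob k [] \<beta> = (\<Sum>\<sigma> | \<sigma> permutes {..<k}. sign \<sigma> * (if \<forall>i<k. \<beta> i = - int (\<sigma> i) then 1 else 0))"
| "frob k (r # \<mu>) \<beta> = (\<Sum>i<k. frob k \<mu> (\<beta>(i := \<beta> i - int r)))"

text \<open>The coefficient of the monomial with exponents \<alpha> in the product of the power sums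
  indexed by \<mu>, which is also a value of a permutation character on words. Exponents are
  integers because the lowering steps may make them negative.\<close>

fun word_count :: "nat \<Rightarrow> nat list \<Rightarrow> (nat \<Rightarrow> int) \<Rightarrow> int" where
  "word_count k [] \<alpha> = (if \<forall>i<k. \<alpha> i = 0 then 1 else 0)"
| "word_count k (r # \<mu>) \<alpha> = (\<Sum>i<k. word_count k \<mu> (\<alpha>(i := \<alpha> i - int r)))"

lemma finite_permutes_lessThan [simp]: "finite {\<sigma>. \<sigma> permutes {..<k::nat}}"
  by (simp add: finite_permutations)

lemma frob_cong: "(\<And>i. i < k \<Longrightarrow> \<beta> i = \<gamma> i) \<Longrightarrow> frob k \<mu> \<beta> = frob k \<mu> \<gamma>"
proof (induction \<mu> arbitrary: \<beta> \<gamma>)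
  case Nil
  then show ?case by simp
next
  case (Cons r \<mu>)
  show ?case unfolding frob.simps
    by (rule sum.cong[OF refl], rule Cons.IH) (use Cons.prems in auto)
qed

text \<open>Lowering a bead commutes with adding the shift by \<sigma>, so the sum over the terms of
  the Vandermonde determinant can be moved outside. On characters this is the determinantal
  expansion of a Schur function into complete symmetric functions.\<close>

lemma frob_eq_word_count:
  "frob k \<mu> \<beta> = (\<Sum>\<sigma> | \<sigma> permutes {..<k}. sign \<sigma> * word_count k \<mu> (\<lambda>i. \<beta> i + int (\<sigma> i)))"
proof (induction \<mu> arbitrary: \<beta>)
  case Nil
  show ?case by (auto intro!: sum.cong simp: eq_neg_iff_add_eq_0)
next
  case (Cons r \<mu>)
  have "frob k (r # \<mu>) \<beta> =
    (\<Sum>\<sigma> | \<sigma> permutes {..<k}. \<Sum>i<k. sign \<sigma> * word_count k \<mu> (\<lambda>j. (\<beta>(i := \<beta> i - int r)) j + int (\<sigma> j)))"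
    by (simp add: Cons.IH, rule sum.swap)
  also have "\<dots> = (\<Sum>\<sigma> | \<sigma> permutes {..<k}. sign \<sigma> * word_count k (r # \<mu>) (\<lambda>j. \<beta> j + int (\<sigma> j)))"
  proof (intro sum.cong refl)
    fix \<sigma> :: "nat \<Rightarrow> nat"
    have "(\<lambda>j. (\<beta>(i := \<beta> i - int r)) j + int (\<sigma> j))
      = (\<lambda>j. \<beta> j + int (\<sigma> j))(i := \<beta> i + int (\<sigma> i) - int r)" for i
      by (auto simp: fun_eq_iff)
    then show "(\<Sum>i<k. sign \<sigma> * word_count k \<mu> (\<lambda>j. (\<beta>(i := \<beta> i - int r)) j + int (\<sigma> j)))
      = sign \<sigma> * word_count k (r # \<mu>) (\<lambda>j. \<beta> j + int (\<sigma> j))"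
      by (simp add: sum_distrib_left)
  qed
  finally show ?case .
qed

lemma frob_comp:
  assumes "\<tau> permutes {..<k}"
  shows "frob k \<mu> (\<beta> \<circ> \<tau>) = sign \<tau> * frob k \<mu> \<beta>"
proof (induction \<mu> arbitrary: \<beta>)
  case Nil
  have "frob k [] (\<beta> \<circ> \<tau>) = (\<Sum>\<sigma> | \<sigma> permutes {..<k}. sign (\<sigma> \<circ> \<tau>) * (if \<forall>i<k. \<beta> (\<tau> i)
    = - int (\<sigma> (\<tau> i)) then 1 else 0))"
    unfolding frob.simps by (subst sum_permutations_compose_right[OF assms]) (auto intro!: sum.cong)
  also have "\<dots> = (\<Sum>\<sigma> | \<sigma> permutes {..<k}. sign \<tau> * (sign \<sigma> * (if \<forall>i<k. \<beta> i = - int (\<sigma> i) then 1 else 0)))"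
  proof (rule sum.cong[OF refl])
    fix \<sigma> :: "nat \<Rightarrow> nat" assume s: "\<sigma> \<in> {\<sigma>. \<sigma> permutes {..<k}}"
    have "sign (\<sigma> \<circ> \<tau>) = sign \<sigma> * sign \<tau>"
      using s assms by (intro sign_compose) (auto simp: permutation_permutes)
    moreover have "(\<forall>i<k. \<beta> (\<tau> i) = - int (\<sigma> (\<tau> i))) \<longleftrightarrow> (\<forall>i<k. \<beta> i = - int (\<sigma> i))"
      using permutes_image[OF assms] by (metis (no_types, lifting) imageE image_eqI lessThan_iff)
    ultimately show "sign (\<sigma> \<circ> \<tau>) * (if \<forall>i<k. \<beta> (\<tau> i) = - int (\<sigma> (\<tau> i)) then 1 else 0) =
      sign \<tau> * (sign \<sigma> * (if \<forall>i<k. \<beta> i = - int (\<sigma> i) then 1 else 0))" by simp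
  qed
  finally show ?case by (simp add: sum_distrib_left)
next
  case (Cons r \<mu>)
  have upd: "(\<beta> \<circ> \<tau>)(i := (\<beta> \<circ> \<tau>) i - int r) = \<beta>(\<tau> i := \<beta> (\<tau> i) - int r) \<circ> \<tau>" for i
    using permutes_inj[OF assms] by (auto simp: fun_eq_iff inj_eq)
  have "frob k (r # \<mu>) (\<beta> \<circ> \<tau>) = (\<Sum>i<k. sign \<tau> * frob k \<mu> (\<beta>(\<tau> i := \<beta> (\<tau> i) - int r)))"
    by (simp only: frob.simps upd Cons.IH)
  also have "\<dots> = (\<Sum>i<k. sign \<tau> * frob k \<mu> (\<beta>(i := \<beta> i - int r)))"
    by (rule sum.reindex_bij_betw[OF permutes_imp_bij[OF assms], of "\<lambda>i. sign \<tau> * frob k \<mu> (\<beta>(i := \<beta> i - int r))"])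
  finally show ?case by (simp only: frob.simps sum_distrib_left)
qed

lemma frob_transpose:
  assumes "i < k" "j < k" "i \<noteq> j"
  shows "frob k \<mu> (\<beta> \<circ> transpose i j) = - frob k \<mu> \<beta>"
  using frob_comp[of "transpose i j" k \<mu> \<beta>] assms by (simp add: permutes_swap_id sign_swap_id)

lemma frob_eq_0_collision:
  assumes "i < k" "j < k" "i \<noteq> j" "\<beta> i = \<beta> j"
  shows "frob k \<mu> \<beta> = 0"
proof -
  have "\<beta> \<circ> transpose i j = \<beta>"
    using assms(4) by (auto simp: fun_eq_iff transpose_def)
  then show ?thesis using frob_transpose[OF assms(1-3), of \<mu> \<beta>] by simp
qed

lemma frob_Nil_nonzeroD:
  assumes "frob k [] \<beta> \<noteq> 0"
  obtains \<sigma> where "\<sigma> permutes {..<k}" "\<And>i. i < k \<Longrightarrow> \<beta> i = - int (\<sigma> i)"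
proof -
  have "\<exists>\<sigma>. \<sigma> permutes {..<k} \<and> (\<forall>i<k. \<beta> i = - int (\<sigma> i))"
  proof (rule ccontr)
    assume "\<not> ?thesis"
    then have "frob k [] \<beta> = 0" by (auto intro!: sum.neutral)
    with assms show False by simp
  qed
  then show ?thesis using that by blast
qed

lemma frob_Cons_nonzeroD:
  assumes "frob k (r # \<mu>) \<beta> \<noteq> 0"
  obtains i where "i < k" "frob k \<mu> (\<beta>(i := \<beta> i - int r)) \<noteq> 0"
  using assms by (auto elim!: sum.not_neutral_contains_not_neutral)

text \<open>Beads only move down and must end in \<open>{1 - k..0}\<close>, so a bead that starts
  below that range can never arrive.\<close>

lemma frob_nonzero_lower:
  assumes "frob k \<mu> \<beta> \<noteq> 0" "i < k"
  shows "- int k < \<beta> i"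
  using assms(1)
proof (induction \<mu> arbitrary: \<beta>)
  case Nil
  obtain \<sigma> where s: "\<sigma> permutes {..<k}" "\<And>i. i < k \<Longrightarrow> \<beta> i = - int (\<sigma> i)"
    using frob_Nil_nonzeroD[OF Nil(1)] by blast
  have "\<sigma> i < k" using permutes_in_image[OF s(1), of i] assms(2) by simp
  then show ?case using s(2)[OF assms(2)] by linarith
next
  case (Cons r \<mu>)
  then obtain j where "j < k" "frob k \<mu> (\<beta>(j := \<beta> j - int r)) \<noteq> 0" by (elim frob_Cons_nonzeroD)
  from Cons.IH[OF this(2)] show ?case by (auto split: if_splits)
qed

lemma frob_nonzero_upper:
  assumes "frob k \<mu> \<beta> \<noteq> 0" "i < k"
  shows "\<beta> i \<le> int (sum_list \<mu>)"
  using assms(1)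
proof (induction \<mu> arbitrary: \<beta>)
  case Nil
  obtain \<sigma> where s: "\<sigma> permutes {..<k}" "\<And>i. i < k \<Longrightarrow> \<beta> i = - int (\<sigma> i)"
    using frob_Nil_nonzeroD[OF Nil(1)] by blast
  then show ?case using assms(2) by simp
next
  case (Cons r \<mu>)
  then obtain j where "j < k" "frob k \<mu> (\<beta>(j := \<beta> j - int r)) \<noteq> 0" by (elim frob_Cons_nonzeroD)
  from Cons.IH[OF this(2)] show ?case by (auto split: if_splits)
qed

lemma frob_nonzero_sum:
  assumes "frob k \<mu> \<beta> \<noteq> 0"
  shows "(\<Sum>i<k. \<beta> i + int i) = int (sum_list \<mu>)"
  using assms
proof (induction \<mu> arbitrary: \<beta>)
  case Nil
  obtain \<sigma> where s: "\<sigma> permutes {..<k}" "\<And>i. i < k \<Longrightarrow> \<beta> i = - int (\<sigma> i)"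
    using frob_Nil_nonzeroD[OF Nil(1)] by blast
  have "(\<Sum>i<k. \<beta> i) = - (\<Sum>i<k. int (\<sigma> i))" using s(2) by (simp add: sum_negf)
  also have "(\<Sum>i<k. int (\<sigma> i)) = (\<Sum>i<k. int i)"
    using sum.reindex_bij_betw[OF permutes_imp_bij[OF s(1)], of int] by simp
  finally show ?case by (simp add: sum.distrib)
next
  case (Cons r \<mu>)
  then obtain j where j: "j < k" "frob k \<mu> (\<beta>(j := \<beta> j - int r)) \<noteq> 0" by (elim frob_Cons_nonzeroD)
  have "(\<Sum>i<k. (\<beta>(j := \<beta> j - int r)) i + int i) = (\<Sum>i<k. (\<beta> i + int i) - (if i = j then int r else 0))"
    by (rule sum.cong) auto
  also have "\<dots> = (\<Sum>i<k. \<beta> i + int i) - int r" using j(1) by (simp add: sum_subtractf)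
  finally show ?case using Cons.IH[OF j(2)] by simp
qed

text \<open>Once all parts are removed, every admissible position is filled. Undoing a lowering by
  \<open>r\<close> could empty position \<open>v\<close> only by lifting its bead to
  \<open>v + r\<close>; if \<open>v\<close> is low enough, that position is itself filled, and two
  equal beads make the coefficient vanish.\<close>

lemma frob_nonzero_low_beads:
  assumes "frob k \<mu> \<beta> \<noteq> 0" "0 \<notin> set \<mu>" "- int k < v" "v \<le> - int (sum_list \<mu>)"
  shows "\<exists>i<k. \<beta> i = v"
  using assms
proof (induction \<mu> arbitrary: \<beta> v)
  case Nil
  obtain \<sigma> where s: "\<sigma> permutes {..<k}" "\<And>i. i < k \<Longrightarrow> \<beta> i = - int (\<sigma> i)"
    using frob_Nil_nonzeroD[OF Nil(1)] by blast
  have "nat (- v) \<in> \<sigma> ` {..<k}" unfolding permutes_image[OF s(1)] using Nil by auto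
  then obtain i where "i < k" "nat (- v) = \<sigma> i" by auto
  then show ?case using s(2)[of i] Nil by auto
next
  case (Cons r \<mu>)
  then obtain j where j: "j < k" "frob k \<mu> (\<beta>(j := \<beta> j - int r)) \<noteq> 0" by (elim frob_Cons_nonzeroD)
  have ih: "\<exists>i<k. (\<beta>(j := \<beta> j - int r)) i = u" if "- int k < u" "u \<le> - int (sum_list \<mu>)" for u
    by (rule Cons.IH[OF j(2) _ that]) (use Cons.prems in auto)
  obtain i where i: "i < k" "(\<beta>(j := \<beta> j - int r)) i = v" using ih[of v] Cons.prems by auto
  show ?case
  proof (cases "i = j")
    case True
    then have bj: "\<beta> j = v + int r" using i by simp
    then obtain i' where i': "i' < k" "(\<beta>(j := \<beta> j - int r)) i' = \<beta> j"
      using ih[of "\<beta> j"] Cons.prems by auto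
    have "i' \<noteq> j" using i' Cons.prems(2) by auto
    with i' have "\<beta> i' = \<beta> j" by simp
    then show ?thesis using frob_eq_0_collision[OF i'(1) j(1) \<open>i' \<noteq> j\<close>] Cons.prems(1) by metis
  qed (use i in auto)
qed

lemma frob_swap_parts: "frob k (r # s # \<mu>) \<beta> = frob k (s # r # \<mu>) \<beta>"
proof -
  have c: "\<beta>(i := \<beta> i - int a, j := (\<beta>(i := \<beta> i - int a)) j - int b) =
     \<beta>(j := \<beta> j - int b, i := (\<beta>(j := \<beta> j - int b)) i - int a)" for i j a b
    by (auto simp: fun_eq_iff)
  show ?thesis unfolding frob.simps c[of _ r _ s] by (rule sum.swap)
qed

lemma frob_remove1:
  "r \<in> set \<mu> \<Longrightarrow> frob k \<mu> \<beta> = frob k (r # remove1 r \<mu>) \<beta>"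
proof (induction \<mu> arbitrary: \<beta>)
  case (Cons s \<mu>)
  show ?case
  proof (cases "r = s")
    case False
    then have "frob k (s # \<mu>) \<beta> = frob k (s # r # remove1 r \<mu>) \<beta>"
      using Cons.IH Cons.prems by (simp only: frob.simps) auto
    then show ?thesis using False by (simp only: frob_swap_parts[of k s r]) simp
  qed simp
qed simp

lemma frob_mset_cong: "mset \<mu> = mset \<nu> \<Longrightarrow> frob k \<mu> \<beta> = frob k \<nu> \<beta>"
proof (induction \<nu> arbitrary: \<mu> \<beta>)
  case (Cons s \<nu>)
  have "s \<in> set \<mu>" using Cons.prems by (metis list.set_intros(1) set_mset_mset)
  moreover have "mset (remove1 s \<mu>) = mset \<nu>" using Cons.prems by simp
  ultimately show ?case using frob_remove1[of s \<mu> k \<beta>] Cons.IH[of "remove1 s \<mu>"]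
    by (simp del: fun_upd_apply)
qed simp

lemma frob_eq_0_not_inj: "\<not> inj_on \<beta> {..<k} \<Longrightarrow> frob k \<mu> \<beta> = 0"
  by (auto simp: inj_on_def intro: frob_eq_0_collision)

text \<open>Raising any other bead leaves the two equal beads in place and gives 0; raising one or
  the other of the equal beads gives configurations that differ by a transposition, and these two
  terms cancel.\<close>

lemma sum_frob_raise_not_inj:
  assumes "\<not> inj_on \<gamma> {..<k}"
  shows "(\<Sum>i<k. frob k \<mu> (\<gamma>(i := \<gamma> i + r))) = 0"
proof -
  obtain a b where ab: "a < k" "b < k" "a \<noteq> b" "\<gamma> a = \<gamma> b"
    using assms by (auto simp: inj_on_def)
  have "(\<Sum>i<k. frob k \<mu> (\<gamma>(i := \<gamma> i + r))) = (\<Sum>i\<in>{a,b}. frob k \<mu> (\<gamma>(i := \<gamma> i + r)))"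
  proof (rule sum.mono_neutral_right)
    show "\<forall>i\<in>{..<k} - {a, b}. frob k \<mu> (\<gamma>(i := \<gamma> i + r)) = 0"
      using ab by (auto intro!: frob_eq_0_collision[of a _ b])
  qed (use ab in auto)
  also have "\<dots> = frob k \<mu> (\<gamma>(a := \<gamma> a + r)) + frob k \<mu> (\<gamma>(b := \<gamma> b + r))" using ab by simp
  also have "\<gamma>(b := \<gamma> b + r) = \<gamma>(a := \<gamma> a + r) \<circ> transpose a b"
    using ab by (auto simp: fun_eq_iff transpose_def)
  also have "frob k \<mu> \<dots> = - frob k \<mu> (\<gamma>(a := \<gamma> a + r))" using frob_transpose ab by blast
  finally show ?thesis by (simp del: fun_upd_apply)
qed

text \<open>In terms of symmetric functions, raising beads by \<open>r\<close> is adjoint to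
  multiplication by the power sum \<open>p_r\<close> and acts as \<open>r\<close> times the
  derivative in \<open>p_r\<close>. The product rule comes from the truncation at
  \<open>- k\<close>: raising and lowering commute as shifts, but a bead lowered past the bottom
  kills the coefficient unless the same bead is raised again. The filled positions up to
  \<open>- k + N\<close> make this happen for exactly \<open>r\<close> beads.\<close>

lemma sum_frob_raise:
  assumes "0 \<notin> set \<mu>" "\<And>s. s \<in> set \<mu> \<Longrightarrow> s \<le> N" "1 \<le> r" "r \<le> N"
    and "\<And>i. i < k \<Longrightarrow> - int k < \<beta> i"
    and "\<And>v. - int k < v \<Longrightarrow> v \<le> - int k + int N \<Longrightarrow> \<exists>i<k. \<beta> i = v"
  shows "(\<Sum>i<k. frob k \<mu> (\<beta>(i := \<beta> i + int r))) = int r * int (count_list \<mu> r) * frob k (remove1 r \<mu>) \<beta>"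
proof (cases "inj_on \<beta> {..<k}")
  case False
  then show ?thesis by (simp add: sum_frob_raise_not_inj frob_eq_0_not_inj del: fun_upd_apply)
next
  case True
  then show ?thesis using assms(1,2,5,6)
  proof (induction \<mu> arbitrary: \<beta>)
    case Nil
    have "frob k [] (\<beta>(i := \<beta> i + int r)) = 0" if i: "i < k" for i
    proof (rule ccontr)
      assume "frob k [] (\<beta>(i := \<beta> i + int r)) \<noteq> 0"
      then obtain \<sigma> where s: "\<sigma> permutes {..<k}"
          "\<And>j. j < k \<Longrightarrow> (\<beta>(i := \<beta> i + int r)) j = - int (\<sigma> j)"
        by (rule frob_Nil_nonzeroD) blast
      have le: "\<beta> i + int r \<le> 0" using s(2)[OF i] by simp
      then have "nat (- \<beta> i) \<in> \<sigma> ` {..<k}"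
        unfolding permutes_image[OF s(1)] using Nil.prems(4)[OF i] i by auto
      then obtain j where j: "j < k" "\<sigma> j = nat (- \<beta> i)" by auto
      then have bj: "(\<beta>(i := \<beta> i + int r)) j = \<beta> i" using s(2)[of j] le by simp
      then have "j \<noteq> i" using assms(3) by auto
      then show False using bj Nil.prems(1) i j by (auto simp: inj_on_def)
    qed
    then show ?case by simp
  next
    case (Cons s \<mu>)
    let ?g = "\<lambda>j. \<beta>(j := \<beta> j - int s)"
    have s: "1 \<le> s" "s \<le> N" using Cons.prems by (auto simp: Suc_le_eq intro: gr0I)
    have comm: "(\<beta>(i := \<beta> i + int r))(j := (\<beta>(i := \<beta> i + int r)) j - int s)
      = (?g j)(i := ?g j i + int r)" for i j
      by (auto simp: fun_eq_iff)
    \<comment> \<open>The induction hypothesis needs the lowered configuration to stay above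
      \<open>- k\<close>; the last summand collects the beads for which it does not.\<close>
    have main: "(\<Sum>i<k. frob k \<mu> ((?g j)(i := ?g j i + int r))) =
        int r * int (count_list \<mu> r) * frob k (remove1 r \<mu>) (?g j)
        + (if r = s \<and> \<beta> j \<le> - int k + int s then frob k \<mu> \<beta> else 0)" if j: "j < k" for j
    proof (cases "\<beta> j \<le> - int k + int s")
      case False
      have "(\<Sum>i<k. frob k \<mu> ((?g j)(i := ?g j i + int r)))
        = int r * int (count_list \<mu> r) * frob k (remove1 r \<mu>) (?g j)"
      proof (cases "inj_on (?g j) {..<k}")
        case inj: True
        show ?thesis
        proof (rule Cons.IH[OF inj])
          fix v assume v: "- int k < v" "v \<le> - int k + int N"
          then obtain i where i: "i < k" "\<beta> i = v" using Cons.prems(5) by blast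
          \<comment> \<open>Lowering bead \<open>j\<close> cannot empty a bottom position: it would
            land on the bead at \<open>v - s\<close>, against injectivity.\<close>
          show "\<exists>i<k. ?g j i = v"
          proof (cases "i = j")
            case True
            then obtain i' where i': "i' < k" "\<beta> i' = v - int s"
              using Cons.prems(5)[of "v - int s"] i v False by auto
            then have "i' \<noteq> j" using True i s by auto
            then show ?thesis using inj i' i True j by (auto simp: inj_on_def)
          qed (use i in auto)
        qed (use Cons.prems False in auto)
      next
        case False
        then show ?thesis by (simp add: sum_frob_raise_not_inj frob_eq_0_not_inj del: fun_upd_apply)
      qed
      then show ?thesis using False by simp
    next
      case True
      then have neg: "?g j j \<le> - int k" by simp
      have z: "frob k \<nu> \<gamma> = 0" if "\<gamma> j \<le> - int k" for \<nu> \<gamma>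
        using frob_nonzero_lower[of k \<nu> \<gamma> j] that j by force
      \<comment> \<open>Bead \<open>j\<close> now lies below the bottom, so only the summand that
        raises this very bead survives; its net shift is \<open>r - s\<close>.\<close>
      have "(\<Sum>i<k. frob k \<mu> ((?g j)(i := ?g j i + int r))) = (\<Sum>i<k. if i
        = j then frob k \<mu> ((?g j)(j := ?g j j + int r)) else 0)"
        by (rule sum.cong[OF refl]) (use neg in \<open>auto intro!: z\<close>)
      also have "\<dots> = frob k \<mu> (\<beta>(j := \<beta> j + (int r - int s)))" using j by (simp add: algebra_simps)
      also have "\<dots> = (if r = s then frob k \<mu> \<beta> else 0)"
      proof (cases "r = s")
        case False
        \<comment> \<open>Since \<open>\<beta> j \<le> - k + s\<close>, this target is at most
          \<open>- k + r\<close>, so it is either below the bottom or already occupied.\<close>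
        let ?v = "\<beta> j + (int r - int s)"
        have "frob k \<mu> (\<beta>(j := ?v)) = 0"
        proof (cases "?v \<le> - int k")
          case True
          then show ?thesis by (intro z) simp
        next
          case v: False
          then obtain i where i: "i < k" "\<beta> i = ?v" using Cons.prems(5)[of ?v] True assms(4) by auto
          then have "i \<noteq> j" using False by auto
          then show ?thesis using i j by (intro frob_eq_0_collision[of i _ j]) auto
        qed
        then show ?thesis using False by simp
      qed simp
      finally show ?thesis using True z[of "?g j"] neg by (simp del: fun_upd_apply)
    qed
    have "(\<Sum>i<k. frob k (s # \<mu>) (\<beta>(i := \<beta> i + int r)))
      = (\<Sum>j<k. \<Sum>i<k. frob k \<mu> ((?g j)(i := ?g j i + int r)))"
      by (simp only: frob.simps comm) (rule sum.swap)
    also have "\<dots> = int r * int (count_list \<mu> r) * frob k (s # remove1 r \<mu>) \<beta> +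
       (\<Sum>j<k. if r = s \<and> \<beta> j \<le> - int k + int s then frob k \<mu> \<beta> else 0)"
      by (simp add: main sum.distrib sum_distrib_left del: fun_upd_apply)
    also have "\<dots> = int r * int (count_list (s # \<mu>) r) * frob k (remove1 r (s # \<mu>)) \<beta>"
    proof (cases "r = s")
      case True
      \<comment> \<open>By the filled bottom, the beads up to \<open>- k + s\<close> occupy a full
        interval of \<open>s\<close> positions; this count is the factor \<open>r\<close> in the
        result.\<close>
      have "\<beta> ` {j\<in>{..<k}. \<beta> j \<le> - int k + int s} = {- int k <.. - int k + int s}"
        using Cons.prems(4,5) s by (fastforce simp: image_iff)
      moreover have "inj_on \<beta> {j\<in>{..<k}. \<beta> j \<le> - int k + int s}"
        using Cons.prems(1) by (rule inj_on_subset) auto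
      ultimately have c: "card {j\<in>{..<k}. \<beta> j \<le> - int k + int s} = s"
        using card_image by fastforce
      have "(\<Sum>j<k. if r = s \<and> \<beta> j \<le> - int k + int s then frob k \<mu> \<beta> else 0) = 
         (\<Sum>j\<in>{j\<in>{..<k}. \<beta> j \<le> - int k + int s}. frob k \<mu> \<beta>)"
        using True by (subst sum.inter_filter) auto
      also have "\<dots> = int s * frob k \<mu> \<beta>" using c by simp
      finally have e: "(\<Sum>j<k. if r = s \<and> \<beta> j \<le> - int k + int s then frob k \<mu> \<beta> else 0)
        = int s * frob k \<mu> \<beta>" .
      have "int (count_list \<mu> r) * frob k (s # remove1 r \<mu>) \<beta> = int (count_list \<mu> r) * frob k \<mu> \<beta>"
        using frob_remove1[of r \<mu> k \<beta>] True by (cases "r \<in> set \<mu>") (auto simp: count_list_0_iff)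
      then show ?thesis unfolding e using True by (simp add: algebra_simps del: frob.simps)
    qed simp
    finally show ?case .
  qed
qed

section \<open>Column orthogonality\<close>

text \<open>For \<open>M = mset \<mu>\<close> this is the product of \<open>r ^ m * m!\<close> over
  the distinct parts \<open>r\<close> of multiplicity \<open>m\<close>, the order of a centralizer
  in the symmetric group. The recursion on two arguments mirrors the induction for column
  orthogonality and yields 0 for different cycle types.\<close>

fun centralizer_order :: "nat list \<Rightarrow> nat multiset \<Rightarrow> nat" where
  "centralizer_order [] M = (if M = {#} then 1 else 0)"
| "centralizer_order (r # \<mu>) M = r * count M r * centralizer_order \<mu> (M - {#r#})"

lemma centralizer_order_eq_0: "M \<noteq> mset \<mu> \<Longrightarrow> centralizer_order \<mu> M = 0"
proof (induction \<mu> arbitrary: M)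
  case (Cons r \<mu>)
  show ?case
  proof (cases "r \<in># M")
    case True
    then have "M - {#r#} \<noteq> mset \<mu>" using Cons.prems by (metis insert_DiffM mset.simps(2))
    then show ?thesis using Cons.IH by simp
  qed (simp add: not_in_iff)
qed simp

lemma frob_Nil_negated_permutation:
  assumes "\<sigma> permutes {..<k}" "\<And>i. i < k \<Longrightarrow> \<beta> i = - int (\<sigma> i)"
  shows "frob k [] \<beta> = sign \<sigma>"
proof -
  have eq: "(\<forall>i<k. \<beta> i = - int (\<tau> i)) \<longleftrightarrow> \<tau> = \<sigma>" if "\<tau> permutes {..<k}" for \<tau>
  proof
    assume *: "\<forall>i<k. \<beta> i = - int (\<tau> i)"
    show "\<tau> = \<sigma>"
    proof
      fix i show "\<tau> i = \<sigma> i"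
        using * assms(2)[of i] permutes_not_in[OF that, of i] permutes_not_in[OF assms(1), of i]
        by (cases "i < k") auto
    qed
  qed (use assms(2) in auto)
  have "frob k [] \<beta> = (\<Sum>\<tau> | \<tau> permutes {..<k}. if \<tau> = \<sigma> then sign \<sigma> else 0)"
    unfolding frob.simps by (rule sum.cong) (auto simp: eq)
  also have "\<dots> = sign \<sigma>" using assms(1) by simp
  finally show ?thesis .
qed

text \<open>Only rearrangements of the staircase contribute. Both factors change by the same sign
  under a rearrangement, so all \<open>k!\<close> terms agree.\<close>

lemma sum_frob_Nil:
  assumes "\<And>\<sigma>. \<sigma> permutes {..<k} \<Longrightarrow> restrict (\<lambda>i. - int (\<sigma> i)) {..<k} \<in> B"
    and "finite B" "B \<subseteq> extensional {..<k}"
  shows "(\<Sum>\<beta>\<in>B. frob k [] \<beta> * frob k \<nu> \<beta>) = fact k * frob k \<nu> (\<lambda>i. - int i)"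
proof -
  have "(\<Sum>\<beta>\<in>B. frob k [] \<beta> * frob k \<nu> \<beta>) =
    (\<Sum>\<beta>\<in>B. \<Sum>\<sigma> | \<sigma> permutes {..<k}. if \<beta> = restrict (\<lambda>i. - int (\<sigma> i)) {..<k} then sign \<sigma> * frob k \<nu> \<beta> else 0)"
  proof (rule sum.cong[OF refl])
    fix \<beta> assume "\<beta> \<in> B"
    then have "\<beta> \<in> extensional {..<k}" using assms(3) by blast
    then have "(\<forall>i<k. \<beta> i = - int (\<sigma> i)) \<longleftrightarrow> \<beta> = restrict (\<lambda>i. - int (\<sigma> i)) {..<k}" for \<sigma>
      by (auto simp: extensional_def fun_eq_iff)
    then show "frob k [] \<beta> * frob k \<nu> \<beta> =
       (\<Sum>\<sigma> | \<sigma> permutes {..<k}. if \<beta> = restrict (\<lambda>i. - int (\<sigma> i)) {..<k} then sign \<sigma> * frob k \<nu> \<beta> else 0)"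
      by (simp add: sum_distrib_right if_distrib[of "\<lambda>x. x * _"] if_distrib[of "(*) _"] cong: if_cong)
  qed
  also have "\<dots> = (\<Sum>\<sigma> | \<sigma> permutes {..<k}. sign \<sigma> * frob k \<nu> (restrict (\<lambda>i. - int (\<sigma> i)) {..<k}))"
    by (subst sum.swap) (rule sum.cong, use assms(1,2) in auto)
  also have "\<dots> = (\<Sum>\<sigma> | \<sigma> permutes {..<k}. frob k \<nu> (\<lambda>i. - int i))"
  proof (rule sum.cong[OF refl])
    fix \<sigma> :: "nat \<Rightarrow> nat" assume "\<sigma> \<in> {\<sigma>. \<sigma> permutes {..<k}}"
    then have "frob k \<nu> (restrict (\<lambda>i. - int (\<sigma> i)) {..<k}) = sign \<sigma> * frob k \<nu> (\<lambda>i. - int i)"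
      using frob_comp[of \<sigma> k \<nu> "\<lambda>i. - int i"] frob_cong[of k "restrict (\<lambda>i. - int (\<sigma> i)) {..<k}" "(\<lambda>i. - int i) \<circ> \<sigma>" \<nu>]
      by simp
    then show "sign \<sigma> * frob k \<nu> (restrict (\<lambda>i. - int (\<sigma> i)) {..<k}) = frob k \<nu> (\<lambda>i. - int i)"
      by (simp flip: mult.assoc)
  qed
  also have "\<dots> = fact k * frob k \<nu> (\<lambda>i. - int i)"
    by (simp add: card_permutations[OF refl])
  finally show ?thesis .
qed

lemma frob_zero_config:
  assumes "0 \<notin> set \<nu>"
  shows "frob k \<nu> (\<lambda>i. - int i) = (if \<nu> = [] then 1 else 0)"
proof (cases "\<nu> = []")
  case True
  then show ?thesis using frob_Nil_negated_permutation[of id k "\<lambda>i. - int i"] by (simp add: permutes_id)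
next
  case False
  then have "sum_list \<nu> \<noteq> 0" using assms by (cases \<nu>) auto
  then show ?thesis using frob_nonzero_sum[of k \<nu> "\<lambda>i. - int i"] False 
    by (cases "frob k \<nu> (\<lambda>i. - int i) = 0") (simp_all del: sum_list_eq_0_iff)
qed

text \<open>
  Summing over all bead configurations in a box, rather than over partitions, turns the adjunction
  between raising and lowering beads into a plain shift of the summation variable.
\<close>

lemma frob_column_orthogonality:
  assumes "0 \<notin> set \<mu>" "0 \<notin> set \<nu>" "sum_list \<mu> \<le> n" "sum_list \<nu> \<le> n" "2 * n \<le> k"
  shows "(\<Sum>\<beta>\<in>{..<k} \<rightarrow>\<^sub>E {- int k<..int n}. frob k \<mu> \<beta> * frob k \<nu> \<beta>)
    = fact k * int (centralizer_order \<mu> (mset \<nu>))"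
  using assms
proof (induction \<mu> arbitrary: \<nu>)
  case Nil
  have "(\<Sum>\<beta>\<in>{..<k} \<rightarrow>\<^sub>E {- int k<..int n}. frob k [] \<beta> * frob k \<nu> \<beta>) = fact k * frob k \<nu> (\<lambda>i. - int i)"
  proof (rule sum_frob_Nil)
    fix \<sigma> :: "nat \<Rightarrow> nat" assume "\<sigma> permutes {..<k}"
    then have "\<sigma> i < k" if "i < k" for i using that permutes_in_image[of \<sigma> "{..<k}" i] by simp
    then show "restrict (\<lambda>i. - int (\<sigma> i)) {..<k} \<in> {..<k} \<rightarrow>\<^sub>E {- int k<..int n}" by auto
  next
    show "finite ({..<k} \<rightarrow>\<^sub>E {- int k<..int n})" by (intro finite_PiE) auto
  qed (auto simp: PiE_def)
  then show ?case using Nil by (simp add: frob_zero_config)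
next
  case (Cons r \<mu>)
  let ?B = "{..<k} \<rightarrow>\<^sub>E {- int k<..int n}"
  have finB: "finite ?B" by (intro finite_PiE) auto
  have r: "1 \<le> r" "r \<le> n" using Cons.prems by auto
  \<comment> \<open>The box is not invariant under the shift, but terms that leave it vanish:
    downwards through the first factor, upwards through the second.\<close>
  have shift: "(\<Sum>\<beta>\<in>?B. frob k \<mu> (\<beta>(i := \<beta> i - int r)) * frob k \<nu> \<beta>) =
      (\<Sum>\<gamma>\<in>?B. frob k \<mu> \<gamma> * frob k \<nu> (\<gamma>(i := \<gamma> i + int r)))" if i: "i < k" for i
  proof (rule sum.reindex_bij_witness_not_neutral[where
        j = "\<lambda>\<beta>. \<beta>(i := \<beta> i - int r)" and i = "\<lambda>\<gamma>. \<gamma>(i := \<gamma> i + int r)" and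
        S' = "{\<beta>\<in>?B. frob k \<mu> (\<beta>(i := \<beta> i - int r)) * frob k \<nu> \<beta> = 0}" and
        T' = "{\<gamma>\<in>?B. frob k \<mu> \<gamma> * frob k \<nu> (\<gamma>(i := \<gamma> i + int r)) = 0}"])
    fix a assume a: "a \<in> ?B - {\<beta>\<in>?B. frob k \<mu> (\<beta>(i := \<beta> i - int r)) * frob k \<nu> \<beta> = 0}"
    then have "frob k \<mu> (a(i := a i - int r)) \<noteq> 0" by auto
    from frob_nonzero_lower[OF this i] have "- int k < a i - int r" by simp
    moreover have "a i \<le> int n" using a i by (auto simp: PiE_iff)
    then have "a i - int r \<le> int n" by simp
    ultimately have "a(i := a i - int r) \<in> ?B" using a i by (auto simp: PiE_iff extensional_def)
    moreover have "(a(i := a i - int r))(i := (a(i := a i - int r)) i + int r) = a"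
      by (simp add: fun_eq_iff)
    ultimately show "a(i := a i - int r) \<in> ?B - {\<gamma>\<in>?B. frob k \<mu> \<gamma> * frob k \<nu> (\<gamma>(i := \<gamma> i + int r)) = 0}"
      using a by (simp del: fun_upd_apply)
  next
    fix a assume a: "a \<in> ?B - {\<gamma>\<in>?B. frob k \<mu> \<gamma> * frob k \<nu> (\<gamma>(i := \<gamma> i + int r)) = 0}"
    then have "frob k \<nu> (a(i := a i + int r)) \<noteq> 0" by auto
    from frob_nonzero_upper[OF this i] have "a i + int r \<le> int n" using Cons.prems by simp
    moreover have "- int k < a i" using a i by (auto simp: PiE_iff)
    then have "- int k < a i + int r" by simp
    ultimately have "a(i := a i + int r) \<in> ?B" using a i by (auto simp: PiE_iff extensional_def)
    moreover have "(a(i := a i + int r))(i := (a(i := a i + int r)) i - int r) = a"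
      by (simp add: fun_eq_iff)
    ultimately show "a(i := a i + int r) \<in> ?B - {\<beta>\<in>?B. frob k \<mu> (\<beta>(i := \<beta> i - int r)) * frob k \<nu> \<beta> = 0}"
      using a by (simp del: fun_upd_apply)
  qed (use finB in auto)
  have "(\<Sum>\<beta>\<in>?B. frob k (r # \<mu>) \<beta> * frob k \<nu> \<beta>) = (\<Sum>\<beta>\<in>?B. \<Sum>i<k. frob k \<mu> (\<beta>(i := \<beta> i - int r)) * frob k \<nu> \<beta>)"
    by (simp add: sum_distrib_right del: fun_upd_apply)
  also have "\<dots> = (\<Sum>i<k. \<Sum>\<gamma>\<in>?B. frob k \<mu> \<gamma> * frob k \<nu> (\<gamma>(i := \<gamma> i + int r)))"
    by (subst sum.swap) (rule sum.cong[OF refl], use shift in simp)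
  also have "\<dots> = (\<Sum>\<gamma>\<in>?B. frob k \<mu> \<gamma> * (\<Sum>i<k. frob k \<nu> (\<gamma>(i := \<gamma> i + int r))))"
    by (subst sum.swap) (simp add: sum_distrib_left del: fun_upd_apply)
  also have "\<dots> = (\<Sum>\<gamma>\<in>?B. frob k \<mu> \<gamma> * (int r * int (count_list \<nu> r) * frob k (remove1 r \<nu>) \<gamma>))"
  proof (rule sum.cong[OF refl])
    fix \<gamma> assume g: "\<gamma> \<in> ?B"
    show "frob k \<mu> \<gamma> * (\<Sum>i<k. frob k \<nu> (\<gamma>(i := \<gamma> i + int r))) =
       frob k \<mu> \<gamma> * (int r * int (count_list \<nu> r) * frob k (remove1 r \<nu>) \<gamma>)"
    proof (cases "frob k \<mu> \<gamma> = 0")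
      case nz: False
      have "(\<Sum>i<k. frob k \<nu> (\<gamma>(i := \<gamma> i + int r))) = int r * int (count_list \<nu> r) * frob k (remove1 r \<nu>) \<gamma>"
      proof (rule sum_frob_raise)
        show "s \<le> n" if "s \<in> set \<nu>" for s using member_le_sum_list[OF that] Cons.prems by simp
        show "- int k < \<gamma> i" if "i < k" for i using g that by (auto simp: PiE_iff)
        \<comment> \<open>Here \<open>2 * n \<le> k\<close> enters: it gives
          \<open>- k + n \<le> - n\<close>, so nonvanishing of the other factor guarantees the
          filled bottom.\<close>
        show "\<exists>i<k. \<gamma> i = v" if "- int k < v" "v \<le> - int k + int n" for v
          by (rule frob_nonzero_low_beads[OF nz]) (use Cons.prems that in auto)
      qed (use Cons.prems r in auto)
      then show ?thesis by simp
    qed simp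
  qed
  also have "\<dots> = int r * int (count_list \<nu> r) * (\<Sum>\<gamma>\<in>?B. frob k \<mu> \<gamma> * frob k (remove1 r \<nu>) \<gamma>)"
    by (simp add: sum_distrib_left mult_ac)
  also have "\<dots> = int r * int (count_list \<nu> r) * (fact k * int (centralizer_order \<mu> (mset (remove1 r \<nu>))))"
  proof (cases "r \<in> set \<nu>")
    case True
    have "sum_list (remove1 r \<nu>) \<le> sum_list \<nu>" using sum_list_map_remove1[OF True, of id] by simp
    then show ?thesis using Cons.prems set_remove1_subset[of r \<nu>] by (subst Cons.IH) auto
  qed (simp add: count_list_0_iff)
  finally show ?case by (simp add: flip: count_mset)
qed

section \<open>Complementary bead configurations and conjugate partitions\<close>

lemma permutes_if_inj_on:
  assumes "finite A" "inj_on f A" "\<And>x. x \<in> A \<Longrightarrow> f x \<in> A" "\<And>x. x \<notin> A \<Longrightarrow> f x = x"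
  shows "f permutes A"
proof (rule bij_imp_permutes[OF _ assms(4)])
  show "bij_betw f A A"
    using assms(1-3) endo_inj_surj[of A f] by (auto simp: bij_betw_def image_subset_iff)
qed

lemma less_double_cases:
  obtains "x < k" | j where "x = k + j" "j < k" | "\<not> x < 2 * (k::nat)"
proof -
  have "x = k + (x - k) \<and> x - k < k" if "\<not> x < k" "x < 2 * k" using that by linarith
  then show ?thesis using that by blast
qed

text \<open>
  The beads \<open>\<beta>\<close> and the reflected beads \<open>1 - \<gamma>\<close> together fill \<open>{1 - k..k}\<close>, numbered downwards
  from \<open>k\<close>. Lowering a bead of \<open>\<beta>\<close> into a gap lowers a bead of \<open>\<gamma>\<close> and exchanges two values of
  the merged permutation.
\<close>

definition merge_beads :: "nat \<Rightarrow> (nat \<Rightarrow> int) \<Rightarrow> (nat \<Rightarrow> int) \<Rightarrow> nat \<Rightarrow> nat" where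
  "merge_beads k \<beta> \<gamma> x =
     (if x < k then nat (int k - \<beta> x) else if x < 2 * k then nat (\<gamma> (x - k) + int k - 1) else x)"

text \<open>The range conditions keep the truncating \<open>nat\<close> in
  \<open>merge_beads\<close> faithful, so that the permutation condition really says that \<beta>
  and the reflection of \<gamma> share out the \<open>2 * k\<close> positions.\<close>

definition complementary :: "nat \<Rightarrow> (nat \<Rightarrow> int) \<Rightarrow> (nat \<Rightarrow> int) \<Rightarrow> bool" where
  "complementary k \<beta> \<gamma> \<longleftrightarrow>
     (\<forall>i<k. - int k < \<beta> i \<and> \<beta> i \<le> int k \<and> - int k < \<gamma> i \<and> \<gamma> i \<le> int k) \<and>
     merge_beads k \<beta> \<gamma> permutes {..<2 * k}"

text \<open>By cardinality, \<open>k\<close> beads at nonpositive positions occupy all of these,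
  which leaves exactly the positive positions to the reflected beads \<open>1 - \<gamma>\<close>.
  This settles when the base case of \<open>frob\<close> vanishes.\<close>

lemma complementary_nonpos_iff:
  assumes "complementary k \<beta> \<gamma>"
  shows "(\<forall>i<k. \<beta> i \<le> 0) \<longleftrightarrow> (\<forall>i<k. \<gamma> i \<le> 0)"
proof -
  let ?P = "merge_beads k \<beta> \<gamma>"
  have P: "?P permutes {..<2 * k}" using assms by (simp add: complementary_def)
  have un: "?P ` {..<k} \<union> ?P ` {k..<2 * k} = {..<2 * k}"
    using permutes_image[OF P] by (metis image_Un ivl_disj_un_one(2) le_add2 mult_2)
  have dis: "?P ` {..<k} \<inter> ?P ` {k..<2 * k} = {}"
    using permutes_inj[OF P] by (auto simp: inj_eq)
  have c1: "card (?P ` {..<k}) = k" and c2: "card (?P ` {k..<2 * k}) = k"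
    using card_image[OF permutes_inj_on[OF P, of "{..<k}"]] card_image[OF permutes_inj_on[OF P, of "{k..<2 * k}"]]
    by simp_all
  have A: "(\<forall>i<k. \<beta> i \<le> 0) \<longleftrightarrow> ?P ` {..<k} = {k..<2 * k}"
  proof
    assume "\<forall>i<k. \<beta> i \<le> 0"
    then have "?P ` {..<k} \<subseteq> {k..<2 * k}" using assms
      by (fastforce simp: merge_beads_def complementary_def)
    then show "?P ` {..<k} = {k..<2 * k}" by (intro card_subset_eq) (use c1 in auto)
  next
    assume "?P ` {..<k} = {k..<2 * k}"
    then have "?P i \<ge> k" if "i < k" for i using that by auto
    then show "\<forall>i<k. \<beta> i \<le> 0" by (fastforce simp: merge_beads_def)
  qed
  have B: "(\<forall>i<k. \<gamma> i \<le> 0) \<longleftrightarrow> ?P ` {k..<2 * k} = {..<k}"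
  proof
    assume *: "\<forall>i<k. \<gamma> i \<le> 0"
    have "?P x < k" if "x \<in> {k..<2 * k}" for x
    proof -
      have "x - k < k" using that by auto
      then have "\<gamma> (x - k) \<le> 0" using * by blast
      then show ?thesis using that by (auto simp: merge_beads_def)
    qed
    then have "?P ` {k..<2 * k} \<subseteq> {..<k}" by auto
    then show "?P ` {k..<2 * k} = {..<k}" by (intro card_subset_eq) (use c2 in auto)
  next
    assume *: "?P ` {k..<2 * k} = {..<k}"
    have "?P (k + i) < k" if "i < k" for i using that * by auto
    then show "\<forall>i<k. \<gamma> i \<le> 0" by (fastforce simp: merge_beads_def)
  qed
  have X: "?P ` {..<k} = {..<2 * k} - ?P ` {k..<2 * k}" and Y: "?P ` {k..<2 * k} = {..<2 * k} - ?P ` {..<k}"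
    using un dis by blast+
  show ?thesis unfolding A B
  proof
    assume "?P ` {..<k} = {k..<2 * k}" then show "?P ` {k..<2 * k} = {..<k}" by (subst Y) auto
  next
    assume "?P ` {k..<2 * k} = {..<k}" then show "?P ` {..<k} = {k..<2 * k}" by (subst X) auto
  qed
qed

lemma complementary_inj_on:
  assumes "complementary k \<beta> \<gamma>"
  shows "inj_on \<beta> {..<k}" "inj_on \<gamma> {..<k}"
proof -
  have P: "inj (merge_beads k \<beta> \<gamma>)" using assms permutes_inj by (auto simp: complementary_def)
  have "i = j" if "i < k" "j < k" "\<beta> i = \<beta> j" for i j
    using injD[OF P, of i j] that by (simp add: merge_beads_def)
  then show "inj_on \<beta> {..<k}" by (auto simp: inj_on_def)
  have "i = j" if "i < k" "j < k" "\<gamma> i = \<gamma> j" for i j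
    using injD[OF P, of "k + i" "k + j"] that by (simp add: merge_beads_def)
  then show "inj_on \<gamma> {..<k}" by (auto simp: inj_on_def)
qed

lemma nonpos_beads_permutation:
  assumes "inj_on \<beta> {..<k}" "\<And>i. i < k \<Longrightarrow> - int k < \<beta> i \<and> \<beta> i \<le> 0"
  obtains \<sigma> where "\<sigma> permutes {..<k}" "\<And>i. i < k \<Longrightarrow> \<beta> i = - int (\<sigma> i)"
proof
  let ?s = "\<lambda>i. if i < k then nat (- \<beta> i) else i"
  show "?s permutes {..<k}"
  proof (rule permutes_if_inj_on)
    show "inj_on ?s {..<k}"
    proof (rule inj_onI)
      fix x y assume xy: "x \<in> {..<k}" "y \<in> {..<k}" "?s x = ?s y"
      then have "\<beta> x = \<beta> y" using assms(2)[of x] assms(2)[of y] by auto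
      then show "x = y" using assms(1) xy by (auto dest: inj_onD)
    qed
    show "?s i \<in> {..<k}" if "i \<in> {..<k}" for i using assms(2)[of i] that by auto
  qed auto
  show "\<beta> i = - int (?s i)" if "i < k" for i using assms(2)[OF that] that by auto
qed

text \<open>The merged permutation factors through that of the two staircases, preceded by \<sigma>
  on the first block and a copy of \<tau> on the second.\<close>

lemma sign_merge_beads_base:
  assumes "\<sigma> permutes {..<k}" "\<tau> permutes {..<k}"
    and "\<And>i. i < k \<Longrightarrow> \<beta> i = - int (\<sigma> i)" "\<And>i. i < k \<Longrightarrow> \<gamma> i = - int (\<tau> i)"
    and "complementary k \<beta> \<gamma>"
  shows "sign (merge_beads k \<beta> \<gamma>) =
    sign (merge_beads k (\<lambda>i. - int i) (\<lambda>i. - int i)) * sign \<sigma> * sign \<tau>"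
proof -
  let ?P0 = "merge_beads k (\<lambda>i. - int i) (\<lambda>i. - int i)"
  let ?t = "map_permutation {..<k} (\<lambda>i. k + i) \<tau>"
  have inj: "inj_on (\<lambda>i. k + i) {..<k}" by simp
  have tp: "?t permutes {k..<2 * k}"
  proof (rule map_permutation_permutes[OF _ assms(2)])
    show "bij_betw (\<lambda>i. k + i) {..<k} {k..<2 * k}"
      by (rule bij_betw_byWitness[where f' = "\<lambda>i. i - k"]) auto
  qed
  have st: "sign ?t = sign \<tau>" using assms(2) by (intro sign_map_permutation) auto
  have s1: "\<sigma> i < k" "\<tau> i < k" if "i < k" for i
    using that permutes_in_image[OF assms(1), of i] permutes_in_image[OF assms(2), of i] by simp_all
  have t_low: "?t x = x" if "x < k" for x using permutes_not_in[OF tp, of x] that by simp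
  have t_hi: "?t x = x" if "\<not> x < 2 * k" for x using permutes_not_in[OF tp, of x] that by simp
  have t_mid: "?t (k + j) = k + \<tau> j" if "j < k" for j
    using map_permutation_apply[OF inj, of j \<tau>] that by simp
  have P0inv: "?P0 permutes {..<2 * k}"
  proof (rule permutes_if_inj_on)
    show "inj_on ?P0 {..<2 * k}"
      by (auto simp: inj_on_def merge_beads_def nat_eq_iff split: if_splits)
  qed (auto simp: merge_beads_def)
  have eq: "merge_beads k \<beta> \<gamma> = ?P0 \<circ> (\<sigma> \<circ> ?t)"
  proof
    fix x show "merge_beads k \<beta> \<gamma> x = (?P0 \<circ> (\<sigma> \<circ> ?t)) x"
    proof (cases x k rule: less_double_cases)
      case 1 then show ?thesis using assms(3)[of x] s1[of x] t_low by (simp add: merge_beads_def)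
    next
      case (2 j)
      then have "\<sigma> (k + \<tau> j) = k + \<tau> j" using permutes_not_in[OF assms(1)] by simp
      then show ?thesis using 2 assms(4)[of j] s1[of j] t_mid[of j] by (simp add: merge_beads_def)
    next
      case 3
      then have "\<sigma> x = x" using permutes_not_in[OF assms(1)] by simp
      then show ?thesis using 3 t_hi by (simp add: merge_beads_def)
    qed
  qed
  have perm: "permutation ?P0" "permutation \<sigma>" "permutation ?t"
    using P0inv assms(1) tp by (auto simp: permutation_permutes)
  show ?thesis unfolding eq using perm
    by (simp add: sign_compose permutation_compose st)
qed

text \<open>By \<open>rel\<close>, the target \<open>\<beta> i - r\<close> is the position
  \<open>1 - \<gamma> j\<close>, and the reflected bead moves to \<open>\<beta> i\<close>. The two
  exchange places, so the merge is followed by one transposition.\<close>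

lemma complementary_move:
  assumes c: "complementary k \<beta> \<gamma>" and ij: "i < k" "j < k" and r: "0 < r"
    and rel: "\<beta> i + \<gamma> j = 1 + int r"
  shows "complementary k (\<beta>(i := \<beta> i - int r)) (\<gamma>(j := \<gamma> j - int r))"
    and "sign (merge_beads k (\<beta>(i := \<beta> i - int r)) (\<gamma>(j := \<gamma> j - int r))) = - sign (merge_beads k \<beta> \<gamma>)"
proof -
  let ?P = "merge_beads k \<beta> \<gamma>" and ?P' = "merge_beads k (\<beta>(i := \<beta> i - int r)) (\<gamma>(j := \<gamma> j - int r))"
  have P: "?P permutes {..<2 * k}" using c by (simp add: complementary_def)
  have b: "- int k < \<beta> x \<and> \<beta> x \<le> int k \<and> - int k < \<gamma> x \<and> \<gamma> x \<le> int k" if "x < k" for x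
    using c that by (simp add: complementary_def)
  have Pi: "?P i = nat (int k - \<beta> i)" and Pj: "?P (k + j) = nat (\<gamma> j + int k - 1)"
    using ij by (simp_all add: merge_beads_def)
  have eq: "?P' = transpose (?P i) (?P (k + j)) \<circ> ?P"
  proof
    fix x
    consider "x = i" | "x = k + j" | "x \<noteq> i" "x \<noteq> k + j" by blast
    then show "?P' x = (transpose (?P i) (?P (k + j)) \<circ> ?P) x"
    proof cases
      case 1
      have "?P' i = ?P (k + j)" using ij rel Pj by (simp add: merge_beads_def algebra_simps)
      then show ?thesis using 1 by simp
    next
      case 2
      have "?P' (k + j) = ?P i" using ij rel Pi by (simp add: merge_beads_def algebra_simps)
      then show ?thesis using 2 by simp
    next
      case 3
      then have "?P x \<noteq> ?P i" "?P x \<noteq> ?P (k + j)" using permutes_inj[OF P] by (auto simp: inj_eq)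
      moreover have "?P' x = ?P x" using 3 by (auto simp: merge_beads_def)
      ultimately show ?thesis by simp
    qed
  qed
  have tr: "transpose (?P i) (?P (k + j)) permutes {..<2 * k}"
    using permutes_in_image[OF P, of i] permutes_in_image[OF P, of "k + j"] ij
    by (intro permutes_swap_id) auto
  have ne: "?P i \<noteq> ?P (k + j)" using permutes_inj[OF P] ij by (auto simp: inj_eq)
  have "- int k < \<beta> i - int r" "- int k < \<gamma> j - int r" using b[OF ij(1)] b[OF ij(2)] rel by linarith+
  then show "complementary k (\<beta>(i := \<beta> i - int r)) (\<gamma>(j := \<gamma> j - int r))"
    unfolding complementary_def eq
    using permutes_compose[OF P tr] b b[OF ij(1)] b[OF ij(2)] by auto
  show "sign ?P' = - sign ?P"
    unfolding eq using P tr ne by (subst sign_compose) (auto simp: permutation_permutes sign_swap_id)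
qed

text \<open>This is the involution exchanging elementary and complete symmetric functions, which
  multiplies each power sum by a sign. Lowerings into gaps correspond on both sides, each flips the
  sign of the merge, and one flip per part gives \<open>(-1) ^ length \<mu>\<close>.\<close>

lemma frob_complementary:
  assumes "complementary k \<beta> \<gamma>" "0 \<notin> set \<mu>"
  shows "frob k \<mu> \<beta> =
    sign (merge_beads k (\<lambda>i. - int i) (\<lambda>i. - int i)) * (-1) ^ length \<mu> * sign (merge_beads k \<beta> \<gamma>) * frob k \<mu> \<gamma>"
  using assms
proof (induction \<mu> arbitrary: \<beta> \<gamma>)
  case Nil
  note inj = complementary_inj_on[OF Nil.prems(1)]
  have b: "- int k < \<beta> x \<and> - int k < \<gamma> x" if "x < k" for x
    using Nil.prems that by (simp add: complementary_def)
  show ?case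
  proof (cases "\<forall>i<k. \<beta> i \<le> 0")
    case True
    obtain \<sigma> where s: "\<sigma> permutes {..<k}" "\<And>i. i < k \<Longrightarrow> \<beta> i = - int (\<sigma> i)"
      using nonpos_beads_permutation[OF inj(1)] b True by metis
    obtain \<tau> where t: "\<tau> permutes {..<k}" "\<And>i. i < k \<Longrightarrow> \<gamma> i = - int (\<tau> i)"
      using nonpos_beads_permutation[OF inj(2)] b True complementary_nonpos_iff[OF Nil.prems(1)] by metis
    show ?thesis
      by (simp add: frob_Nil_negated_permutation[OF s] frob_Nil_negated_permutation[OF t]
        sign_merge_beads_base[OF s(1) t(1) s(2) t(2) Nil.prems(1)] del: frob.simps)
  next
    case False
    then have "\<not> (\<forall>i<k. \<gamma> i \<le> 0)" using complementary_nonpos_iff[OF Nil.prems(1)] by blast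
    then have "frob k [] \<gamma> = 0" "frob k [] \<beta> = 0"
      using False frob_nonzero_upper[of k "[]"] by (auto simp del: frob.simps)
    then show ?thesis by (simp del: frob.simps)
  qed
next
  case (Cons r \<mu>)
  let ?K = "sign (merge_beads k (\<lambda>i. - int i) (\<lambda>i. - int i))"
  let ?P = "merge_beads k \<beta> \<gamma>"
  have P: "?P permutes {..<2 * k}" using Cons.prems(1) by (simp add: complementary_def)
  have b: "- int k < \<beta> x \<and> \<beta> x \<le> int k \<and> - int k < \<gamma> x \<and> \<gamma> x \<le> int k" if "x < k" for x
    using Cons.prems(1) that by (simp add: complementary_def)
  have r: "0 < r" using Cons.prems by auto
  have zero: "frob k \<mu> (\<delta>(i := \<delta> i - int r)) = 0"
    if h: "i < k" "\<delta> i - int r \<le> - int k \<or> \<delta> i - int r \<in> \<delta> ` {..<k}" for \<delta> i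
  proof (cases "\<delta> i - int r \<le> - int k")
    case True
    then show ?thesis using frob_nonzero_lower[OF _ h(1), of \<mu> "\<delta>(i := \<delta> i - int r)"] by fastforce
  next
    case False
    then obtain j where "j < k" "\<delta> j = \<delta> i - int r" using h by auto
    moreover then have "j \<noteq> i" using r by auto
    ultimately show ?thesis using h(1) by (intro frob_eq_0_collision[of i _ j]) auto
  qed
  \<comment> \<open>Lowerings onto an occupied position or past the bottom contribute nothing, so
    only moves into gaps need a partner.\<close>
  define I where "I = {i. i < k \<and> - int k < \<beta> i - int r \<and> \<beta> i - int r \<notin> \<beta> ` {..<k}}"
  define J where "J = {j. j < k \<and> - int k < \<gamma> j - int r \<and> \<gamma> j - int r \<notin> \<gamma> ` {..<k}}"
  define R where "R = (\<lambda>i j. \<beta> i + \<gamma> j = 1 + int r)"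
  have excl: "\<beta> i + \<gamma> j \<noteq> 1" if "i < k" "j < k" for i j
  proof
    assume "\<beta> i + \<gamma> j = 1"
    then have "?P i = ?P (k + j)" using that by (simp add: merge_beads_def algebra_simps)
    then show False using permutes_inj[OF P] that by (auto simp: inj_eq)
  qed
  have cover: "(\<exists>i<k. \<beta> i = v) \<or> (\<exists>j<k. \<gamma> j = 1 - v)" if "- int k < v" "v \<le> int k" for v
  proof -
    have "nat (int k - v) \<in> ?P ` {..<2 * k}" unfolding permutes_image[OF P] using that by auto
    then obtain x where x: "x < 2 * k" "?P x = nat (int k - v)" by auto
    show ?thesis
    proof (cases "x < k")
      case True
      then have "\<beta> x = v" using x b[of x] that by (simp add: merge_beads_def nat_eq_iff split: if_splits)
      then show ?thesis using True by blast
    next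
      case False
      then have xk: "x - k < k" using x by simp
      then have "\<gamma> (x - k) = 1 - v" using x False b[OF xk] that
        by (auto simp add: merge_beads_def nat_eq_iff split: if_splits)
      then show ?thesis using xk by blast
    qed
  qed
  \<comment> \<open>The gap entered by bead \<open>i\<close> of \<beta> is the reflection of one
    bead \<open>j\<close> of \<gamma>; that bead in turn moves to \<open>1 - \<beta> i\<close>,
    which is free by \<open>excl\<close>.\<close>
  have I: "\<exists>!j. j \<in> J \<and> R i j" if "i \<in> I" for i
  proof -
    have i: "i < k" "- int k < \<beta> i - int r" "\<beta> i - int r \<notin> \<beta> ` {..<k}" using that by (auto simp: I_def)
    then obtain j where j: "j < k" "\<gamma> j = 1 - (\<beta> i - int r)" using cover[of "\<beta> i - int r"] b[OF i(1)]
      by force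
    have "\<gamma> j - int r \<notin> \<gamma> ` {..<k}" using excl[OF i(1)] j by fastforce
    then have "j \<in> J" "R i j" using j b[OF i(1)] by (auto simp: J_def R_def)
    then show ?thesis using complementary_inj_on(2)[OF Cons.prems(1)]
      by (intro ex1I[of _ j]) (auto simp: R_def J_def inj_on_def)
  qed
  have J: "\<exists>!i. i \<in> I \<and> R i j" if "j \<in> J" for j
  proof -
    have j: "j < k" "- int k < \<gamma> j - int r" "\<gamma> j - int r \<notin> \<gamma> ` {..<k}" using that by (auto simp: J_def)
    then obtain i where i: "i < k" "\<beta> i = 1 - (\<gamma> j - int r)" using cover[of "1 - (\<gamma> j - int r)"] b[OF j(1)]
      by force
    have "\<beta> i - int r \<notin> \<beta> ` {..<k}" using excl[OF _ j(1)] i by fastforce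
    then have "i \<in> I" "R i j" using i b[OF j(1)] by (auto simp: I_def R_def)
    then show ?thesis using complementary_inj_on(1)[OF Cons.prems(1)]
      by (intro ex1I[of _ i]) (auto simp: R_def I_def inj_on_def)
  qed
  have "frob k (r # \<mu>) \<beta> = (\<Sum>i\<in>I. frob k \<mu> (\<beta>(i := \<beta> i - int r)))"
    unfolding frob.simps by (rule sum.mono_neutral_right) (auto simp: I_def intro!: zero)
  also have "\<dots> = (\<Sum>j\<in>J. ?K * (-1) ^ length \<mu> * - sign ?P * frob k \<mu> (\<gamma>(j := \<gamma> j - int r)))"
  proof (rule sum.reindex_bij_witness[where i = "\<lambda>j. THE i. i \<in> I \<and> R i j" and j
    = "\<lambda>i. THE j. j \<in> J \<and> R i j"])
    fix i assume i: "i \<in> I"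
    let ?j = "THE j. j \<in> J \<and> R i j"
    have j: "?j \<in> J" "R i ?j" using theI'[OF I[OF i]] by auto
    then show "?j \<in> J" by simp
    show "(THE i. i \<in> I \<and> R i ?j) = i" using the1_equality[OF J[OF j(1)]] i j by blast
    have lt: "i < k" "?j < k" using i j by (auto simp: I_def J_def)
    have rel: "\<beta> i + \<gamma> ?j = 1 + int r" using j(2) by (simp only: R_def)
    note m = complementary_move[OF Cons.prems(1) lt r rel]
    show "?K * (-1) ^ length \<mu> * - sign ?P * frob k \<mu> (\<gamma>(?j := \<gamma> ?j - int r))
      = frob k \<mu> (\<beta>(i := \<beta> i - int r))"
      using Cons.IH[OF m(1)] m(2) Cons.prems(2) by (simp del: fun_upd_apply)
  next
    fix j assume j: "j \<in> J"
    let ?i = "THE i. i \<in> I \<and> R i j"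
    have i: "?i \<in> I" "R ?i j" using theI'[OF J[OF j]] by auto
    then show "?i \<in> I" by simp
    show "(THE j. j \<in> J \<and> R ?i j) = j" using the1_equality[OF I[OF i(1)]] i j by blast
  qed
  also have "\<dots> = ?K * (-1) ^ length \<mu> * - sign ?P * (\<Sum>j\<in>J. frob k \<mu> (\<gamma>(j := \<gamma> j - int r)))"
    by (simp only: sum_distrib_left)
  also have "(\<Sum>j\<in>J. frob k \<mu> (\<gamma>(j := \<gamma> j - int r))) = frob k (r # \<mu>) \<gamma>"
    unfolding frob.simps by (rule sum.mono_neutral_left) (auto simp: J_def intro!: zero)
  finally show ?case by (simp del: frob.simps)
qed

section \<open>Conjugate partitions as complementary bead configurations\<close>

definition beads :: "(nat \<Rightarrow> nat) \<Rightarrow> nat \<Rightarrow> int" where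
  "beads f i = int (f i) - int i"

definition conj_part :: "nat \<Rightarrow> (nat \<Rightarrow> nat) \<Rightarrow> nat \<Rightarrow> nat" where
  "conj_part k f j = card {i. i < k \<and> j < f i}"

text \<open>Since \<open>f\<close> is weakly decreasing, the rows longer than \<open>j\<close> form
  an initial segment, whose length is the conjugate part.\<close>

lemma conj_part_gt_iff:
  assumes "antimono f" "i < k"
  shows "i < conj_part k f j \<longleftrightarrow> j < f i"
proof
  assume "j < f i"
  then have "{..i} \<subseteq> {i. i < k \<and> j < f i}"
    using assms by (auto simp: antimono_def intro: le_less_trans less_le_trans)
  from card_mono[OF _ this] show "i < conj_part k f j" by (simp add: conj_part_def)
next
  assume *: "i < conj_part k f j"
  show "j < f i"
  proof (rule ccontr)
    assume "\<not> j < f i"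
    then have "{i. i < k \<and> j < f i} \<subseteq> {..<i}"
      using assms(1) by (auto simp: antimono_def) (meson le_less_trans less_le_trans not_le)
    from card_mono[OF _ this] show False using * by (simp add: conj_part_def)
  qed
qed

lemma conj_part_le: "conj_part k f j \<le> k"
proof -
  have "card {i. i < k \<and> j < f i} \<le> card {..<k}" by (rule card_mono) auto
  then show ?thesis by (simp add: conj_part_def)
qed

text \<open>The two bead sets record the two kinds of steps along the boundary of the diagram. Row
  \<open>i\<close> and column \<open>j\<close> cannot clash: \<open>j < f i\<close> and
  \<open>i < conj_part k f j\<close> hold or fail together by \<open>conj_part_gt_iff\<close>, and
  the difference of the two positions is negative in one case and positive in the other.\<close>

lemma complementary_conj:
  assumes "antimono f" "\<And>i. f i \<le> k"
  shows "complementary k (beads f) (beads (conj_part k f))"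
proof -
  let ?g = "conj_part k f"
  let ?P = "merge_beads k (beads f) (beads ?g)"
  have gle: "?g j \<le> k" for j by (rule conj_part_le)
  have gmono: "?g j \<le> ?g i" if "i \<le> j" for i j
    unfolding conj_part_def by (rule card_mono) (use that in auto)
  have fmono: "f j \<le> f i" if "i \<le> j" for i j using assms(1) that by (simp add: antimono_def)
  have lo: "?P i = k + i - f i" if "i < k" for i
    using that by (simp add: merge_beads_def beads_def assms(2) le_add1 trans_le_add1 nat_diff_distrib' nat_add_distrib)
  have hi: "?P (k + j) = k - 1 - j + ?g j" if "j < k" for j
    using that by (simp add: merge_beads_def beads_def)
  have "inj_on ?P {..<2 * k}"
  proof (rule linorder_inj_onI)
    fix x y assume xy: "x < y" "x \<in> {..<2 * k}" "y \<in> {..<2 * k}"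
    consider "y < k" | j where "x < k" "y = k + j" "j < k" | i j where "x = k + i" "y
      = k + j" "i < j" "j < k"
      using xy by (cases x k rule: less_double_cases; cases y k rule: less_double_cases) auto
    then show "?P x \<noteq> ?P y"
    proof cases
      case 1
      then show ?thesis using xy lo[of x] lo[of y] fmono[of x y] assms(2)[of x] by simp
    next
      case 2
      have "j < f x \<longleftrightarrow> x < ?g j" using conj_part_gt_iff[OF assms(1) 2(1)] by simp
      then show ?thesis using 2 lo[of x] hi[of j] assms(2)[of x] by (cases "j < f x") auto
    next
      case 3
      then show ?thesis using hi[of i] hi[of j] gmono[of i j] by simp
    qed
  qed auto
  moreover have "?P x < 2 * k" if "x < 2 * k" for x
  proof (cases x k rule: less_double_cases)
    case (2 j)
    then show ?thesis using hi[of j] gle[of j] by simp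
  qed (use lo that in auto)
  ultimately have "?P permutes {..<2 * k}"
    by (intro permutes_if_inj_on) (auto simp: merge_beads_def)
  moreover have "- int k < beads f i" "beads f i \<le> int k" "- int k < beads ?g i" "beads ?g i \<le> int k"
    if "i < k" for i
    using assms(2)[of i] gle[of i] that by (simp_all add: beads_def)
  ultimately show ?thesis by (simp add: complementary_def)
qed

section \<open>Traces and the group algebra\<close>

abbreviation (input) scl :: "complex \<Rightarrow> ('x \<Rightarrow> complex) \<Rightarrow> 'x \<Rightarrow> complex" where
  "scl a x \<equiv> (\<lambda>t. a * x t)"

definition lin_op :: "(('x \<Rightarrow> complex) \<Rightarrow> 'x \<Rightarrow> complex) \<Rightarrow> bool" where
  "lin_op f \<longleftrightarrow> (\<forall>x y. f (x + y) = f x + f y) \<and> (\<forall>a x. f (scl a x) = scl a (f x))"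

definition fin_dim :: "('x \<Rightarrow> complex) set \<Rightarrow> bool" where
  "fin_dim V \<longleftrightarrow> cfun.subspace V \<and> (\<exists>F. finite F \<and> V \<subseteq> cfun.span F)"

lemma sum_fun_apply: "(\<Sum>i\<in>I. f i) t = (\<Sum>i\<in>I. f i t :: complex)"
  by (induction I rule: infinite_finite_induct) auto

lemma lin_op_sum:
  assumes "lin_op f"
  shows "f (\<Sum>i\<in>I. scl (c i) (v i)) = (\<Sum>i\<in>I. scl (c i) (f (v i)))"
proof (induction I rule: infinite_finite_induct)
  case empty
  have "f (scl 0 0) = scl 0 (f 0)" using assms unfolding lin_op_def by blast
  then show ?case by (simp add: fun_eq_iff)
next
  case (infinite I)
  have "f (scl 0 0) = scl 0 (f 0)" using assms unfolding lin_op_def by blast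
  then show ?case using infinite by (simp add: fun_eq_iff)
next
  case (insert i I)
  have "f (\<Sum>i\<in>insert i I. scl (c i) (v i)) = f (scl (c i) (v i) + (\<Sum>i\<in>I. scl (c i) (v i)))"
    by (simp only: sum.insert[OF insert.hyps])
  also have "\<dots> = f (scl (c i) (v i)) + f (\<Sum>i\<in>I. scl (c i) (v i))" using assms unfolding lin_op_def by blast
  also have "f (scl (c i) (v i)) = scl (c i) (f (v i))" using assms unfolding lin_op_def by blast
  also have "scl (c i) (f (v i)) + f (\<Sum>i\<in>I. scl (c i) (v i)) = (\<Sum>i\<in>insert i I. scl (c i) (f (v i)))"
    by (simp only: sum.insert[OF insert.hyps] insert.IH)
  finally show ?case .
qed

text \<open>Unfolds the choice in \<open>trace_on\<close> once and for all. The chosen basis depends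
  on the subspace alone, so one finite basis serves all operators; linearity and commutation of
  traces rely on this.\<close>

lemma trace_on_basis:
  assumes "fin_dim V"
  obtains B where "finite B" "cfun.independent B" "cfun.span B = V"
    "\<And>f. trace_on V f = (\<Sum>b\<in>B. cfun.representation B (f b) b)"
proof -
  let ?P = "\<lambda>B. cfun.independent B \<and> cfun.span B = V"
  obtain F where F: "finite F" "V \<subseteq> cfun.span F" and sub: "cfun.subspace V"
    using assms by (auto simp: fin_dim_def)
  obtain B0 where B0: "B0 \<subseteq> V" "cfun.independent B0" "V \<subseteq> cfun.span B0"
    by (rule cfun.maximal_independent_subset)
  then have "?P B0" using sub cfun.span_minimal by blast
  then have P: "?P (SOME B. ?P B)" by (rule someI)
  then have "(SOME B. ?P B) \<subseteq> cfun.span F" using F(2) cfun.span_superset by blast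
  then have "finite (SOME B. ?P B)" using cfun.independent_span_bound[OF F(1)] P by blast
  then show ?thesis using that[of "SOME B. ?P B"] P by (simp add: trace_on_def Let_def)
qed

lemma trace_on_sum:
  assumes "fin_dim V" "\<And>g v. g \<in> G \<Longrightarrow> v \<in> V \<Longrightarrow> f g v \<in> V"
  shows "trace_on V (\<lambda>v t. \<Sum>g\<in>G. c g * f g v t) = (\<Sum>g\<in>G. c g * trace_on V (f g))"
proof -
  obtain B where B: "finite B" "cfun.independent B" "cfun.span B = V"
    "\<And>f. trace_on V f = (\<Sum>b\<in>B. cfun.representation B (f b) b)"
    using trace_on_basis[OF assms(1)] by blast
  have "cfun.representation B (\<lambda>t. \<Sum>g\<in>G. c g * f g b t) b = (\<Sum>g\<in>G. c g * cfun.representation B (f g b) b)"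
    if b: "b \<in> B" for b
  proof -
    have bV: "b \<in> V" using B(3) cfun.span_superset b by blast
    have eq: "(\<lambda>t. \<Sum>g\<in>G. c g * f g b t) = (\<Sum>g\<in>G. scl (c g) (f g b))"
      by (simp add: fun_eq_iff sum_fun_apply)
    have fV: "f g b \<in> cfun.span B" if "g \<in> G" for g using assms(2)[OF that bV] B(3) by simp
    then show ?thesis unfolding eq
      by (subst cfun.representation_sum[OF B(2)]) (auto intro: cfun.span_scale simp: cfun.representation_scale[OF B(2)])
  qed
  then show ?thesis unfolding B(4)
    by (simp add: sum_distrib_left) (rule sum.swap)
qed

lemma trace_on_eq_0:
  assumes "fin_dim V" "\<And>v t. v \<in> V \<Longrightarrow> f v t = 0"
  shows "trace_on V f = 0"
proof -
  obtain B where B: "finite B" "cfun.independent B" "cfun.span B = V"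
    "\<And>f. trace_on V f = (\<Sum>b\<in>B. cfun.representation B (f b) b)"
    using trace_on_basis[OF assms(1)] by blast
  have "f b = 0" if "b \<in> B" for b
    using assms(2)[of b] B(3) cfun.span_superset that by (fastforce simp: fun_eq_iff)
  then show ?thesis unfolding B(4) by (simp add: cfun.representation_zero)
qed

lemma sum_representation_basis:
  assumes "cfun.independent B" "finite B" "v \<in> cfun.span B"
  shows "v = (\<Sum>b\<in>B. scl (cfun.representation B v b) b)"
  using cfun.sum_representation_eq[OF assms(1,3,2)] by simp

text \<open>Expanding \<open>e\<close> in the basis and applying \<open>f\<close> gives
  \<open>k\<close> times \<open>e\<close> on one side and the trace times \<open>e\<close> on the
  other; the point \<open>t\<close> serves to cancel \<open>e\<close>.\<close>

lemma trace_on_rank_one: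
  assumes V: "fin_dim V" and e: "e \<in> V" "e t \<noteq> 0"
    and f: "lin_op f" "\<And>v. v \<in> V \<Longrightarrow> f v = scl (\<phi> v) e" "f e = scl k e"
  shows "trace_on V f = k"
proof -
  obtain B where B: "finite B" "cfun.independent B" "cfun.span B = V"
    "\<And>f. trace_on V f = (\<Sum>b\<in>B. cfun.representation B (f b) b)"
    using trace_on_basis[OF V] by blast
  have bV: "b \<in> V" if "b \<in> B" for b using B(3) cfun.span_superset that by blast
  have eB: "e \<in> cfun.span B" using e B(3) by simp
  have "trace_on V f = (\<Sum>b\<in>B. \<phi> b * cfun.representation B e b)"
    unfolding B(4) by (rule sum.cong) (simp_all add: f(2)[OF bV] cfun.representation_scale[OF B(2) eB])
  also have "\<dots> = k"
  proof -
    have "f e = (\<Sum>b\<in>B. scl (cfun.representation B e b) (f b))"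
      by (subst (1) sum_representation_basis[OF B(2,1) eB]) (rule lin_op_sum[OF f(1)])
    then have "f e t = (\<Sum>b\<in>B. cfun.representation B e b * f b t)"
      by (simp add: sum_fun_apply)
    also have "\<dots> = (\<Sum>b\<in>B. \<phi> b * cfun.representation B e b) * e t"
      by (simp add: sum_distrib_right f(2)[OF bV] mult_ac sum_distrib_left)
    finally show ?thesis using f(3) e(2) by simp
  qed
  finally show ?thesis .
qed

lemma trace_on_comp_commute:
  assumes V: "fin_dim V" and f: "lin_op f" "\<And>v. v \<in> V \<Longrightarrow> f v \<in> V"
    and g: "lin_op g" "\<And>v. v \<in> V \<Longrightarrow> g v \<in> V"
  shows "trace_on V (\<lambda>v. f (g v)) = trace_on V (\<lambda>v. g (f v))"
proof -
  obtain B where B: "finite B" "cfun.independent B" "cfun.span B = V"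
    "\<And>f. trace_on V f = (\<Sum>b\<in>B. cfun.representation B (f b) b)"
    using trace_on_basis[OF V] by blast
  have bV: "b \<in> V" if "b \<in> B" for b using B(3) cfun.span_superset that by blast
  have main: "cfun.representation B (p (q b)) b
    = (\<Sum>c\<in>B. cfun.representation B (q b) c * cfun.representation B (p c) b)"
    if p: "lin_op p" "\<And>v. v \<in> V \<Longrightarrow> p v \<in> V" and q: "\<And>v. v \<in> V \<Longrightarrow> q v \<in> V" and b: "b \<in> B" for p q b
  proof -
    have qb: "q b \<in> cfun.span B" using q[OF bV[OF b]] B(3) by simp
    have pc: "p c \<in> cfun.span B" if "c \<in> B" for c using p(2)[OF bV[OF that]] B(3) by simp
    have "p (q b) = (\<Sum>c\<in>B. scl (cfun.representation B (q b) c) (p c))"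
      by (subst (1) sum_representation_basis[OF B(2,1) qb]) (rule lin_op_sum[OF p(1)])
    then show ?thesis
      by (simp add: cfun.representation_sum[OF B(2)] cfun.span_scale pc cfun.representation_scale[OF B(2)])
  qed
  have "trace_on V (\<lambda>v. f (g v)) = (\<Sum>b\<in>B. \<Sum>c\<in>B. cfun.representation B (g b) c * cfun.representation B (f c) b)"
    unfolding B(4) by (rule sum.cong[OF refl], rule main[OF f g(2)])
  also have "\<dots> = (\<Sum>c\<in>B. \<Sum>b\<in>B. cfun.representation B (f c) b * cfun.representation B (g b) c)"
    by (subst sum.swap) (simp add: mult.commute)
  also have "\<dots> = trace_on V (\<lambda>v. g (f v))"
    unfolding B(4) by (rule sum.cong[OF refl], rule main[OF g f(2), symmetric])
  finally show ?thesis .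
qed

section \<open>The symmetric group, convolution and left multiplication\<close>

lemma finite_Sym [simp]: "finite (Sym n)"
  by (simp add: Sym_def finite_permutations)

lemma id_Sym [simp]: "id \<in> Sym n" by (simp add: Sym_def permutes_id)

lemma comp_Sym: "g \<in> Sym n \<Longrightarrow> h \<in> Sym n \<Longrightarrow> g \<circ> h \<in> Sym n"
  by (simp add: Sym_def permutes_compose)

lemma inv_Sym: "g \<in> Sym n \<Longrightarrow> inv g \<in> Sym n"
  by (simp add: Sym_def permutes_inv)

lemma Sym_bij: "g \<in> Sym n \<Longrightarrow> bij g"
  by (auto simp: Sym_def permutes_bij)

lemma Sym_permutation: "g \<in> Sym n \<Longrightarrow> permutation g"
  by (auto simp: Sym_def permutation_permutes)

lemma Sym_in: "g \<in> Sym n \<Longrightarrow> g x \<in> {1..n} \<longleftrightarrow> x \<in> {1..n}"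
  using permutes_in_image[of g "{1..n}" x] by (simp add: Sym_def)

lemma Sym_inv [simp]:
  assumes "g \<in> Sym n"
  shows "inv g \<circ> g = id" "g \<circ> inv g = id" "inv g (g x) = x" "g (inv g x) = x" "inv (inv g) = g"
proof -
  have b: "bij g" using Sym_bij assms .
  show "inv g \<circ> g = id" "g \<circ> inv g = id"
    using b by (auto simp: bij_is_inj bij_is_surj surj_f_inv_f)
  show "inv g (g x) = x" "g (inv g x) = x" "inv (inv g) = g"
    using b by (simp_all add: bij_is_inj bij_is_surj surj_f_inv_f inv_inv_eq)
qed

lemma Sym_inv_comp: "g \<in> Sym n \<Longrightarrow> h \<in> Sym n \<Longrightarrow> inv (g \<circ> h) = inv h \<circ> inv g"
  using Sym_bij by (blast intro: o_inv_distrib)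

lemma Sym_cancel:
  assumes "g \<in> Sym n"
  shows "inv g \<circ> (g \<circ> h) = h" "g \<circ> (inv g \<circ> h) = h" "h \<circ> g \<circ> inv g = h" "h \<circ> inv g \<circ> g = h"
  using assms by (simp_all add: fun_eq_iff)

lemma Sym_comp_iff:
  assumes "g \<in> Sym n"
  shows "g \<circ> h \<in> Sym n \<longleftrightarrow> h \<in> Sym n" "h \<circ> g \<in> Sym n \<longleftrightarrow> h \<in> Sym n"
proof -
  have "h \<in> Sym n" if "g \<circ> h \<in> Sym n"
    using comp_Sym[OF inv_Sym[OF assms] that] by (simp add: Sym_cancel[OF assms])
  then show "g \<circ> h \<in> Sym n \<longleftrightarrow> h \<in> Sym n" using comp_Sym[OF assms] by blast
  have "h \<in> Sym n" if "h \<circ> g \<in> Sym n"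
    using comp_Sym[OF that inv_Sym[OF assms]] by (simp only: Sym_cancel[OF assms])
  then show "h \<circ> g \<in> Sym n \<longleftrightarrow> h \<in> Sym n" using comp_Sym[OF _ assms] by blast
qed

lemma transpose_Sym: "x \<in> {1..n} \<Longrightarrow> y \<in> {1..n} \<Longrightarrow> transpose x y \<in> Sym n"
  by (simp add: Sym_def permutes_swap_id)

lemma sum_Sym_left:
  assumes "g \<in> Sym n"
  shows "(\<Sum>h\<in>Sym n. f (g \<circ> h)) = (\<Sum>h\<in>Sym n. f h)"
  using assms by (intro sum.reindex_bij_witness[where i = "\<lambda>h. inv g \<circ> h" and j = "\<lambda>h. g \<circ> h"])
    (auto simp: Sym_cancel comp_Sym inv_Sym)

text \<open>Left multiplication by \<open>g\<close> in the group algebra, written as a substitution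
  instead of a convolution; \<open>conv_delta\<close> makes the link.\<close>

definition act :: "(nat \<Rightarrow> nat) \<Rightarrow> ((nat \<Rightarrow> nat) \<Rightarrow> complex) \<Rightarrow> (nat \<Rightarrow> nat) \<Rightarrow> complex" where
  "act g x = (\<lambda>h. x (inv g \<circ> h))"

lemma conv_delta:
  assumes g: "g \<in> Sym n"
  shows "conv n (delta g) = act g"
proof (intro ext)
  fix x h
  have "conv n (delta g) x h = (\<Sum>k\<in>Sym n. if k = g then x (inv k \<circ> h) else 0)"
    unfolding conv_def delta_def by (rule sum.cong) auto
  then show "conv n (delta g) x h = act g x h" using g by (simp add: act_def)
qed

lemma conv_assoc: "conv n (conv n x y) z = conv n x (conv n y z)"
proof
  fix g
  have "conv n (conv n x y) z g = (\<Sum>k\<in>Sym n. \<Sum>h\<in>Sym n. x k * y (inv k \<circ> h) * z (inv h \<circ> g))"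
    unfolding conv_def by (simp add: sum_distrib_right) (rule sum.swap)
  also have "\<dots> = (\<Sum>k\<in>Sym n. \<Sum>h\<in>Sym n. x k * y h * z (inv h \<circ> (inv k \<circ> g)))"
  proof (rule sum.cong[OF refl])
    fix k assume k: "k \<in> Sym n"
    have "(\<Sum>h\<in>Sym n. x k * y (inv k \<circ> h) * z (inv h \<circ> g)) =
        (\<Sum>h\<in>Sym n. x k * y (inv k \<circ> (k \<circ> h)) * z (inv (k \<circ> h) \<circ> g))"
      by (rule sum_Sym_left[OF k, symmetric])
    also have "\<dots> = (\<Sum>h\<in>Sym n. x k * y h * z (inv h \<circ> (inv k \<circ> g)))"
      using k by (intro sum.cong) (auto simp: Sym_cancel Sym_inv_comp comp_assoc)
    finally show "(\<Sum>h\<in>Sym n. x k * y (inv k \<circ> h) * z (inv h \<circ> g)) = \<dots>" .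
  qed
  also have "\<dots> = conv n x (conv n y z) g"
    unfolding conv_def by (simp add: sum_distrib_left mult.assoc)
  finally show "conv n (conv n x y) z g = conv n x (conv n y z) g" .
qed

lemma act_conv: "g \<in> Sym n \<Longrightarrow> act g (conv n x y) = conv n (act g x) y"
  using conv_assoc[of n "delta g" x y] by (simp add: conv_delta)

lemma act_act: "g \<in> Sym n \<Longrightarrow> h \<in> Sym n \<Longrightarrow> act g (act h x) = act (g \<circ> h) x"
  by (simp add: act_def Sym_inv_comp comp_assoc)

lemma lin_op_act: "lin_op (act g)"
  by (simp add: lin_op_def act_def fun_eq_iff)

lemma act_GA: "g \<in> Sym n \<Longrightarrow> x \<in> group_algebra n \<Longrightarrow> act g x \<in> group_algebra n"
  by (auto simp: group_algebra_def act_def Sym_comp_iff(1) inv_Sym)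

lemma conv_add: "conv n (x + y) z = conv n x z + conv n y z"
  by (simp add: conv_def fun_eq_iff sum.distrib algebra_simps)

lemma conv_scl: "conv n (scl a x) z = scl a (conv n x z)"
  by (simp add: conv_def fun_eq_iff sum_distrib_left algebra_simps)

lemma conv_GA:
  assumes "x \<in> group_algebra n" "y \<in> group_algebra n"
  shows "conv n x y \<in> group_algebra n"
  using assms by (auto simp: group_algebra_def conv_def Sym_comp_iff(1) inv_Sym intro!: sum.neutral)

section \<open>The left ideals of the Young symmetrizers and their characters\<close>

lemma subspace_irr_module: "cfun.subspace (irr_module \<nu>)"
proof (rule cfun.subspaceI)
  let ?n = "sum_list \<nu>"
  let ?m = "\<lambda>x. conv ?n x (young_symmetrizer \<nu>)"
  show "0 \<in> irr_module \<nu>"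
    unfolding irr_module_def
    by (rule image_eqI[of _ _ "0"]) (auto simp: group_algebra_def conv_def fun_eq_iff)
  show "x + y \<in> irr_module \<nu>" if xy: "x \<in> irr_module \<nu>" "y \<in> irr_module \<nu>" for x y
  proof -
    obtain x' y' where "x = ?m x'" "y = ?m y'" "x' \<in> group_algebra ?n" "y' \<in> group_algebra ?n"
      using xy by (auto simp: irr_module_def)
    then show ?thesis unfolding irr_module_def
      by (intro image_eqI[of _ _ "x' + y'"]) (auto simp: conv_add group_algebra_def)
  qed
  show "scl c x \<in> irr_module \<nu>" if x: "x \<in> irr_module \<nu>" for c x
  proof -
    obtain x' where "x = ?m x'" "x' \<in> group_algebra ?n"
      using x by (auto simp: irr_module_def)
    then show ?thesis unfolding irr_module_def
      by (intro image_eqI[of _ _ "scl c x'"]) (auto simp: conv_scl group_algebra_def)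
  qed
qed

definition row_sum :: "nat list \<Rightarrow> (nat \<Rightarrow> nat) \<Rightarrow> complex" where
  "row_sum \<nu> = (\<lambda>g. if g \<in> row_group \<nu> then 1 else 0)"

definition col_sum :: "nat list \<Rightarrow> (nat \<Rightarrow> nat) \<Rightarrow> complex" where
  "col_sum \<nu> = (\<lambda>g. if g \<in> col_group \<nu> then of_int (sign g) else 0)"

lemma young_symmetrizer_eq: "young_symmetrizer \<nu> = conv (sum_list \<nu>) (row_sum \<nu>) (col_sum \<nu>)"
  by (simp add: young_symmetrizer_def row_sum_def col_sum_def)

lemma row_sum_GA: "row_sum \<nu> \<in> group_algebra (sum_list \<nu>)"
  and col_sum_GA: "col_sum \<nu> \<in> group_algebra (sum_list \<nu>)"
  by (auto simp: group_algebra_def row_sum_def col_sum_def row_group_def col_group_def)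

lemma young_symmetrizer_GA: "young_symmetrizer \<nu> \<in> group_algebra (sum_list \<nu>)"
  unfolding young_symmetrizer_eq by (intro conv_GA row_sum_GA col_sum_GA)

lemma irr_module_GA: "irr_module \<nu> \<subseteq> group_algebra (sum_list \<nu>)"
  unfolding irr_module_def by (auto intro: conv_GA young_symmetrizer_GA)

lemma fin_dim_irr_module: "fin_dim (irr_module \<nu>)"
proof -
  let ?n = "sum_list \<nu>"
  have "group_algebra ?n \<subseteq> cfun.span (delta ` Sym ?n)"
  proof
    fix x assume x: "x \<in> group_algebra ?n"
    have "x = (\<Sum>g\<in>Sym ?n. scl (x g) (delta g))"
      by (rule ext) (use x in \<open>simp add: sum_fun_apply delta_def group_algebra_def if_distrib[of "\<lambda>x. _ * x"] cong: if_cong\<close>)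
    also have "\<dots> \<in> cfun.span (delta ` Sym ?n)"
      by (intro cfun.span_sum cfun.span_scale cfun.span_base) auto
    finally show "x \<in> cfun.span (delta ` Sym ?n)" .
  qed
  then show ?thesis using irr_module_GA subspace_irr_module unfolding fin_dim_def
    by (meson finite_Sym finite_imageI order_trans)
qed

lemma act_irr_module:
  assumes "g \<in> Sym (sum_list \<nu>)" "v \<in> irr_module \<nu>"
  shows "act g v \<in> irr_module \<nu>"
  using assms by (auto simp: irr_module_def act_conv act_GA)

lemma irr_char_eq_trace: "g \<in> Sym (sum_list \<nu>) \<Longrightarrow> irr_char \<nu> g = trace_on (irr_module \<nu>) (act g)"
  by (simp add: irr_char_def conv_delta)

lemma irr_char_conj:
  assumes "g \<in> Sym (sum_list \<nu>)" "k \<in> Sym (sum_list \<nu>)"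
  shows "irr_char \<nu> (k \<circ> g \<circ> inv k) = irr_char \<nu> g"
proof -
  let ?V = "irr_module \<nu>"
  note S = assms inv_Sym[OF assms(2)]
  have "irr_char \<nu> (k \<circ> g \<circ> inv k) = trace_on ?V (\<lambda>v. act k (act (g \<circ> inv k) v))"
    using S by (simp add: irr_char_eq_trace comp_Sym act_act comp_assoc)
  also have "\<dots> = trace_on ?V (\<lambda>v. act (g \<circ> inv k) (act k v))"
    using S by (intro trace_on_comp_commute fin_dim_irr_module lin_op_act act_irr_module comp_Sym)
  also have "\<dots> = trace_on ?V (act g)"
    using S by (simp add: act_act[OF comp_Sym[OF S(1,3)] S(2)] comp_assoc)
  finally show ?thesis using S by (simp add: irr_char_eq_trace)
qed

text \<open>A weighted sum of character values is the trace of a single group algebra element. The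
  evaluations below then only require this element to act by zero or with rank one.\<close>

lemma sum_irr_char:
  assumes "G \<subseteq> Sym (sum_list \<nu>)"
  shows "(\<Sum>g\<in>G. c g * irr_char \<nu> g) = trace_on (irr_module \<nu>) (\<lambda>v t. \<Sum>g\<in>G. c g * act g v t)"
proof -
  have "(\<Sum>g\<in>G. c g * irr_char \<nu> g) = (\<Sum>g\<in>G. c g * trace_on (irr_module \<nu>) (act g))"
    using assms by (intro sum.cong) (auto simp: irr_char_eq_trace)
  also have "\<dots> = trace_on (irr_module \<nu>) (\<lambda>v t. \<Sum>g\<in>G. c g * act g v t)"
    using assms by (intro trace_on_sum[symmetric] fin_dim_irr_module act_irr_module) auto
  finally show ?thesis .
qed

section \<open>Tableaux and Young symmetrizers\<close>

definition part :: "nat list \<Rightarrow> nat \<Rightarrow> nat" where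
  "part \<nu> i = (if i < length \<nu> then \<nu> ! i else 0)"

lemma part_antimono:
  assumes "\<nu> \<in> partitions n"
  shows "antimono (part \<nu>)"
proof (rule antimonoI)
  fix i j :: nat assume "i \<le> j"
  then show "part \<nu> j \<le> part \<nu> i"
    using assms sorted_wrt_nth_less[of "(\<ge>)" \<nu> i j] by (cases "i = j") (auto simp: part_def partitions_def)
qed

lemma length_le_sum_list: "0 \<notin> set \<nu> \<Longrightarrow> length \<nu> \<le> sum_list (\<nu> :: nat list)"
  by (induction \<nu>) auto

lemma part_le: "part \<nu> i \<le> sum_list \<nu>"
  by (auto simp: part_def elem_le_sum_list)

lemma sum_part: "length \<nu> \<le> k \<Longrightarrow> (\<Sum>i<k. part \<nu> i) = sum_list \<nu>"
proof -
  assume "length \<nu> \<le> k"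
  then have "(\<Sum>i<k. part \<nu> i) = (\<Sum>i<length \<nu>. part \<nu> i)"
    by (intro sum.mono_neutral_right) (auto simp: part_def)
  also have "\<dots> = sum_list \<nu>" by (simp add: part_def sum_list_sum_nth lessThan_atLeast0)
  finally show ?thesis .
qed

lemma mem_diagram: "(i, j) \<in> diagram \<nu> \<longleftrightarrow> j < part \<nu> i"
  by (auto simp: diagram_def part_def)

lemma diagram_Sigma: "diagram \<nu> = (SIGMA i:{..<length \<nu>}. {..<part \<nu> i})"
  by (auto simp: diagram_def part_def)

lemma finite_diagram [simp]: "finite (diagram \<nu>)"
  by (simp add: diagram_Sigma)

lemma card_diagram: "card (diagram \<nu>) = sum_list \<nu>"
  by (simp add: diagram_Sigma sum_part)

lemma tab_box_bij: "bij_betw (tab_box \<nu>) {1..sum_list \<nu>} (diagram \<nu>)"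
proof -
  define L where "L = concat (map (\<lambda>i. map (Pair i) [0..<\<nu> ! i]) [0..<length \<nu>])"
  have set: "set L = diagram \<nu>" by (auto simp: L_def diagram_def)
  have len: "length L = sum_list \<nu>"
    by (simp add: L_def length_concat o_def map_nth)
  \<comment> \<open>The list has as many entries as its set has elements, so nothing is
    repeated.\<close>
  have "distinct L" by (rule card_distinct) (simp add: set len card_diagram)
  then have "bij_betw ((!) L) {..<length L} (set L)" by (intro bij_betw_nth) auto
  then have L: "bij_betw ((!) L) {..<sum_list \<nu>} (diagram \<nu>)" by (simp add: set len)
  have "bij_betw (\<lambda>k. k - 1) {1..sum_list \<nu>} {..<sum_list \<nu>}"
    by (rule bij_betw_byWitness[where f' = Suc]) auto
  from bij_betw_trans[OF this L] have "bij_betw (\<lambda>k. L ! (k - 1)) {1..sum_list \<nu>} (diagram \<nu>)"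
    by (simp add: o_def)
  then show ?thesis by (simp add: tab_box_def[abs_def] L_def)
qed

definition trow :: "nat list \<Rightarrow> nat \<Rightarrow> nat" where "trow \<nu> x = fst (tab_box \<nu> x)"
definition tcol :: "nat list \<Rightarrow> nat \<Rightarrow> nat" where "tcol \<nu> x = snd (tab_box \<nu> x)"

lemma card_tab_box:
  "card {x \<in> {1..sum_list \<nu>}. P (trow \<nu> x) (tcol \<nu> x)} = card {(i, j) \<in> diagram \<nu>. P i j}"
proof (rule bij_betw_same_card)
  show "bij_betw (tab_box \<nu>) {x \<in> {1..sum_list \<nu>}. P (trow \<nu> x) (tcol \<nu> x)} {(i, j) \<in> diagram \<nu>. P i j}"
  proof (rule bij_betw_subset[OF tab_box_bij])
    show "tab_box \<nu> ` {x \<in> {1..sum_list \<nu>}. P (trow \<nu> x) (tcol \<nu> x)} = {(i, j) \<in> diagram \<nu>. P i j}"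
    proof (intro equalityI subsetI)
      fix b assume "b \<in> {(i, j) \<in> diagram \<nu>. P i j}"
      then have b: "b \<in> diagram \<nu>" "P (fst b) (snd b)" by auto
      then obtain x where "x \<in> {1..sum_list \<nu>}" "b = tab_box \<nu> x"
        using bij_betw_imp_surj_on[OF tab_box_bij, of \<nu>] by blast
      with b show "b \<in> tab_box \<nu> ` {x \<in> {1..sum_list \<nu>}. P (trow \<nu> x) (tcol \<nu> x)}"
        by (auto simp: trow_def tcol_def)
    next
      fix b assume "b \<in> tab_box \<nu> ` {x \<in> {1..sum_list \<nu>}. P (trow \<nu> x) (tcol \<nu> x)}"
      then obtain x where x: "x \<in> {1..sum_list \<nu>}" "P (trow \<nu> x) (tcol \<nu> x)" "b = tab_box \<nu> x" by blast
      have "b \<in> diagram \<nu>" using bij_betw_apply[OF tab_box_bij x(1)] x(3) by simp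
      with x(2,3) show "b \<in> {(i, j) \<in> diagram \<nu>. P i j}" by (simp add: trow_def tcol_def case_prod_unfold)
    qed
  qed auto
qed

lemma tab_inj:
  assumes "x \<in> {1..sum_list \<nu>}" "y \<in> {1..sum_list \<nu>}" "trow \<nu> x = trow \<nu> y" "tcol \<nu> x = tcol \<nu> y"
  shows "x = y"
  using bij_betw_imp_inj_on[OF tab_box_bij, of \<nu>] assms
    by (auto simp: inj_on_def trow_def tcol_def prod_eq_iff)

lemma tab_bounds:
  assumes "x \<in> {1..sum_list \<nu>}"
  shows "tcol \<nu> x < part \<nu> (trow \<nu> x)" "trow \<nu> x < length \<nu>" "tcol \<nu> x < sum_list \<nu>"
proof -
  have "tab_box \<nu> x \<in> diagram \<nu>" using bij_betw_apply[OF tab_box_bij assms] .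
  then have "(trow \<nu> x, tcol \<nu> x) \<in> diagram \<nu>" by (simp add: trow_def tcol_def)
  then show 1: "tcol \<nu> x < part \<nu> (trow \<nu> x)" by (simp add: mem_diagram)
  from \<open>(trow \<nu> x, tcol \<nu> x) \<in> diagram \<nu>\<close> show "trow \<nu> x < length \<nu>" by (simp add: diagram_def)
  from 1 show "tcol \<nu> x < sum_list \<nu>" using part_le less_le_trans by blast
qed

lemma card_trow: "card {x \<in> {1..sum_list \<nu>}. trow \<nu> x = i} = part \<nu> i"
proof -
  have "{(i', j) \<in> diagram \<nu>. i' = i} = Pair i ` {..<part \<nu> i}"
    by (auto simp: mem_diagram)
  then show ?thesis using card_tab_box[of \<nu> "\<lambda>i' j. i' = i"] by (simp add: card_image inj_on_def)
qed

lemma card_tcol: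
  assumes "length \<nu> \<le> k"
  shows "card {x \<in> {1..sum_list \<nu>}. tcol \<nu> x = j} = conj_part k (part \<nu>) j"
proof -
  have "i < k" if "j < part \<nu> i" for i using that assms by (auto simp: part_def split: if_splits)
  then have "{(i, j') \<in> diagram \<nu>. j' = j} = (\<lambda>i. (i, j)) ` {i. i < k \<and> j < part \<nu> i}"
    by (auto simp: mem_diagram)
  then show ?thesis using card_tab_box[of \<nu> "\<lambda>i j'. j' = j"]
    by (simp add: card_image inj_on_def conj_part_def)
qed

text \<open>Both sides count the boxes in the first \<open>m\<close> rows, the left one by
  columns.\<close>

lemma sum_min_conj_part:
  assumes "antimono f" "\<And>i. f i \<le> J" "m \<le> k"
  shows "(\<Sum>j<J. min m (conj_part k f j)) = (\<Sum>i<m. f i)"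
proof -
  have "(\<Sum>i<m. f i) = (\<Sum>i<m. \<Sum>j<J. if j < f i then 1 else 0)"
  proof (rule sum.cong[OF refl])
    fix i
    have "{j \<in> {..<J}. j < f i} = {..<f i}" using assms(2)[of i] by auto
    then show "f i = (\<Sum>j<J. if j < f i then 1 else 0)" by (subst sum.inter_filter[symmetric]) auto
  qed
  also have "\<dots> = (\<Sum>j<J. \<Sum>i<m. if j < f i then 1 else 0)" by (rule sum.swap)
  also have "\<dots> = (\<Sum>j<J. min m (conj_part k f j))"
  proof (rule sum.cong[OF refl])
    fix j
    have "{i \<in> {..<m}. j < f i} = {..<min m (conj_part k f j)}"
      using conj_part_gt_iff[OF assms(1), of _ k j] assms(3) by auto
    then show "(\<Sum>i<m. if j < f i then 1 else 0) = min m (conj_part k f j)"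
      by (subst sum.inter_filter[symmetric]) auto
  qed
  finally show ?thesis by simp
qed

lemma card_fiber_le:
  assumes "finite X" "inj_on (\<lambda>x. (p x, q x)) X"
  shows "card {x \<in> X. p x < (m :: nat) \<and> q x = j} \<le> min m (card {x \<in> X. q x = j})"
proof -
  have "inj_on p {x \<in> X. p x < m \<and> q x = j}" using assms(2) by (auto simp: inj_on_def)
  then have "card {x \<in> X. p x < m \<and> q x = j} \<le> card {..<m}"
    by (rule card_inj_on_le) auto
  moreover have "card {x \<in> X. p x < m \<and> q x = j} \<le> card {x \<in> X. q x = j}"
    by (rule card_mono) (use assms(1) in auto)
  ultimately show ?thesis by simp
qed

lemma card_fibers_sum:
  assumes "finite X" "\<And>x. x \<in> X \<Longrightarrow> q x < (J::nat)"
  shows "card {x \<in> X. P x} = (\<Sum>j<J. card {x \<in> X. P x \<and> q x = j})"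
proof -
  have "{x \<in> X. P x} = (\<Union>j<J. {x \<in> X. P x \<and> q x = j})" using assms(2) by auto
  also have "card \<dots> = (\<Sum>j<J. card {x \<in> X. P x \<and> q x = j})"
    using assms(1) by (intro card_UN_disjoint) auto
  finally show ?thesis .
qed

text \<open>A pigeonhole bound: injectivity of the pairs leaves at most \<open>m\<close> points with
  small first coordinate in each fibre of \<open>q\<close>. It is applied in contraposition, where a
  violated dominance inequality produces a colliding pair.\<close>

lemma card_below_le:
  assumes "finite X" "inj_on (\<lambda>x. (p x, q x)) X" "\<And>x. x \<in> X \<Longrightarrow> q x < (J::nat)"
  shows "card {x \<in> X. p x < (m :: nat)} \<le> (\<Sum>j<J. min m (card {x \<in> X. q x = j}))"
proof -
  have "card {x \<in> X. p x < m} = (\<Sum>j<J. card {x \<in> X. p x < m \<and> q x = j})"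
    by (rule card_fibers_sum[OF assms(1,3)])
  then show ?thesis using card_fiber_le[OF assms(1,2)] by (simp only: sum_mono)
qed

lemma card_inv_Sym:
  assumes "h \<in> Sym n"
  shows "card {x \<in> {1..n}. q (inv h x) = j} = card {x \<in> {1..n}. q x = j}"
proof (rule bij_betw_same_card)
  show "bij_betw (inv h) {x \<in> {1..n}. q (inv h x) = j} {x \<in> {1..n}. q x = j}"
    by (rule bij_betw_byWitness[where f' = h])
      (use assms Sym_in[OF assms] Sym_in[OF inv_Sym[OF assms]] in \<open>auto simp del: atLeastAtMost_iff\<close>)
qed

text \<open>A Young subgroup, given by a word \<open>w\<close> of letters at the places
  \<open>1..n\<close>. The words \<open>trow\<close> and \<open>tcol\<close> give the row and column
  groups, and stabilizers of general words give the permutation characters, so one calculus serves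
  all three.\<close>

definition Stab :: "nat \<Rightarrow> (nat \<Rightarrow> nat) \<Rightarrow> (nat \<Rightarrow> nat) set" where
  "Stab n w = {g \<in> Sym n. \<forall>x\<in>{1..n}. w (g x) = w x}"

lemma row_group_eq: "row_group \<nu> = Stab (sum_list \<nu>) (trow \<nu>)"
  and col_group_eq: "col_group \<nu> = Stab (sum_list \<nu>) (tcol \<nu>)"
  by (simp_all add: row_group_def col_group_def Stab_def trow_def tcol_def)

lemma Stab_Sym: "g \<in> Stab n w \<Longrightarrow> g \<in> Sym n" by (simp add: Stab_def)

lemma id_Stab: "id \<in> Stab n w" by (simp add: Stab_def)

lemma comp_Stab: "g \<in> Stab n w \<Longrightarrow> h \<in> Stab n w \<Longrightarrow> g \<circ> h \<in> Stab n w"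
  using Sym_in by (auto simp: Stab_def comp_Sym simp del: atLeastAtMost_iff)

lemma inv_Stab: "g \<in> Stab n w \<Longrightarrow> inv g \<in> Stab n w"
proof -
  assume g: "g \<in> Stab n w"
  then have S: "g \<in> Sym n" by (simp add: Stab_def)
  have "w (inv g x) = w x" if x: "x \<in> {1..n}" for x
  proof -
    have "inv g x \<in> {1..n}" using x Sym_in[OF inv_Sym[OF S]] by blast
    then have "w (g (inv g x)) = w (inv g x)" using g unfolding Stab_def by blast
    then show ?thesis using S by simp
  qed
  then show ?thesis using S by (simp add: Stab_def inv_Sym)
qed

lemma comp_Stab_iff:
  assumes "t \<in> Stab n w"
  shows "t \<circ> g \<in> Stab n w \<longleftrightarrow> g \<in> Stab n w" "g \<circ> t \<in> Stab n w \<longleftrightarrow> g \<in> Stab n w"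
proof -
  note S = Stab_Sym[OF assms]
  have "g \<in> Stab n w" if "t \<circ> g \<in> Stab n w"
    using comp_Stab[OF inv_Stab[OF assms] that] by (simp only: Sym_cancel[OF S])
  then show "t \<circ> g \<in> Stab n w \<longleftrightarrow> g \<in> Stab n w" using comp_Stab[OF assms] by blast
  have "g \<in> Stab n w" if "g \<circ> t \<in> Stab n w"
    using comp_Stab[OF that inv_Stab[OF assms]] by (simp only: Sym_cancel[OF S])
  then show "g \<circ> t \<in> Stab n w \<longleftrightarrow> g \<in> Stab n w" using comp_Stab[OF _ assms] by blast
qed

lemma transpose_Stab:
  "x \<in> {1..n} \<Longrightarrow> y \<in> {1..n} \<Longrightarrow> w x = w y \<Longrightarrow> transpose x y \<in> Stab n w"
  by (auto simp: Stab_def transpose_Sym transpose_def simp del: atLeastAtMost_iff)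

lemma finite_Stab [simp]: "finite (Stab n w)"
  by (rule finite_subset[OF _ finite_Sym[of n]]) (auto simp: Stab_def)

lemma sum_Stab_left:
  assumes "t \<in> Stab n w"
  shows "(\<Sum>g\<in>Stab n w. f (t \<circ> g)) = (\<Sum>g\<in>Stab n w. f g)"
  using assms Stab_Sym[OF assms]
  by (intro sum.reindex_bij_witness[where i = "\<lambda>h. inv t \<circ> h" and j = "\<lambda>h. t \<circ> h"])
    (auto simp: Sym_cancel comp_Stab_iff inv_Stab)

lemma transpose_comp_Sym:
  assumes "h \<in> Sym n"
  shows "transpose x y \<circ> h = h \<circ> transpose (inv h x) (inv h y)"
proof
  fix z
  have "h z = x \<longleftrightarrow> z = inv h x" "h z = y \<longleftrightarrow> z = inv h y" using Sym_inv[OF assms] by metis+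
  then show "(transpose x y \<circ> h) z = (h \<circ> transpose (inv h x) (inv h y)) z"
    using assms by (auto simp: transpose_def)
qed

lemma sign_comp_Sym: "g \<in> Sym n \<Longrightarrow> h \<in> Sym n \<Longrightarrow> sign (g \<circ> h) = sign g * sign h"
  by (intro sign_compose Sym_permutation)

section \<open>Symmetries of row sums, column sums and module elements\<close>

lemma row_sum_comp:
  assumes "p \<in> row_group \<nu>"
  shows "row_sum \<nu> (g \<circ> p) = row_sum \<nu> g" "row_sum \<nu> (p \<circ> g) = row_sum \<nu> g"
  using assms by (simp_all add: row_sum_def row_group_eq comp_Stab_iff)

lemma col_sum_comp:
  assumes "q \<in> col_group \<nu>"
  shows "col_sum \<nu> (g \<circ> q) = of_int (sign q) * col_sum \<nu> g"
  using assms
  by (auto simp: col_sum_def col_group_eq comp_Stab_iff(2) sign_comp_Sym[OF Stab_Sym Stab_Sym])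

lemma conv_row_sum_right: "p \<in> row_group \<nu> \<Longrightarrow> conv n x (row_sum \<nu>) (g \<circ> p) = conv n x (row_sum \<nu>) g"
  by (simp add: conv_def row_sum_comp flip: comp_assoc)

lemma conv_col_sum_right:
  "q \<in> col_group \<nu> \<Longrightarrow> conv n x (col_sum \<nu>) (g \<circ> q) = of_int (sign q) * conv n x (col_sum \<nu>) g"
  by (simp add: conv_def col_sum_comp sum_distrib_left mult_ac flip: comp_assoc)

lemma conv_row_sum_left:
  assumes "p \<in> row_group \<nu>"
  shows "conv (sum_list \<nu>) (row_sum \<nu>) x (p \<circ> g) = conv (sum_list \<nu>) (row_sum \<nu>) x g"
proof -
  have p: "p \<in> Sym (sum_list \<nu>)" using assms by (simp add: row_group_def)
  have "conv (sum_list \<nu>) (row_sum \<nu>) x (p \<circ> g) =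
      (\<Sum>h\<in>Sym (sum_list \<nu>). row_sum \<nu> (p \<circ> h) * x (inv (p \<circ> h) \<circ> (p \<circ> g)))"
    unfolding conv_def by (rule sum_Sym_left[OF p, symmetric])
  also have "\<dots> = (\<Sum>h\<in>Sym (sum_list \<nu>). row_sum \<nu> h * x (inv h \<circ> g))"
    using p by (intro sum.cong) (auto simp: row_sum_comp[OF assms] Sym_inv_comp comp_assoc Sym_cancel)
  finally show ?thesis by (simp add: conv_def)
qed

text \<open>Associativity regroups the generator so that both symmetries become visible: the outer
  column sum makes \<open>v\<close> alternating under the column group, and the inner factor
  \<open>u\<close> is invariant under the row group.\<close>

lemma irr_module_cases:
  assumes "v \<in> irr_module \<nu>"
  obtains u where "v = conv (sum_list \<nu>) u (col_sum \<nu>)"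
    "\<And>g p. p \<in> row_group \<nu> \<Longrightarrow> u (g \<circ> p) = u g" "v \<in> group_algebra (sum_list \<nu>)" 
proof -
  obtain x where "v = conv (sum_list \<nu>) (conv (sum_list \<nu>) x (row_sum \<nu>)) (col_sum \<nu>)"
    using assms by (auto simp: irr_module_def young_symmetrizer_eq conv_assoc)
  then show ?thesis using that conv_row_sum_right irr_module_GA assms by blast
qed

text \<open>Replacing \<open>g\<close> by \<open>transpose x y \<circ> g\<close> permutes the
  stabilizer. Inside \<open>F\<close> the transposition moves to the right end, where it exchanges
  \<open>inv h x\<close> and \<open>inv h y\<close>. Since \<epsilon> and \<delta> have product -1,
  the sum equals its negative; the sign comes from \<open>F\<close> in the column argument and from
  \<open>c\<close> in the row argument.\<close>

lemma Stab_sum_cancel: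
  assumes xy: "x \<noteq> y" "x \<in> {1..n}" "y \<in> {1..n}" "w x = w y" "h \<in> Sym n"
    and c: "\<And>g. g \<in> Stab n w \<Longrightarrow> c (transpose x y \<circ> g) = \<epsilon> * c g"
    and F: "\<And>g. F (g \<circ> transpose (inv h x) (inv h y)) = \<delta> * F g"
    and "\<epsilon> * \<delta> = (-1 :: complex)"
  shows "(\<Sum>g\<in>Stab n w. c g * F (inv g \<circ> h)) = 0"
proof -
  let ?t = "transpose x y"
  have t: "?t \<in> Stab n w" by (intro transpose_Stab xy)
  have "(\<Sum>g\<in>Stab n w. c g * F (inv g \<circ> h)) = (\<Sum>g\<in>Stab n w. c (?t \<circ> g) * F (inv (?t \<circ> g) \<circ> h))"
    by (rule sum_Stab_left[OF t, symmetric])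
  also have "\<dots> = (\<Sum>g\<in>Stab n w. - (c g * F (inv g \<circ> h)))"
  proof (rule sum.cong[OF refl])
    fix g assume g: "g \<in> Stab n w"
    have "inv (?t \<circ> g) \<circ> h = inv g \<circ> (?t \<circ> h)"
      using Sym_inv_comp[OF Stab_Sym[OF t] Stab_Sym[OF g]] by (simp add: comp_assoc)
    also have "\<dots> = (inv g \<circ> h) \<circ> transpose (inv h x) (inv h y)"
      by (simp only: transpose_comp_Sym[OF xy(5)] comp_assoc)
    finally have "c (?t \<circ> g) * F (inv (?t \<circ> g) \<circ> h) = (\<epsilon> * \<delta>) * (c g * F (inv g \<circ> h))"
      by (simp only: F c[OF g] mult_ac)
    then show "c (?t \<circ> g) * F (inv (?t \<circ> g) \<circ> h) = - (c g * F (inv g \<circ> h))" by (simp add: assms(8))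
  qed
  finally show ?thesis by (simp add: sum_negf)
qed

lemma collision_pair:
  assumes "\<not> inj_on (\<lambda>x. (w x, q (inv h x))) {1..n}"
  obtains x y where "x \<noteq> y" "x \<in> {1..n}" "y \<in> {1..n}" "w x = w y" "q (inv h x) = q (inv h y)"
  using assms unfolding inj_on_def by blast

lemma sign_transpose_inv:
  assumes "h \<in> Sym n" "x \<noteq> y"
  shows "sign (transpose (inv h x) (inv h y)) = - 1"
proof -
  have "inv h x \<noteq> inv h y" using assms Sym_inv(4)[OF assms(1)] by metis
  then show ?thesis by (simp add: sign_swap_id)
qed

lemma inv_in: "h \<in> Sym n \<Longrightarrow> x \<in> {1..n} \<Longrightarrow> inv h x \<in> {1..n}"
  using Sym_in[OF inv_Sym] by blast

text \<open>The word has more letters below \<open>m\<close> than the columns of \<nu> can take with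
  distinct letters in each. So for every \<open>h\<close> two places share both letter and column;
  their transposition fixes \<open>w\<close> and, moved to the right, lies in the column group. The
  sum over the stabilizer therefore annihilates the module.\<close>

lemma sum_Stab_irr_char_eq_0:
  assumes "\<nu> \<in> partitions n" "m \<le> k" "n \<le> k"
    and gt: "(\<Sum>i<m. part \<nu> i) < card {x \<in> {1..n}. w x < m}"
  shows "(\<Sum>g\<in>Stab n w. irr_char \<nu> g) = 0"
proof -
  have n: "sum_list \<nu> = n" using assms(1) by (simp add: partitions_def)
  have len: "length \<nu> \<le> k" using length_le_sum_list[of \<nu>] assms by (auto simp: partitions_def)
  have coll: "\<not> inj_on (\<lambda>x. (w x, tcol \<nu> (inv h x))) {1..n}" if h: "h \<in> Sym n" for h
  proof
    assume "inj_on (\<lambda>x. (w x, tcol \<nu> (inv h x))) {1..n}"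
    then have "card {x \<in> {1..n}. w x < m} \<le> (\<Sum>j<n. min m (card {x \<in> {1..n}. tcol \<nu> (inv h x) = j}))"
      using tab_bounds(3)[of "inv h _" \<nu>] inv_in[OF h] n by (intro card_below_le) auto
    also have "\<dots> = (\<Sum>i<m. part \<nu> i)"
      using card_tcol[OF len] sum_min_conj_part[OF part_antimono[OF assms(1)] _ assms(2), of n] part_le[of \<nu>] n
      by (simp add: card_inv_Sym[OF h] del: One_nat_def atLeastAtMost_iff)
    finally show False using gt by simp
  qed
  have "(\<Sum>g\<in>Stab n w. 1 * irr_char \<nu> g) = 0"
  proof (subst sum_irr_char)
    show "Stab n w \<subseteq> Sym (sum_list \<nu>)" using n by (auto simp: Stab_def)
    show "trace_on (irr_module \<nu>) (\<lambda>v t. \<Sum>g\<in>Stab n w. 1 * act g v t) = 0"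
    proof (rule trace_on_eq_0[OF fin_dim_irr_module])
      fix v h assume "v \<in> irr_module \<nu>"
      then obtain u where v: "v = conv n u (col_sum \<nu>)" and vGA: "v \<in> group_algebra n"
        using irr_module_cases n by metis
      show "(\<Sum>g\<in>Stab n w. 1 * act g v h) = 0"
      proof (cases "h \<in> Sym n")
        case True
        from coll[OF this] obtain x y where xy: "x \<noteq> y" "x \<in> {1..n}" "y \<in> {1..n}" "w x = w y"
          "tcol \<nu> (inv h x) = tcol \<nu> (inv h y)" by (rule collision_pair)
        have "transpose (inv h x) (inv h y) \<in> col_group \<nu>"
          unfolding col_group_eq n by (intro transpose_Stab inv_in True xy)
        then have "v (g \<circ> transpose (inv h x) (inv h y)) = -1 * v g" for g
          unfolding v by (simp add: conv_col_sum_right sign_transpose_inv[OF True xy(1)])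
        from Stab_sum_cancel[where c = "\<lambda>_. 1" and F = v and \<epsilon> = 1 and \<delta> = "-1", OF xy(1-4) True _ this]
        show ?thesis unfolding act_def by simp
      next
        case False
        then have "inv g \<circ> h \<notin> Sym n" if "g \<in> Stab n w" for g
          using Sym_comp_iff(1)[OF inv_Sym[OF Stab_Sym[OF that]]] by blast
        then show ?thesis using vGA by (auto simp: act_def group_algebra_def intro!: sum.neutral)
      qed
    qed
  qed
  then show ?thesis by simp
qed

text \<open>Dual to the previous vanishing, with rows in place of columns. Row invariance belongs to
  the factor \<open>u\<close> before multiplication by the column sum, so the cancellation takes
  place there and is carried through the convolution.\<close>

lemma sum_Stab_sign_irr_char_eq_0:
  assumes "\<nu> \<in> partitions n" "n \<le> k"
    and gt: "(\<Sum>i<k. min m (part \<nu> i)) < card {x \<in> {1..n}. w x < m}"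
  shows "(\<Sum>g\<in>Stab n w. of_int (sign g) * irr_char \<nu> g) = 0"
proof -
  have n: "sum_list \<nu> = n" using assms(1) by (simp add: partitions_def)
  have len: "length \<nu> \<le> k" using length_le_sum_list[of \<nu>] assms by (auto simp: partitions_def)
  have coll: "\<not> inj_on (\<lambda>x. (w x, trow \<nu> (inv h x))) {1..n}" if h: "h \<in> Sym n" for h
  proof
    assume "inj_on (\<lambda>x. (w x, trow \<nu> (inv h x))) {1..n}"
    then have "card {x \<in> {1..n}. w x < m} \<le> (\<Sum>j<k. min m (card {x \<in> {1..n}. trow \<nu> (inv h x) = j}))"
      using tab_bounds(2)[of "inv h _" \<nu>] inv_in[OF h] n len
        by (intro card_below_le) (auto intro: less_le_trans)
    also have "\<dots> = (\<Sum>i<k. min m (part \<nu> i))"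
      using card_trow[of \<nu>] n by (simp add: card_inv_Sym[OF h] del: One_nat_def atLeastAtMost_iff)
    finally show False using gt by simp
  qed
  show ?thesis
  proof (subst sum_irr_char)
    show "Stab n w \<subseteq> Sym (sum_list \<nu>)" using n by (auto simp: Stab_def)
    show "trace_on (irr_module \<nu>) (\<lambda>v t. \<Sum>g\<in>Stab n w. of_int (sign g) * act g v t) = 0"
    proof (rule trace_on_eq_0[OF fin_dim_irr_module])
      fix v t assume "v \<in> irr_module \<nu>"
      then obtain u where v: "v = conv n u (col_sum \<nu>)" and u: "\<And>g p. p \<in> row_group \<nu> \<Longrightarrow> u (g \<circ> p) = u g"
        using irr_module_cases n by metis
      have zero: "(\<Sum>g\<in>Stab n w. of_int (sign g) * u (inv g \<circ> h)) = 0" if h: "h \<in> Sym n" for h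
      proof -
        from coll[OF h] obtain x y where xy: "x \<noteq> y" "x \<in> {1..n}" "y \<in> {1..n}" "w x = w y"
          "trow \<nu> (inv h x) = trow \<nu> (inv h y)" by (rule collision_pair)
        have "transpose (inv h x) (inv h y) \<in> row_group \<nu>"
          unfolding row_group_eq n by (intro transpose_Stab inv_in h xy)
        then have 1: "u (g \<circ> transpose (inv h x) (inv h y)) = 1 * u g" for g by (simp add: u)
        have 2: "(of_int (sign (transpose x y \<circ> g)) :: complex) = -1 * of_int (sign g)"
          if "g \<in> Stab n w" for g
          using sign_comp_Sym[OF transpose_Sym[OF xy(2,3)] Stab_Sym[OF that]] xy(1)
            by (simp add: sign_swap_id)
        show ?thesis
          by (rule Stab_sum_cancel[where c = "\<lambda>g. of_int (sign g)" and F = u and \<epsilon> = "-1" and \<delta> = 1,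
                OF xy(1-4) h 2 1]) auto
      qed
      have "(\<Sum>g\<in>Stab n w. of_int (sign g) * act g v t) =
          (\<Sum>g\<in>Stab n w. of_int (sign g) * (\<Sum>h\<in>Sym n. u (inv g \<circ> h) * col_sum \<nu> (inv h \<circ> t)))"
      proof (rule sum.cong[OF refl])
        fix g assume "g \<in> Stab n w"
        then have "act g v = conv n (act g u) (col_sum \<nu>)" unfolding v by (intro act_conv Stab_Sym)
        then show "of_int (sign g) * act g v t =
            of_int (sign g) * (\<Sum>h\<in>Sym n. u (inv g \<circ> h) * col_sum \<nu> (inv h \<circ> t))"
          by (simp add: conv_def act_def)
      qed
      also have "\<dots> = (\<Sum>h\<in>Sym n. (\<Sum>g\<in>Stab n w. of_int (sign g) * u (inv g \<circ> h)) * col_sum \<nu> (inv h \<circ> t))"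
        by (simp add: sum_distrib_left sum_distrib_right mult_ac) (rule sum.swap)
      also have "\<dots> = 0" by (simp add: zero)
      finally show "(\<Sum>g\<in>Stab n w. of_int (sign g) * act g v t) = 0" .
    qed
  qed
qed

text \<open>
  Both factors are found by counting: the row and column counts force the pairs (row of \<open>x\<close>, column
  of \<open>inv g x\<close>) to fill exactly the diagram.
\<close>

lemma row_col_factor:
  assumes "\<nu> \<in> partitions n" "g \<in> Sym n" "inj_on (\<lambda>x. (trow \<nu> x, tcol \<nu> (inv g x))) {1..n}"
  obtains p q where "p \<in> row_group \<nu>" "q \<in> col_group \<nu>" "g = p \<circ> q"
proof -
  let ?X = "{1..n}"
  have n: "sum_list \<nu> = n" using assms(1) by (simp add: partitions_def)
  let ?f = "part \<nu>"
  let ?c = "conj_part n ?f"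
  have len: "length \<nu> \<le> n" using length_le_sum_list[of \<nu>] assms by (auto simp: partitions_def)
  have anti: "antimono ?f" by (rule part_antimono[OF assms(1)])
  \<comment> \<open>Each fibre is bounded by the corresponding one of the diagram and the totals
    agree, so every bound is attained.\<close>
  have fib: "card {x \<in> ?X. trow \<nu> x < m \<and> tcol \<nu> (inv g x) = j}
    = min m (?c j)" if m: "m \<le> n" and j: "j < n" for m j
  proof -
    have le: "card {x \<in> ?X. trow \<nu> x < m \<and> tcol \<nu> (inv g x) = j} \<le> min m (?c j)" for j
      using card_fiber_le[OF _ assms(3), of m j] card_tcol[OF len, of j] n
      by (simp add: card_inv_Sym[OF assms(2)] del: One_nat_def atLeastAtMost_iff)
    have s1: "(\<Sum>j<n. card {x \<in> ?X. trow \<nu> x < m \<and> tcol \<nu> (inv g x) = j}) = card {x \<in> ?X. trow \<nu> x < m}"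
      using tab_bounds(3)[of _ \<nu>] inv_in[OF assms(2)] n by (intro card_fibers_sum[symmetric]) auto
    have s2: "card {x \<in> ?X. trow \<nu> x < m} = (\<Sum>i<m. card {x \<in> ?X. trow \<nu> x < m \<and> trow \<nu> x = i})"
    proof -
      have "card {x \<in> {x \<in> ?X. trow \<nu> x < m}. True}
        = (\<Sum>i<m. card {x \<in> {x \<in> ?X. trow \<nu> x < m}. True \<and> trow \<nu> x = i})"
        by (rule card_fibers_sum) auto
      then show ?thesis by (simp only: mem_Collect_eq conj_assoc simp_thms)
    qed
    have s3: "card {x \<in> ?X. trow \<nu> x < m \<and> trow \<nu> x = i} = part \<nu> i" if "i < m" for i
    proof -
      have "{x \<in> ?X. trow \<nu> x < m \<and> trow \<nu> x = i} = {x \<in> ?X. trow \<nu> x = i}"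
        using that by (intro Collect_cong) blast
      then show ?thesis using card_trow[of \<nu> i] n by simp
    qed
    have s4: "(\<Sum>j<n. min m (?c j)) = (\<Sum>i<m. part \<nu> i)"
      using sum_min_conj_part[OF anti, of n m n] part_le[of \<nu>] n m by simp
    have "(\<Sum>j<n. card {x \<in> ?X. trow \<nu> x < m \<and> tcol \<nu> (inv g x) = j}) = (\<Sum>j<n. min m (?c j))"
      unfolding s1 s2 s4 by (intro sum.cong refl s3) simp
    from sum_mono_inv[OF this le, of j] show ?thesis using j by simp
  qed
  \<comment> \<open>The place \<open>x\<close> enters its column fibre when the row bound passes
    from \<open>trow \<nu> x\<close> to its successor. So the minimum still increases there, which
    means that the column is long enough.\<close>
  have D: "(trow \<nu> x, tcol \<nu> (inv g x)) \<in> diagram \<nu>" if x: "x \<in> ?X" for x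
  proof -
    let ?m = "trow \<nu> x" and ?j = "tcol \<nu> (inv g x)"
    have m: "?m < n" using tab_bounds(2)[of x \<nu>] x n len by simp
    have j: "?j < n" using tab_bounds(3)[of "inv g x" \<nu>] inv_in[OF assms(2) x] n by simp
    have sub: "{y \<in> ?X. trow \<nu> y < ?m \<and> tcol \<nu> (inv g y)
      = ?j} \<subset> {y \<in> ?X. trow \<nu> y < Suc ?m \<and> tcol \<nu> (inv g y) = ?j}"
      using x by auto
    have "card {y \<in> ?X. trow \<nu> y < ?m \<and> tcol \<nu> (inv g y)
      = ?j} < card {y \<in> ?X. trow \<nu> y < Suc ?m \<and> tcol \<nu> (inv g y) = ?j}"
      by (rule psubset_card_mono[OF _ sub]) simp
    then have "min ?m (?c ?j) < min (Suc ?m) (?c ?j)"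
      using fib[of ?m ?j] fib[of "Suc ?m" ?j] m j by linarith
    then have "?m < ?c ?j" by linarith
    then show ?thesis using conj_part_gt_iff[OF anti m] by (simp add: mem_diagram)
  qed
  let ?B = "\<lambda>x. (trow \<nu> x, tcol \<nu> (inv g x))"
  let ?T = "inv_into ?X (tab_box \<nu>)"
  have bT: "bij_betw (tab_box \<nu>) ?X (diagram \<nu>)" using tab_box_bij[of \<nu>] n by simp
  \<comment> \<open>\<open>p\<close> sends \<open>x\<close> to the entry in the row of
    \<open>x\<close> and the column of \<open>inv g x\<close>. It thus preserves rows, and
    \<open>p \<circ> g\<close> preserves columns.\<close>
  define p where "p = (\<lambda>x. if x \<in> ?X then ?T (?B x) else x)"
  have T: "?T b \<in> ?X" "tab_box \<nu> (?T b) = b" if "b \<in> diagram \<nu>" for b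
    using bij_betw_inv_into_right[OF bT that] bij_betw_apply[OF bij_betw_inv_into[OF bT] that] by auto
  have pX: "p x \<in> ?X" "tab_box \<nu> (p x) = ?B x" if "x \<in> ?X" for x
    using T[OF D[OF that]] that unfolding p_def by simp_all
  have "p permutes ?X"
  proof (rule permutes_if_inj_on)
    show "inj_on p ?X"
    proof (rule inj_onI)
      fix x y assume "x \<in> ?X" "y \<in> ?X" "p x = p y"
      then have "?B x = ?B y" using pX(2) by metis
      then show "x = y" using inj_onD[OF assms(3)] \<open>x \<in> ?X\<close> \<open>y \<in> ?X\<close> by blast
    qed
  qed (use pX in \<open>auto simp: p_def\<close>)
  then have pS: "p \<in> Sym n" by (simp add: Sym_def)
  have pr: "p \<in> row_group \<nu>"
    unfolding row_group_eq Stab_def n using pS pX(2) by (simp add: trow_def)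
  have qc: "p \<circ> g \<in> col_group \<nu>"
  proof -
    have "tcol \<nu> (p (g x)) = tcol \<nu> x" if "x \<in> ?X" for x
    proof -
      have "g x \<in> ?X" using that Sym_in[OF assms(2)] by blast
      from pX(2)[OF this] show ?thesis using assms(2) by (simp add: tcol_def)
    qed
    then show ?thesis unfolding col_group_eq Stab_def n using comp_Sym[OF pS assms(2)] by simp
  qed
  have "inv p \<in> row_group \<nu>" using pr inv_Stab unfolding row_group_eq by blast
  moreover have "g = inv p \<circ> (p \<circ> g)" using pS by (simp add: Sym_cancel)
  ultimately show ?thesis using that qc by blast
qed

section \<open>The Young symmetrizer up to scalars, and two traces\<close>

lemma young_symmetrizer_id:
  "young_symmetrizer \<nu> id = 1"
proof -
  let ?n = "sum_list \<nu>"
  have "young_symmetrizer \<nu> id = (\<Sum>h\<in>Sym ?n. if h = id then 1 else 0)"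
    unfolding young_symmetrizer_eq conv_def
  proof (rule sum.cong[OF refl])
    fix h assume h: "h \<in> Sym ?n"
    \<comment> \<open>Row and column together determine the entry, so the two groups meet only in
      the identity.\<close>
    have "h = id" if r: "h \<in> row_group \<nu>" and c: "inv h \<in> col_group \<nu>"
    proof
      fix x
      have c': "h \<in> col_group \<nu>" using inv_Stab[of "inv h"] c Sym_inv(5)[OF h] unfolding col_group_eq
        by metis
      show "h x = id x"
      proof (cases "x \<in> {1..?n}")
        case True
        then have "h x \<in> {1..?n}" using Sym_in[OF h] by blast
        then show ?thesis using tab_inj[of "h x" \<nu> x] True r c'
          by (simp add: row_group_eq col_group_eq Stab_def)
      next
        case False
        then show ?thesis using h by (simp add: Sym_def permutes_def)
      qed
    qed
    then show "row_sum \<nu> h * col_sum \<nu> (inv h \<circ> id) = (if h = id then 1 else 0)"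
      using id_Stab by (auto simp: row_sum_def col_sum_def row_group_eq col_group_eq)
  qed
  then show ?thesis by simp
qed

text \<open>This is von Neumann's lemma. Subtracting a multiple of the symmetrizer leaves a function
  \<open>G\<close> with the same symmetries and value 0 at \<open>id\<close>. A permutation with
  distinct row-column pairs factors as \<open>p \<circ> q\<close>, where invariance applies;
  otherwise a colliding pair gives a transposition that acts with sign 1 from the left and -1 from
  the right.\<close>

lemma young_symmetrizer_multiple:
  assumes nu: "\<nu> \<in> partitions n" and GA: "F \<in> group_algebra n"
    and L: "\<And>p g. p \<in> row_group \<nu> \<Longrightarrow> F (p \<circ> g) = F g"
    and R: "\<And>q g. q \<in> col_group \<nu> \<Longrightarrow> F (g \<circ> q) = of_int (sign q) * F g"
  shows "F = scl (F id) (young_symmetrizer \<nu>)"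
proof -
  have n: "sum_list \<nu> = n" using nu by (simp add: partitions_def)
  let ?e = "young_symmetrizer \<nu>"
  define G where "G = (\<lambda>g. F g - F id * ?e g)"
  have eL: "?e (p \<circ> g) = ?e g" if "p \<in> row_group \<nu>" for p g
    unfolding young_symmetrizer_eq using conv_row_sum_left[OF that] .
  have eR: "?e (g \<circ> q) = of_int (sign q) * ?e g" if "q \<in> col_group \<nu>" for q g
    unfolding young_symmetrizer_eq using conv_col_sum_right[OF that] .
  have GL: "G (p \<circ> g) = G g" if "p \<in> row_group \<nu>" for p g
    using L[OF that] eL[OF that] by (simp add: G_def)
  have GR: "G (g \<circ> q) = of_int (sign q) * G g" if "q \<in> col_group \<nu>" for q g
    using R[OF that] eR[OF that] by (simp add: G_def algebra_simps)
  have Gid: "G id = 0" by (simp add: G_def young_symmetrizer_id)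
  have "G g = 0" for g
  proof (cases "g \<in> Sym n")
    case g: True
    show ?thesis
    proof (cases "inj_on (\<lambda>x. (trow \<nu> x, tcol \<nu> (inv g x))) {1..n}")
      case True
      then obtain p q where pq: "p \<in> row_group \<nu>" "q \<in> col_group \<nu>" "g = p \<circ> q"
        using row_col_factor[OF nu g] by blast
      then show ?thesis using GL[of p q] GR[of q id] Gid by simp
    next
      case False
      then obtain x y where xy: "x \<noteq> y" "x \<in> {1..n}" "y \<in> {1..n}" "trow \<nu> x = trow \<nu> y"
          "tcol \<nu> (inv g x) = tcol \<nu> (inv g y)" by (rule collision_pair)
      have r: "transpose x y \<in> row_group \<nu>" unfolding row_group_eq n by (intro transpose_Stab xy)
      have c: "transpose (inv g x) (inv g y) \<in> col_group \<nu>"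
        unfolding col_group_eq n by (intro transpose_Stab inv_in g xy)
      have "G g = G (transpose x y \<circ> g)" using GL[OF r] by simp
      also have "\<dots> = - G g"
        unfolding transpose_comp_Sym[OF g] GR[OF c] by (simp add: sign_transpose_inv[OF g xy(1)])
      finally show ?thesis by simp
    qed
  next
    case False
    then show ?thesis using GA young_symmetrizer_GA[of \<nu>] n by (simp add: G_def group_algebra_def)
  qed
  then show ?thesis unfolding G_def by (intro ext) (metis eq_iff_diff_eq_0)
qed

lemma young_symmetrizer_irr_module: 
  "young_symmetrizer \<nu> \<in> irr_module \<nu>"
proof -
  have "conv (sum_list \<nu>) (delta id) (young_symmetrizer \<nu>) = young_symmetrizer \<nu>"
    by (simp add: conv_delta act_def fun_eq_iff comp_def)
  moreover have "delta id \<in> group_algebra (sum_list \<nu>)" by (auto simp: delta_def group_algebra_def)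
  ultimately show ?thesis unfolding irr_module_def by (metis imageI)
qed

lemma irr_module_right:
  assumes "v \<in> irr_module \<nu>" "q \<in> col_group \<nu>"
  shows "v (g \<circ> q) = of_int (sign q) * v g"
proof -
  obtain u where v: "v = conv (sum_list \<nu>) u (col_sum \<nu>)" using irr_module_cases[OF assms(1)] by blast
  show ?thesis unfolding v by (rule conv_col_sum_right[OF assms(2)])
qed

text \<open>Summing over the row group makes every module element row invariant from the left, hence
  a multiple of the symmetrizer, which itself is multiplied by the group order. The trace is that of
  a rank one operator.\<close>

lemma sum_row_group_irr_char:
  assumes nu: "\<nu> \<in> partitions n"
  shows "(\<Sum>g\<in>row_group \<nu>. irr_char \<nu> g) = of_nat (card (row_group \<nu>))"
proof -
  have n: "sum_list \<nu> = n" using nu by (simp add: partitions_def)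
  let ?R = "row_group \<nu>" and ?e = "young_symmetrizer \<nu>"
  have R: "?R = Stab n (trow \<nu>)" using n by (simp add: row_group_eq)
  define T where "T = (\<lambda>v t. \<Sum>g\<in>?R. 1 * act g v t)"
  have "(\<Sum>g\<in>?R. 1 * irr_char \<nu> g) = trace_on (irr_module \<nu>) T"
    unfolding T_def by (rule sum_irr_char) (auto simp: row_group_def)
  also have "\<dots> = of_nat (card ?R)"
  proof (rule trace_on_rank_one[OF fin_dim_irr_module young_symmetrizer_irr_module])
    show "?e id \<noteq> 0" by (simp add: young_symmetrizer_id)
    show "lin_op T"
      by (simp add: lin_op_def T_def act_def fun_eq_iff sum.distrib sum_distrib_left)
    show "T v = scl (T v id) ?e" if v: "v \<in> irr_module \<nu>" for v
    proof (rule young_symmetrizer_multiple[OF nu])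
      have vGA: "v \<in> group_algebra n" using v irr_module_GA n by blast
      have "act g v h = 0" if "g \<in> ?R" "h \<notin> Sym n" for g h
        using act_GA[OF _ vGA, of g] that Stab_Sym[of g n] R by (auto simp: group_algebra_def)
      then show "T v \<in> group_algebra n" by (auto simp: T_def group_algebra_def)
      show "T v (p \<circ> g) = T v g" if p: "p \<in> ?R" for p g
      proof -
        have "T v (p \<circ> g) = (\<Sum>h\<in>?R. 1 * act (p \<circ> h) v (p \<circ> g))"
          unfolding T_def R by (rule sum_Stab_left[symmetric]) (use p R in simp)
        also have "\<dots> = T v g" unfolding T_def
        proof (rule sum.cong[OF refl])
          fix h assume "h \<in> ?R"
          then show "1 * act (p \<circ> h) v (p \<circ> g) = 1 * act h v g"
            using p Stab_Sym[of p n] Stab_Sym[of h n] R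
            by (simp add: act_def Sym_inv_comp[of p n h] comp_assoc Sym_cancel[of p n])
        qed
        finally show ?thesis .
      qed
      show "T v (g \<circ> q) = of_int (sign q) * T v g" if "q \<in> col_group \<nu>" for q g
        using irr_module_right[OF v that] by (simp add: T_def act_def sum_distrib_left flip: comp_assoc)
    qed
    show "T ?e = scl (of_nat (card ?R)) ?e"
    proof
      fix h
      have "act g ?e h = ?e h" if "g \<in> ?R" for g
        using conv_row_sum_left[of "inv g" \<nu>] inv_Stab[of g n "trow \<nu>"] that R n
        by (simp add: act_def young_symmetrizer_eq)
      then show "T ?e h = of_nat (card ?R) * ?e h" by (simp add: T_def)
    qed
  qed
  finally show ?thesis by simp
qed

text \<open>With all entries in one row, the row group is everything and the column group is
  trivial, so the group acts trivially on a line. The hypothesis on \<open>trow\<close> is phrased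
  so as to include \<open>n = 0\<close>.\<close>

lemma irr_char_single_row:
  assumes nu: "\<nu> \<in> partitions n" and one: "\<And>x. x \<in> {1..n} \<Longrightarrow> trow \<nu> x = 0" and g: "g \<in> Sym n"
  shows "irr_char \<nu> g = 1"
proof -
  have n: "sum_list \<nu> = n" using nu by (simp add: partitions_def)
  let ?e = "young_symmetrizer \<nu>"
  have R: "row_group \<nu> = Sym n" using one Sym_in[of _ n]
    by (auto simp: row_group_eq Stab_def n simp del: atLeastAtMost_iff)
  have C: "q = id" if q: "q \<in> col_group \<nu>" for q
  proof
    fix x
    have qS: "q \<in> Sym n" using q n by (simp add: col_group_def)
    show "q x = id x"
    proof (cases "x \<in> {1..n}")
      case True
      then have "q x \<in> {1..n}" using Sym_in[OF qS] by blast
      then show ?thesis using tab_inj[of "q x" \<nu> x] True one q n by (simp add: col_group_eq Stab_def)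
    next
      case False
      then show ?thesis using qS by (simp add: Sym_def permutes_def)
    qed
  qed
  have const: "v (h \<circ> k) = v k" if v: "v \<in> irr_module \<nu>" and h: "h \<in> Sym n" for v h k
  proof -
    obtain u where u: "v = conv n u (col_sum \<nu>)" "\<And>g p. p \<in> row_group \<nu>
      \<Longrightarrow> u (g \<circ> p) = u g" "v \<in> group_algebra n"
      using irr_module_cases[OF v] n by metis
    \<comment> \<open>The column group is trivial, so \<open>col_sum\<close> is the unit of the
      group algebra.\<close>
    have vu: "v k = u k" if k: "k \<in> Sym n" for k
    proof -
      have "u h * col_sum \<nu> (inv h \<circ> k) = (if h = k then u k else 0)" if h: "h \<in> Sym n" for h
      proof -
        have "col_sum \<nu> (inv h \<circ> k) = (if inv h \<circ> k = id then 1 else 0)"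
          using C id_Stab[of n "tcol \<nu>"] n by (auto simp: col_sum_def col_group_eq)
        moreover have "inv h \<circ> k = id \<longleftrightarrow> h = k"
          using Sym_cancel(2)[OF h, of k] Sym_inv(1)[OF h] by (metis comp_id)
        ultimately show ?thesis by simp
      qed
      then have "v k = (\<Sum>h\<in>Sym n. if h = k then u k else 0)"
        unfolding u(1) conv_def by (intro sum.cong refl) blast
      then show ?thesis using k by simp
    qed
    show ?thesis
    proof (cases "k \<in> Sym n")
      case True
      have "u (h \<circ> k) = u id" "u k = u id"
        using u(2)[of "h \<circ> k" id] u(2)[of k id] R comp_Sym[OF h True] True by simp_all
      then show ?thesis using vu[OF True] vu[OF comp_Sym[OF h True]] by simp
    next
      case False
      then have "h \<circ> k \<notin> Sym n" using Sym_comp_iff(1)[OF h] by blast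
      with False u(3) show ?thesis by (simp add: group_algebra_def)
    qed
  qed
  have inv_act: "act g v = v" if "v \<in> irr_module \<nu>" for v
    using const[OF that inv_Sym[OF g]] by (simp add: act_def)
  have "irr_char \<nu> g = trace_on (irr_module \<nu>) (act g)" using irr_char_eq_trace g n by blast
  also have "\<dots> = 1"
  proof (rule trace_on_rank_one[OF fin_dim_irr_module young_symmetrizer_irr_module _ lin_op_act])
    show "?e id \<noteq> 0" by (simp add: young_symmetrizer_id)
    show "act g v = scl (v id) ?e" if v: "v \<in> irr_module \<nu>" for v
      unfolding inv_act[OF v] 
    proof (rule young_symmetrizer_multiple[OF nu])
      show "v \<in> group_algebra n" using v irr_module_GA n by blast
      show "v (p \<circ> g) = v g" if "p \<in> row_group \<nu>" for p g using const[OF v] that R by blast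
      show "v (g \<circ> q) = of_int (sign q) * v g" if "q \<in> col_group \<nu>" for q g
        by (rule irr_module_right[OF v that])
    qed
    show "act g ?e = scl 1 ?e" using inv_act[OF young_symmetrizer_irr_module] by simp
  qed
  finally show ?thesis .
qed

section \<open>Orbits, cycle types and invariant words\<close>

text \<open>Allows the orbits of a permutation to be listed in the order of a prescribed list of
  cycle lengths.\<close>

lemma mset_eq_image_mset_listE:
  assumes "finite \<Omega>" "mset \<mu> = image_mset f (mset_set \<Omega>)"
  obtains xs where "distinct xs" "set xs = \<Omega>" "map f xs = \<mu>"
proof -
  have "\<exists>xs. distinct xs \<and> set xs = \<Omega> \<and> map f xs = \<mu>"
    using assms
  proof (induction \<mu> arbitrary: \<Omega>)
    case Nil
    then have "\<Omega> = {}" by (simp add: mset_set_empty_iff)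
    then show ?case by simp
  next
    case (Cons r \<mu>)
    have "r \<in># image_mset f (mset_set \<Omega>)" by (simp flip: Cons.prems(2))
    then obtain a where a: "a \<in> \<Omega>" "f a = r" using Cons.prems(1) by auto
    have "mset_set \<Omega> = add_mset a (mset_set (\<Omega> - {a}))"
      using mset_set.remove[OF Cons.prems(1) a(1)] by simp
    then have "mset \<mu> = image_mset f (mset_set (\<Omega> - {a}))" using Cons.prems(2) a(2) by simp
    then obtain xs where "distinct xs" "set xs = \<Omega> - {a}" "map f xs = \<mu>"
      using Cons.IH[of "\<Omega> - {a}"] Cons.prems(1) by auto
    then show ?case using a by (intro exI[of _ "a # xs"]) auto
  qed
  then show ?thesis using that by blast
qed

lemma orbit_eq_iff:
  assumes "permutation p"
  shows "orbit p x = orbit p y \<longleftrightarrow> x \<in> orbit p y"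
proof
  show "orbit p x = orbit p y \<Longrightarrow> x \<in> orbit p y" using permutation_self_in_orbit[OF assms, of x] by simp
  show "x \<in> orbit p y \<Longrightarrow> orbit p x = orbit p y" by (rule orbit_cyclic_eq3[OF cyclic_on_orbit'[OF assms]])
qed

lemma orbits_disjoint:
  assumes "permutation p" "orbit p x \<noteq> orbit p y"
  shows "orbit p x \<inter> orbit p y = {}"
proof (rule ccontr)
  assume "orbit p x \<inter> orbit p y \<noteq> {}"
  then obtain z where "z \<in> orbit p x" "z \<in> orbit p y" by blast
  then have "orbit p z = orbit p x" "orbit p z = orbit p y" by (simp_all add: orbit_eq_iff[OF assms(1)])
  then show False using assms(2) by simp
qed

lemma Union_orbits:
  assumes "p permutes S" "finite S"
  shows "\<Union> (orbit p ` S) = S"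
proof
  show "\<Union> (orbit p ` S) \<subseteq> S" using permutes_orbit_subset[OF assms(1)] by blast
  have "permutation p" using assms by (auto simp: permutation_permutes)
  then show "S \<subseteq> \<Union> (orbit p ` S)" using permutation_self_in_orbit by fast
qed

lemma finite_orbit_permutation: "permutation p \<Longrightarrow> finite (orbit p x)"
  by (rule finite_orbit[OF permutation_self_in_orbit])

lemma card_orbit: "permutation p \<Longrightarrow> card (orbit p x) = least_power p x"
proof -
  assume p: "permutation p"
  have "orbit p x = set (support p x)"
    unfolding support_set[OF p] using orbit_altdef_permutation[OF p] by auto
  then show ?thesis using distinct_card[OF cycle_of_permutation[OF p, of x]] by simp
qed

lemma funpow_eq_iff_dvd:
  assumes "permutation p" "a \<le> b"
  shows "(p ^^ a) x = (p ^^ b) x \<longleftrightarrow> card (orbit p x) dvd b - a"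
proof -
  have i: "inj p" using assms(1) by (simp add: permutation bij_is_inj)
  have "(p ^^ b) x = (p ^^ a) ((p ^^ (b - a)) x)"
    using assms(2) by (metis funpow_add le_add_diff_inverse comp_apply)
  then have "(p ^^ a) x = (p ^^ b) x \<longleftrightarrow> (p ^^ (b - a)) x = x"
    using inj_fn[OF i, of a] by (metis injD)
  then show ?thesis by (simp add: card_orbit[OF assms(1)] least_power_dvd[OF assms(1)])
qed

lemma funpow_eq_transfer:
  assumes "permutation p" "permutation q" "card (orbit p x) = card (orbit q y)"
  shows "(p ^^ a) x = (p ^^ b) x \<longleftrightarrow> (q ^^ a) y = (q ^^ b) y"
proof (cases "a \<le> b")
  case True
  then show ?thesis using funpow_eq_iff_dvd assms by metis
next
  case False
  then have "b \<le> a" by simp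
  then show ?thesis using funpow_eq_iff_dvd assms by metis
qed

text \<open>Orbits of equal length are paired through a common list of lengths. After a choice of
  base points, the conjugating permutation sends the \<open>a\<close>-th iterate of \<open>g\<close>
  at \<open>X i\<close> to the \<open>a\<close>-th iterate of \<open>h\<close> at
  \<open>Y i\<close>.\<close>

lemma cycle_type_conj:
  assumes g: "g \<in> Sym n" and h: "h \<in> Sym n" and ct: "cycle_type n g = cycle_type n h"
  obtains k where "k \<in> Sym n" "h = k \<circ> g \<circ> inv k"
proof -
  let ?X = "{1..n}"
  have pg: "permutation g" and ph: "permutation h" using g h Sym_permutation by auto
  have Ug: "\<Union> (orbit g ` ?X) = ?X" and Uh: "\<Union> (orbit h ` ?X) = ?X"
    using g h by (simp_all add: Sym_def Union_orbits)
  obtain \<mu> where mu: "mset \<mu> = cycle_type n g" using ex_mset by blast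
  obtain xs where xs: "distinct xs" "set xs = orbit g ` ?X" "map card xs = \<mu>"
    using mset_eq_image_mset_listE[of "orbit g ` ?X" \<mu> card] mu by (auto simp: cycle_type_def)
  obtain ys where ys: "distinct ys" "set ys = orbit h ` ?X" "map card ys = \<mu>"
    using mset_eq_image_mset_listE[of "orbit h ` ?X" \<mu> card] mu ct by (auto simp: cycle_type_def)
  let ?L = "length \<mu>"
  have lx: "length xs = ?L" and ly: "length ys = ?L" using xs(3) ys(3)
    by (auto dest: arg_cong[of _ _ length])
  have "\<forall>i. \<exists>x. i < ?L \<longrightarrow> x \<in> ?X \<and> xs ! i = orbit g x" 
    using xs(2) lx by (metis (no_types, lifting) imageE nth_mem)
  then obtain X where X: "\<And>i. i < ?L \<Longrightarrow> X i \<in> ?X \<and> xs ! i = orbit g (X i)" by metis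
  have "\<forall>i. \<exists>x. i < ?L \<longrightarrow> x \<in> ?X \<and> ys ! i = orbit h x" 
    using ys(2) ly by (metis (no_types, lifting) imageE nth_mem)
  then obtain Y where Y: "\<And>i. i < ?L \<Longrightarrow> Y i \<in> ?X \<and> ys ! i = orbit h (Y i)" by metis
  have card: "card (orbit g (X i)) = card (orbit h (Y i))" if "i < ?L" for i
  proof -
    have "card (xs ! i) = \<mu> ! i" "card (ys ! i) = \<mu> ! i" using xs(3) ys(3) that lx ly by (metis nth_map)+
    then show ?thesis using X[OF that] Y[OF that] by simp
  qed
  have in_orb: "(p ^^ a) x \<in> orbit p x" if "permutation p" for p :: "nat \<Rightarrow> nat" and a x
    using orbit_altdef_permutation[OF that] by blast
  have same: "i = j" if "i < ?L" "j < ?L" "(g ^^ a) (X i) = (g ^^ b) (X j)" for i j a b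
  proof -
    have "orbit g (X i) = orbit g (X j)" using orbits_disjoint[OF pg] in_orb[OF pg] that(3)
      by (metis disjoint_iff)
    then show ?thesis using X that xs(1) lx by (metis nth_eq_iff_index_eq)
  qed
  have same': "i = j" if "i < ?L" "j < ?L" "(h ^^ a) (Y i) = (h ^^ b) (Y j)" for i j a b
  proof -
    have "orbit h (Y i) = orbit h (Y j)" using orbits_disjoint[OF ph] in_orb[OF ph] that(3)
      by (metis disjoint_iff)
    then show ?thesis using Y that ys(1) ly by (metis nth_eq_iff_index_eq)
  qed
  \<comment> \<open>Coincidences among iterates are the same on both sides; in one direction this
    makes the map well defined, in the other injective.\<close>
  have transfer: "(g ^^ a) (X i) = (g ^^ b) (X j) \<longleftrightarrow> (h ^^ a) (Y i) = (h ^^ b) (Y j)"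
    if "i < ?L" "j < ?L" for i j a b
    using same[OF that] same'[OF that] funpow_eq_transfer[OF pg ph card[OF that(1)]] by metis
  define k where "k = (\<lambda>z. if z \<in> ?X then SOME y. \<exists>i a. i < ?L \<and> z = (g ^^ a) (X i) \<and> y
    = (h ^^ a) (Y i) else z)"
  have ex: "\<exists>i a. i < ?L \<and> z = (g ^^ a) (X i)" if z: "z \<in> ?X" for z
  proof -
    have "orbit g z \<in> set xs" using xs(2) z by blast
    then obtain i where i: "i < ?L" "xs ! i = orbit g z" using lx by (metis in_set_conv_nth)
    then have "z \<in> orbit g (X i)" using X[OF i(1)] permutation_self_in_orbit[OF pg] by metis
    then show ?thesis using i(1) orbit_altdef_permutation[OF pg] by blast
  qed
  have inX: "(p ^^ a) x \<in> ?X" if "p \<in> Sym n" "x \<in> ?X" for p a x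
    using that Sym_in[OF that(1)] by (induction a) (auto simp del: atLeastAtMost_iff)
  have keq: "k ((g ^^ a) (X i)) = (h ^^ a) (Y i)" if i: "i < ?L" for i a
  proof -
    have "(g ^^ a) (X i) \<in> ?X" using inX[OF g] X[OF i] by blast
    then have "k ((g ^^ a) (X i)) = (SOME y. \<exists>j b. j < ?L \<and> (g ^^ a) (X i) = (g ^^ b) (X j) \<and> y
      = (h ^^ b) (Y j))"
      unfolding k_def by (simp only: if_True)
    also have "\<dots> = (h ^^ a) (Y i)"
      by (rule some_equality) (use i transfer in \<open>blast, metis\<close>)
    finally show ?thesis .
  qed
  have "k permutes ?X"
  proof (rule permutes_if_inj_on)
    show "inj_on k ?X"
    proof (rule inj_onI)
      fix z z' assume "z \<in> ?X" "z' \<in> ?X" and eq: "k z = k z'"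
      obtain i a where i: "i < ?L" "z = (g ^^ a) (X i)" using ex[OF \<open>z \<in> ?X\<close>] by blast
      obtain j b where j: "j < ?L" "z' = (g ^^ b) (X j)" using ex[OF \<open>z' \<in> ?X\<close>] by blast
      show "z = z'" using eq unfolding i(2) j(2) keq[OF i(1)] keq[OF j(1)] transfer[OF i(1) j(1)] .
    qed
    show "k z \<in> ?X" if z: "z \<in> ?X" for z
    proof -
      obtain i a where i: "i < ?L" "z = (g ^^ a) (X i)" using ex[OF z] by blast
      show ?thesis unfolding i(2) keq[OF i(1)] using inX[OF h] Y[OF i(1)] by blast
    qed
  qed (simp_all add: k_def del: atLeastAtMost_iff)
  then have kS: "k \<in> Sym n" by (simp add: Sym_def)
  have "k (g z) = h (k z)" for z
  proof (cases "z \<in> ?X")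
    case True
    obtain i a where i: "i < ?L" "z = (g ^^ a) (X i)" using ex[OF True] by blast
    show ?thesis unfolding i(2) using keq[OF i(1), of "Suc a"] keq[OF i(1), of a] by simp
  next
    case False
    then show ?thesis using g h kS by (simp add: Sym_def permutes_not_in)
  qed
  then have "k \<circ> g = h \<circ> k" by (simp add: fun_eq_iff)
  then have "h = k \<circ> g \<circ> inv k" using Sym_cancel(3)[OF kS, of h] by simp
  then show ?thesis using that kS by blast
qed

lemma irr_char_cycle_type:
  assumes "\<nu> \<in> partitions n" "g \<in> Sym n" "h \<in> Sym n" "cycle_type n g = cycle_type n h"
  shows "irr_char \<nu> g = irr_char \<nu> h"
proof -
  obtain k where "k \<in> Sym n" "h = k \<circ> g \<circ> inv k" using cycle_type_conj[OF assms(2-4)] .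
  then show ?thesis using irr_char_conj[of g \<nu> k] assms by (simp add: partitions_def)
qed

text \<open>The predecessor of \<open>x\<close> is sent directly to \<open>p x\<close>, so
  \<open>x\<close> is cut out of its cycle and becomes a fixed point, while all other cycles are
  untouched.\<close>

lemma orbit_skip:
  assumes p: "permutation p" and x: "p x \<noteq> x"
  defines "p' \<equiv> transpose x (p x) \<circ> p"
  shows "orbit p' x = {x}"
    and "y \<in> orbit p x \<Longrightarrow> y \<noteq> x \<Longrightarrow> orbit p' y = orbit p x - {x}"
    and "y \<notin> orbit p x \<Longrightarrow> orbit p' y = orbit p y"
proof -
  have inj: "p a = p b \<longleftrightarrow> a = b" for a b using p by (metis bij_pointE permutation)
  have p'x: "p' x = x" by (simp add: p'_def)
  then show "orbit p' x = {x}" by (simp add: orbit_eq_singleton_iff)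
  have p'1: "p' z = p z" if "z \<noteq> x" "p z \<noteq> x" for z
    using that inj[of z x] by (simp add: p'_def)
  have p'2: "p' z = p x" if "p z = x" for z using that by (simp add: p'_def)
  show "orbit p' y = orbit p x - {x}" if y: "y \<in> orbit p x" "y \<noteq> x"
  proof (intro equalityI subsetI)
    have p'ne: "p' z \<noteq> x" if "z \<noteq> x" for z using p'1[OF that] p'2[of z] x by metis
    have p'in: "p' z \<in> orbit p x" if "z \<in> orbit p x" "z \<noteq> x" for z
      using p'1[OF that(2)] p'2[of z] that(1) by (metis orbit.base orbit.step)
    fix z assume "z \<in> orbit p' y"
    then show "z \<in> orbit p x - {x}"
      by induction (use y p'ne p'in in auto)
  next
    fix z assume z: "z \<in> orbit p x - {x}"
    have "orbit p y = orbit p x" using y orbit_eq_iff[OF p] by blast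
    then have "z \<in> orbit p y" using z by blast
    \<comment> \<open>The walk along \<open>p\<close> may pass through \<open>x\<close>, which
      \<open>p'\<close> avoids; the second clause keeps hold of the point \<open>p x\<close> at
      which \<open>p'\<close> resumes.\<close>
    then have "(z \<noteq> x \<longrightarrow> z \<in> orbit p' y) \<and> (z = x \<longrightarrow> p x \<in> orbit p' y)"
    proof induction
      case base
      show ?case using p'1[OF y(2)] p'2[of y] orbit.base[of p' y] by metis
    next
      case (step z)
      show ?case
      proof (cases "z = x")
        case True
        then show ?thesis using step.IH x by simp
      next
        case False
        then have "p' z \<in> orbit p' y" using step.IH orbit.step by metis
        then show ?thesis using p'1[OF False] p'2[of z] by metis
      qed
    qed
    then show "z \<in> orbit p' y" using z by simp
  qed
  show "orbit p' y = orbit p y" if y: "y \<notin> orbit p x"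
  proof -
    have nx: "x \<notin> orbit p y" using y orbit_eq_iff[OF p] permutation_self_in_orbit[OF p] by metis
    have "p' z = p z" if "z \<in> orbit p y" for z
      using p'1[of z] that nx orbit.step[OF that] by metis
    then show ?thesis
      using permutation_self_in_orbit[OF p] orbit.step
        by (intro orbit_cong0[of y "orbit p y" p p', symmetric]) auto
  qed
qed

text \<open>By \<open>orbit_skip\<close>, cutting a moved point out of its cycle flips the sign and
  adds one orbit. The number of moved points drops until only the identity is left.\<close>

lemma sign_eq_orbits:
  assumes "p permutes S" "finite S"
  shows "sign p = (-1) ^ (card S + card (orbit p ` S))"
  using assms(1)
proof (induction "card {z \<in> S. p z \<noteq> z}" arbitrary: p rule: less_induct)
  case less
  show ?case
  proof (cases "\<exists>x\<in>S. p x \<noteq> x")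
    case False
    then have id: "p = id" using less.prems by (auto simp: permutes_def fun_eq_iff)
    have "orbit p ` S = (\<lambda>x. {x}) ` S" unfolding id using orbit_eq_singleton_iff[of id]
      by (intro image_cong) simp_all
    then have "card (orbit p ` S) = card S" by (simp add: card_image)
    then show ?thesis by (simp add: id flip: mult_2)
  next
    case True
    then obtain x where x: "x \<in> S" "p x \<noteq> x" by blast
    let ?p' = "transpose x (p x) \<circ> p"
    have perm: "permutation p" using less.prems assms(2) by (auto simp: permutation_permutes)
    have px: "p x \<in> S" using x less.prems by (simp add: permutes_in_image)
    have p': "?p' permutes S" by (intro permutes_compose less.prems permutes_swap_id x px)
    have inj: "p a = p b \<longleftrightarrow> a = b" for a b using perm by (metis bij_pointE permutation)
    note sk = orbit_skip[OF perm x(2)]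
    have "{z \<in> S. ?p' z \<noteq> z} \<subset> {z \<in> S. p z \<noteq> z}"
    proof
      have "?p' z = z" if "p z = z" for z
        using that inj[of z x] x(2) inj[of "p x" x] by (metis comp_apply transpose_apply_other)
      then show "{z \<in> S. ?p' z \<noteq> z} \<subseteq> {z \<in> S. p z \<noteq> z}" by blast
      have "?p' x = x" by simp
      then show "{z \<in> S. ?p' z \<noteq> z} \<noteq> {z \<in> S. p z \<noteq> z}" using x by blast
    qed
    then have "card {z \<in> S. ?p' z \<noteq> z} < card {z \<in> S. p z \<noteq> z}"
      using assms(2) by (intro psubset_card_mono) auto
    then have IH: "sign ?p' = (-1) ^ (card S + card (orbit ?p' ` S))" using less.hyps p' by blast
    have sgn: "sign ?p' = - sign p"
      using perm x(2) by (subst sign_compose) (auto simp: sign_swap_id permutation_swap_id)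
    let ?O = "orbit p x"
    let ?R = "orbit p ` S - {?O}"
    have pxO: "p x \<in> ?O - {x}" using x(2) orbit.base[of p x] by simp
    have self: "z \<in> orbit p z" for z using permutation_self_in_orbit[OF perm] .
    have eq: "orbit ?p' ` S = insert {x} (insert (?O - {x}) ?R)"
    proof (intro equalityI subsetI)
      fix A assume "A \<in> orbit ?p' ` S"
      then obtain z where z: "z \<in> S" "A = orbit ?p' z" by blast
      consider "z = x" | "z \<in> ?O" "z \<noteq> x" | "z \<notin> ?O" by blast
      then show "A \<in> insert {x} (insert (?O - {x}) ?R)"
      proof cases
        case 1 then show ?thesis using z sk(1) by simp
      next
        case 2 then show ?thesis using z sk(2) by simp
      next
        case 3
        then have "A = orbit p z" using z sk(3) by simp
        moreover have "orbit p z \<noteq> ?O" using 3 self by metis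
        ultimately show ?thesis using z by blast
      qed
    next
      fix A assume "A \<in> insert {x} (insert (?O - {x}) ?R)"
      then consider "A = {x}" | "A = ?O - {x}" | z where "z \<in> S" "A = orbit p z" "orbit p z \<noteq> ?O" by blast
      then show "A \<in> orbit ?p' ` S"
      proof cases
        case 1 then show ?thesis using x sk(1) by blast
      next
        case 2 then show ?thesis using px pxO sk(2)[of "p x"] by (metis DiffE imageI singletonI)
      next
        case 3
        then have "z \<notin> ?O" using orbit_eq_iff[OF perm] by blast
        then show ?thesis using 3 sk(3) by (metis imageI)
      qed
    qed
    have xR: "B \<inter> ?O = {}" if "B \<in> ?R" for B using that orbits_disjoint[OF perm] by blast
    have finR: "finite ?R" using assms(2) by simp
    have n1: "?O - {x} \<notin> ?R" using xR[of "?O - {x}"] pxO by blast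
    have n2: "{x} \<notin> insert (?O - {x}) ?R" using xR[of "{x}"] self[of x] by blast
    have "card (orbit ?p' ` S) = Suc (Suc (card ?R))" unfolding eq using n1 n2 finR by simp
    moreover have "Suc (card ?R) = card (orbit p ` S)"
      using x(1) assms(2) by (intro card_Suc_Diff1) auto
    ultimately have "card (orbit ?p' ` S) = Suc (card (orbit p ` S))" by (simp only:)
    then show ?thesis using IH sgn by (simp only: add_Suc_right power_Suc)
  qed
qed

text \<open>The blocks will be the orbits of a permutation; they form a list so that the recursion
  of \<open>word_count\<close> can remove one at a time. Extensional functions make each colouring
  of the blocks count once.\<close>

definition words :: "nat \<Rightarrow> nat set list \<Rightarrow> (nat \<Rightarrow> int) \<Rightarrow> (nat \<Rightarrow> nat) set" where
  "words k Os \<alpha> = {w \<in> \<Union> (set Os) \<rightarrow>\<^sub>E {..<k}.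
     (\<forall>A\<in>set Os. \<forall>x\<in>A. \<forall>y\<in>A. w x = w y) \<and>
     (\<forall>i<k. int (card {x \<in> \<Union> (set Os). w x = i}) = \<alpha> i)}"

lemma wordsD:
  assumes "w \<in> words k Os \<alpha>"
  shows "w \<in> \<Union> (set Os) \<rightarrow>\<^sub>E {..<k}"
    and "A \<in> set Os \<Longrightarrow> x \<in> A \<Longrightarrow> y \<in> A \<Longrightarrow> w x = w y"
    and "i < k \<Longrightarrow> int (card {x \<in> \<Union> (set Os). w x = i}) = \<alpha> i"
proof -
  note * = assms[unfolded words_def mem_Collect_eq]
  show "w \<in> \<Union> (set Os) \<rightarrow>\<^sub>E {..<k}" using * by (rule conjunct1)
  show "w x = w y" if "A \<in> set Os" "x \<in> A" "y \<in> A"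
    using *[THEN conjunct2, THEN conjunct1, rule_format, OF that] .
  show "int (card {x \<in> \<Union> (set Os). w x = i}) = \<alpha> i" if "i < k"
    using *[THEN conjunct2, THEN conjunct2, rule_format, OF that] .
qed

lemma wordsI:
  assumes "w \<in> \<Union> (set Os) \<rightarrow>\<^sub>E {..<k}"
    and "\<And>A x y. A \<in> set Os \<Longrightarrow> x \<in> A \<Longrightarrow> y \<in> A \<Longrightarrow> w x = w y"
    and "\<And>i. i < k \<Longrightarrow> int (card {x \<in> \<Union> (set Os). w x = i}) = \<alpha> i"
  shows "w \<in> words k Os \<alpha>"
  unfolding words_def mem_Collect_eq
proof (intro conjI)
  show "\<forall>A\<in>set Os. \<forall>x\<in>A. \<forall>y\<in>A. w x = w y" by (intro ballI) (rule assms(2))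
  show "\<forall>i<k. int (card {x \<in> \<Union> (set Os). w x = i}) = \<alpha> i" using assms(3) by blast
qed (rule assms(1))

lemma words_Cons_bij:
  assumes A: "A \<noteq> {}" "finite A" "A \<inter> \<Union> (set Os) = {}" "finite (\<Union> (set Os))" and i: "i < k"
  shows "bij_betw (\<lambda>w. restrict w (\<Union> (set Os))) {w \<in> words k (A # Os) \<alpha>. \<forall>x\<in>A. w x = i}
    (words k Os (\<alpha>(i := \<alpha> i - int (card A))))"
proof -
  let ?U = "\<Union> (set Os)"
  \<comment> \<open>The inverse of restriction: the removed block is painted again with the letter
    \<open>i\<close>.\<close>
  let ?ext = "\<lambda>w x. if x \<in> A then i else w x"
  have cnt: "card {x \<in> \<Union> (set (A # Os)). w x = j} = (if j = i then card A else 0) + card {x \<in> ?U. w x = j}"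
    if "\<forall>x\<in>A. w x = i" for w j
  proof -
    have "{x \<in> \<Union> (set (A # Os)). w x = j} = (if j = i then A else {}) \<union> {x \<in> ?U. w x = j}"
      using that by auto
    moreover have "finite {x \<in> ?U. w x = j}" "A \<inter> {x \<in> ?U. w x = j} = {}"
      using A(3,4) finite_subset[of "{x \<in> ?U. w x = j}" ?U] by auto
    ultimately show ?thesis using A(2) by (cases "j
      = i") (simp_all add: card_Un_disjoint del: set_simps UN_simps)
  qed
  have cong: "card {x \<in> ?U. w x = j} = card {x \<in> ?U. w' x = j}"
    if "\<And>x. x \<in> ?U \<Longrightarrow> w x = w' x" for w w' :: "nat \<Rightarrow> nat" and j
    using that by (intro arg_cong[of _ _ card] Collect_cong) metis
  show ?thesis
  proof (rule bij_betw_byWitness[where f' = ?ext])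
    show "\<forall>w\<in>{w \<in> words k (A # Os) \<alpha>. \<forall>x\<in>A. w x = i}. ?ext (restrict w ?U) = w"
    proof (intro ballI ext)
      fix w x assume w: "w \<in> {w \<in> words k (A # Os) \<alpha>. \<forall>x\<in>A. w x = i}"
      then have "w \<in> \<Union> (set (A # Os)) \<rightarrow>\<^sub>E {..<k}" by (intro wordsD(1)) blast
      from PiE_arb[OF this, of x] show "?ext (restrict w ?U) x = w x"
        using w by (cases "x \<in> A"; cases "x \<in> ?U") simp_all
    qed
    show "\<forall>w\<in>words k Os (\<alpha>(i := \<alpha> i - int (card A))). restrict (?ext w) ?U = w"
    proof (intro ballI ext)
      fix w x assume w: "w \<in> words k Os (\<alpha>(i := \<alpha> i - int (card A)))"
      have "x \<notin> A" if "x \<in> ?U" using that A(3) by blast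
      then show "restrict (?ext w) ?U x = w x"
        using PiE_arb[OF wordsD(1)[OF w], of x] by (cases "x \<in> ?U") simp_all
    qed
    show "(\<lambda>w. restrict w ?U) ` {w \<in> words k (A # Os) \<alpha>. \<forall>x\<in>A. w x
      = i} \<subseteq> words k Os (\<alpha>(i := \<alpha> i - int (card A)))"
    proof clarify
      fix w assume w: "w \<in> words k (A # Os) \<alpha>" "\<forall>x\<in>A. w x = i"
      show "restrict w ?U \<in> words k Os (\<alpha>(i := \<alpha> i - int (card A)))"
      proof (rule wordsI)
        show "restrict w ?U \<in> ?U \<rightarrow>\<^sub>E {..<k}" using PiE_mem[OF wordsD(1)[OF w(1)]] by auto
        show "restrict w ?U x = restrict w ?U y" if "B \<in> set Os" "x \<in> B" "y \<in> B" for B x y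
        proof -
          have "x \<in> ?U" "y \<in> ?U" using that by blast+
          then show ?thesis using wordsD(2)[OF w(1), of B x y] that by simp
        qed
        show "int (card {x \<in> ?U. restrict w ?U x = j}) = (\<alpha>(i := \<alpha> i - int (card A))) j" if "j < k" for j
        proof -
          have "card {x \<in> ?U. restrict w ?U x = j} = card {x \<in> ?U. w x = j}"
            by (rule cong) (simp only: restrict_apply if_True)
          moreover have "int (card {x \<in> \<Union> (set (A # Os)). w x = j}) = \<alpha> j" by (rule wordsD(3)[OF w(1) that])
          ultimately show ?thesis using cnt[OF w(2), of j] by (cases "j = i") simp_all
        qed
      qed
    qed
    show "?ext ` words k Os (\<alpha>(i := \<alpha> i - int (card A))) \<subseteq> {w \<in> words k (A # Os) \<alpha>. \<forall>x\<in>A. w x = i}"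
    proof clarify
      fix w assume w: "w \<in> words k Os (\<alpha>(i := \<alpha> i - int (card A)))"
      have dis: "x \<notin> A" if "B \<in> set Os" "x \<in> B" for x B using that A(3) by blast
      have "?ext w \<in> words k (A # Os) \<alpha>"
      proof (rule wordsI)
        show "?ext w \<in> \<Union> (set (A # Os)) \<rightarrow>\<^sub>E {..<k}"
        proof (rule PiE_I)
          fix x assume "x \<in> \<Union> (set (A # Os))"
          then show "?ext w x \<in> {..<k}" using PiE_mem[OF wordsD(1)[OF w], of x] i
            by (cases "x \<in> A") simp_all
        next
          fix x assume "x \<notin> \<Union> (set (A # Os))"
          then show "?ext w x = undefined" using PiE_arb[OF wordsD(1)[OF w], of x] by simp
        qed
        show "?ext w x = ?ext w y" if B: "B \<in> set (A # Os)" "x \<in> B" "y \<in> B" for B x y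
        proof (cases "B = A")
          case False
          then have "B \<in> set Os" using B by simp
          then show ?thesis using dis[of B x] dis[of B y] wordsD(2)[OF w, of B x y] B by simp
        qed (use B in simp)
        show "int (card {x \<in> \<Union> (set (A # Os)). ?ext w x = j}) = \<alpha> j" if "j < k" for j
        proof -
          have "card {x \<in> ?U. ?ext w x = j} = card {x \<in> ?U. w x = j}" by (rule cong) (use dis in auto)
          then show ?thesis using cnt[of "?ext w" j] wordsD(3)[OF w that] by (cases "j = i") simp_all
        qed
      qed
      then show "?ext w \<in> words k (A # Os) \<alpha> \<and> (\<forall>x\<in>A. ?ext w x = i)" by simp
    qed
  qed
qed

lemma finite_words: "finite (\<Union> (set Os)) \<Longrightarrow> finite (words k Os \<alpha>)"
  by (rule finite_subset[of _ "\<Union> (set Os) \<rightarrow>\<^sub>E {..<k}"]) (auto simp: words_def intro: finite_PiE)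

text \<open>Sorting the words by their letter on the first block reproduces the recursion of
  \<open>word_count\<close>.\<close>

lemma word_count_eq_card_words:
  assumes "\<And>A. A \<in> set Os \<Longrightarrow> finite A \<and> A \<noteq> {}" "distinct Os" "disjoint (set Os)"
  shows "word_count k (map card Os) \<alpha> = int (card (words k Os \<alpha>))"
  using assms
proof (induction Os arbitrary: \<alpha>)
  case Nil
  have "words k [] \<alpha> = (if \<forall>i<k. \<alpha> i = 0 then {\<lambda>_. undefined} else {})"
    by (auto simp: words_def)
  then show ?case by simp
next
  case (Cons A Os)
  have finB: "finite B" if "B \<in> set (A # Os)" for B using Cons.prems(1)[OF that] by simp
  have fin: "finite (\<Union> (set Os))" "finite (\<Union> (set (A # Os)))"
    by (rule finite_Union; use finB in simp)+
  have dis: "A \<inter> B = {}" if "B \<in> set Os" for B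
  proof -
    have "A \<noteq> B" using Cons.prems(2) that by auto
    then show ?thesis using pairwiseD[OF Cons.prems(3), of A B] that by (simp add: disjnt_def)
  qed
  have A: "A \<noteq> {}" "finite A" "A \<inter> \<Union> (set Os) = {}"
    using Cons.prems(1)[of A] dis by (simp, simp, blast)
  have dj: "disjoint (set Os)" using Cons.prems(3) by (rule pairwise_subset) auto
  let ?W = "\<lambda>i. {w \<in> words k (A # Os) \<alpha>. \<forall>x\<in>A. w x = i}"
  obtain a where a: "a \<in> A" using A(1) by blast
  have "words k (A # Os) \<alpha> = (\<Union>i<k. ?W i)"
  proof (intro equalityI subsetI)
    fix w assume w: "w \<in> words k (A # Os) \<alpha>"
    then have "w \<in> \<Union> (set (A # Os)) \<rightarrow>\<^sub>E {..<k}" unfolding words_def by blast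
    from PiE_mem[OF this, of a] have "w a \<in> {..<k}" using a by simp
    moreover have "\<forall>B\<in>set (A # Os). \<forall>x\<in>B. \<forall>y\<in>B. w x = w y" using w unfolding words_def by blast
    then have "\<forall>x\<in>A. w x = w a" using a by (meson list.set_intros(1))
    ultimately show "w \<in> (\<Union>i<k. ?W i)" using w by blast
  qed auto
  then have "int (card (words k (A # Os) \<alpha>)) = int (card (\<Union>i<k. ?W i))" by simp
  also have "card (\<Union>i<k. ?W i) = (\<Sum>i<k. card (?W i))"
    using a finite_words[OF fin(2), of k \<alpha>] by (intro card_UN_disjoint) auto
  also have "int \<dots> = (\<Sum>i<k. int (card (words k Os (\<alpha>(i := \<alpha> i - int (card A))))))"
    using bij_betw_same_card[OF words_Cons_bij[OF A fin(1), of _ k \<alpha>]] by simp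
  also have "\<dots> = (\<Sum>i<k. word_count k (map card Os) (\<alpha>(i := \<alpha> i - int (card A))))"
    using Cons.IH[OF _ _ dj] Cons.prems(1,2) by (simp del: fun_upd_apply)
  finally show ?case by (simp del: fun_upd_apply)
qed

text \<open>Negative entries of \<alpha> are allowed, as they occur in the determinantal expansion;
  the set is then empty.\<close>

definition content_words :: "nat \<Rightarrow> nat \<Rightarrow> (nat \<Rightarrow> int) \<Rightarrow> (nat \<Rightarrow> nat) set" where
  "content_words n k \<alpha> = {w \<in> {1..n} \<rightarrow>\<^sub>E {..<k}. \<forall>i<k. int (card {x \<in> {1..n}. w x = i}) = \<alpha> i}"

lemma finite_content_words [simp]: "finite (content_words n k \<alpha>)"
  by (rule finite_subset[of _ "{1..n} \<rightarrow>\<^sub>E {..<k}"]) (auto simp: content_words_def intro: finite_PiE)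

text \<open>A word is fixed by \<open>g\<close> exactly when it is constant on the orbits of
  \<open>g\<close>. So \<open>word_count\<close> is the character of the permutation representation
  on words of content \<alpha>.\<close>

lemma word_count_eq_card:
  assumes g: "g \<in> Sym n" and mu: "mset \<mu> = cycle_type n g"
  shows "word_count k \<mu> \<alpha> = int (card {w \<in> content_words n k \<alpha>. g \<in> Stab n w})"
proof -
  let ?X = "{1..n}"
  have pg: "permutation g" using g Sym_permutation by auto
  have U: "\<Union> (orbit g ` ?X) = ?X" using g by (simp add: Sym_def Union_orbits)
  obtain Os where Os: "distinct Os" "set Os = orbit g ` ?X" "map card Os = \<mu>"
    using mset_eq_image_mset_listE[of "orbit g ` ?X" \<mu> card] mu by (auto simp: cycle_type_def)
  have UO: "\<Union> (set Os) = ?X" using Os(2) U by simp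
  have const: "(\<forall>A\<in>set Os. \<forall>x\<in>A. \<forall>y\<in>A. w x = w y) \<longleftrightarrow> (\<forall>x\<in>?X. w (g x) = w x)" for w :: "nat \<Rightarrow> nat"
  proof
    assume *: "\<forall>A\<in>set Os. \<forall>x\<in>A. \<forall>y\<in>A. w x = w y"
    show "\<forall>x\<in>?X. w (g x) = w x"
    proof
      fix x assume "x \<in> ?X"
      then have "orbit g x \<in> set Os" using Os(2) by blast
      then show "w (g x) = w x" using * permutation_self_in_orbit[OF pg] orbit.base by metis
    qed
  next
    assume *: "\<forall>x\<in>?X. w (g x) = w x"
    have "w y = w x" if "y \<in> orbit g x" "x \<in> ?X" for x y
      using that(1)
    proof induction
      case base show ?case using * that(2) by blast
    next
      case (step y)
      have "y \<in> ?X" using step.hyps U that(2) by blast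
      then show ?case using * step.IH by metis
    qed
    then show "\<forall>A\<in>set Os. \<forall>x\<in>A. \<forall>y\<in>A. w x = w y" unfolding Os(2) by (metis imageE)
  qed
  have "word_count k \<mu> \<alpha> = int (card (words k Os \<alpha>))"
    unfolding Os(3)[symmetric]
  proof (rule word_count_eq_card_words)
    show "finite A \<and> A \<noteq> {}" if "A \<in> set Os" for A
      using that Os(2) finite_orbit_permutation[OF pg] orbit_nonempty by (metis imageE)
    show "disjoint (set Os)" unfolding Os(2) using orbits_disjoint[OF pg]
      by (auto simp: disjoint_def pairwise_def disjnt_def)
  qed (rule Os(1))
  also have "words k Os \<alpha> = {w \<in> content_words n k \<alpha>. g \<in> Stab n w}"
    using g by (auto simp only: words_def UO const content_words_def Stab_def)
  finally show ?thesis .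
qed

section \<open>Permutation characters\<close>

lemma sum_mset_cycle_type:
  assumes "g \<in> Sym n"
  shows "sum_mset (cycle_type n g) = n"
proof -
  have pg: "permutation g" using assms Sym_permutation by auto
  have "sum_mset (cycle_type n g) = (\<Sum>A\<in>orbit g ` {1..n}. card A)"
    by (simp add: cycle_type_def sum_unfold_sum_mset)
  also have "\<dots> = card (\<Union> (orbit g ` {1..n}))"
    using orbits_disjoint[OF pg] finite_orbit_permutation[OF pg]
    by (intro card_Union_disjoint[symmetric]) (auto simp: pairwise_def disjnt_def)
  also have "\<dots> = n" using assms by (simp add: Sym_def Union_orbits)
  finally show ?thesis .
qed

lemma zero_notin_cycle_type:
  assumes "g \<in> Sym n"
  shows "0 \<notin># cycle_type n g"
proof
  have pg: "permutation g" using assms Sym_permutation by auto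
  assume "0 \<in># cycle_type n g"
  then obtain x where "card (orbit g x) = 0" by (auto simp: cycle_type_def)
  then show False using finite_orbit_permutation[OF pg] orbit_nonempty by (metis card_0_eq)
qed

text \<open>\<open>frob\<close> and \<open>word_count\<close> recurse on lists, so an ordering of
  the cycle type has to be fixed; by \<open>frob_mset_cong\<close> the value of \<open>frob\<close>
  does not depend on it.\<close>

definition cycle_list :: "nat \<Rightarrow> (nat \<Rightarrow> nat) \<Rightarrow> nat list" where
  "cycle_list n g = sorted_list_of_multiset (cycle_type n g)"

lemma mset_cycle_list [simp]: "mset (cycle_list n g) = cycle_type n g"
  by (simp add: cycle_list_def)

lemma cycle_list:
  assumes "g \<in> Sym n"
  shows "0 \<notin> set (cycle_list n g)" "sum_list (cycle_list n g) = n"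
    "(-1) ^ length (cycle_list n g) = (-1) ^ n * sign g"
proof -
  show "0 \<notin> set (cycle_list n g)"
    using zero_notin_cycle_type[OF assms] by (metis mset_cycle_list set_mset_mset)
  show "sum_list (cycle_list n g) = n"
    using sum_mset_cycle_type[OF assms] by (metis mset_cycle_list sum_mset_sum_list)
  have "length (cycle_list n g) = size (cycle_type n g)" by (metis mset_cycle_list size_mset)
  also have "\<dots> = card (orbit g ` {1..n})" by (simp add: cycle_type_def)
  finally show "(-1) ^ length (cycle_list n g) = (-1) ^ n * sign g"
    using sign_eq_orbits[of g "{1..n}"] assms
      by (simp add: Sym_def power_add flip: power_mult_distrib mult.assoc)
qed

text \<open>Counting pairs of a permutation and a word fixed by it in two ways. This is Frobenius
  reciprocity by hand: the inner product with a permutation character becomes a sum over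
  stabilizers, where the results on Young symmetrizers apply.\<close>

lemma sum_word_count:
  "(\<Sum>g\<in>Sym n. \<chi> g * of_int (word_count k (cycle_list n g) \<alpha>)) =
   (\<Sum>w\<in>content_words n k \<alpha>. \<Sum>g\<in>Stab n w. (\<chi> g :: complex))"
proof -
  have "(\<Sum>g\<in>Sym n. \<chi> g * of_int (word_count k (cycle_list n g) \<alpha>)) =
      (\<Sum>g\<in>Sym n. \<Sum>w\<in>content_words n k \<alpha>. if g \<in> Stab n w then \<chi> g else 0)"
  proof (rule sum.cong[OF refl])
    fix g assume g: "g \<in> Sym n"
    have "(\<Sum>w\<in>content_words n k \<alpha>. if g \<in> Stab n w then \<chi> g else 0) =
        (\<Sum>w\<in>{w \<in> content_words n k \<alpha>. g \<in> Stab n w}. \<chi> g)"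
      by (rule sum.inter_filter[symmetric]) simp
    then show "\<chi> g * of_int (word_count k (cycle_list n g) \<alpha>) =
        (\<Sum>w\<in>content_words n k \<alpha>. if g \<in> Stab n w then \<chi> g else 0)"
      by (simp add: word_count_eq_card[OF g mset_cycle_list])
  qed
  also have "\<dots> = (\<Sum>w\<in>content_words n k \<alpha>. \<Sum>g\<in>Sym n. if g \<in> Stab n w then \<chi> g else 0)"
    by (rule sum.swap)
  also have "\<dots> = (\<Sum>w\<in>content_words n k \<alpha>. \<Sum>g\<in>Stab n w. \<chi> g)"
  proof (rule sum.cong[OF refl])
    fix w
    have "{g \<in> Sym n. g \<in> Stab n w} = Stab n w" by (auto simp: Stab_def)
    then show "(\<Sum>g\<in>Sym n. if g \<in> Stab n w then \<chi> g else 0) = (\<Sum>g\<in>Stab n w. \<chi> g)"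
      by (simp flip: sum.inter_filter)
  qed
  finally show ?thesis .
qed

lemma card_content_below:
  assumes "w \<in> content_words n k \<alpha>" "m \<le> k"
  shows "int (card {x \<in> {1..n}. w x < m}) = (\<Sum>i<m. \<alpha> i)"
proof -
  have "card {x \<in> {x \<in> {1..n}. w x < m}. True} = (\<Sum>i<m. card {x \<in> {x \<in> {1..n}. w x < m}. True \<and> w x = i})"
    by (rule card_fibers_sum) auto
  also have "\<dots> = (\<Sum>i<m. card {x \<in> {1..n}. w x = i})"
    by (intro sum.cong refl arg_cong[of _ _ card] Collect_cong) blast
  finally show ?thesis using assms by (simp add: content_words_def)
qed

lemma sum_irr_char_word_count_eq_0:
  assumes "\<nu> \<in> partitions n" "n \<le> k" "m \<le> k" "int (\<Sum>i<m. part \<nu> i) < (\<Sum>i<m. \<alpha> i)"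
  shows "(\<Sum>g\<in>Sym n. irr_char \<nu> g * of_int (word_count k (cycle_list n g) \<alpha>)) = 0"
  unfolding sum_word_count
proof (rule sum.neutral, rule ballI)
  fix w assume "w \<in> content_words n k \<alpha>"
  then have "(\<Sum>i<m. part \<nu> i) < card {x \<in> {1..n}. w x < m}"
    using card_content_below[of w n k \<alpha> m] assms(3,4) by linarith
  then show "(\<Sum>g\<in>Stab n w. irr_char \<nu> g) = 0"
    by (rule sum_Stab_irr_char_eq_0[OF assms(1,3,2)])
qed

lemma sum_sign_irr_char_word_count_eq_0:
  assumes "\<nu> \<in> partitions n" "n \<le> k" "m \<le> k" "int (\<Sum>i<k. min m (part \<nu> i)) < (\<Sum>i<m. \<alpha> i)"
  shows "(\<Sum>g\<in>Sym n. of_int (sign g) * irr_char \<nu> g * of_int (word_count k (cycle_list n g) \<alpha>)) = 0"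
  unfolding sum_word_count
proof (rule sum.neutral, rule ballI)
  fix w assume "w \<in> content_words n k \<alpha>"
  then have "(\<Sum>i<k. min m (part \<nu> i)) < card {x \<in> {1..n}. w x < m}"
    using card_content_below[of w n k \<alpha> m] assms(3,4) by linarith
  then show "(\<Sum>g\<in>Stab n w. of_int (sign g) * irr_char \<nu> g) = 0"
    by (rule sum_Stab_sign_irr_char_eq_0[OF assms(1,2)])
qed

lemma sum_Stab_comp:
  assumes nu: "\<nu> \<in> partitions n" and p: "\<pi> \<in> Sym n" and w: "\<And>x. x \<in> {1..n} \<Longrightarrow> w x = w0 (\<pi> x)"
  shows "(\<Sum>g\<in>Stab n w. irr_char \<nu> g) = (\<Sum>g\<in>Stab n w0. irr_char \<nu> g)"
proof (rule sum.reindex_bij_witness[where i = "\<lambda>g. inv \<pi> \<circ> g \<circ> \<pi>" and j = "\<lambda>g. \<pi> \<circ> g \<circ> inv \<pi>"])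
  fix g assume g: "g \<in> Stab n w"
  then have gS: "g \<in> Sym n" by (rule Stab_Sym)
  show "inv \<pi> \<circ> (\<pi> \<circ> g \<circ> inv \<pi>) \<circ> \<pi> = g" using p by (simp add: fun_eq_iff)
  have "w0 (\<pi> (g (inv \<pi> x))) = w0 x" if x: "x \<in> {1..n}" for x
  proof -
    let ?y = "inv \<pi> x"
    have y: "?y \<in> {1..n}" "g ?y \<in> {1..n}" using inv_in[OF p x] Sym_in[OF gS] by blast+
    have "w0 (\<pi> (g ?y)) = w (g ?y)" using w[OF y(2)] by simp
    also have "\<dots> = w ?y" using g y(1) unfolding Stab_def by blast
    also have "\<dots> = w0 x" using w[OF y(1)] p by simp
    finally show ?thesis .
  qed
  then show "\<pi> \<circ> g \<circ> inv \<pi> \<in> Stab n w0"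
    using gS p by (simp add: Stab_def comp_Sym inv_Sym)
  show "irr_char \<nu> (\<pi> \<circ> g \<circ> inv \<pi>) = irr_char \<nu> g"
    using irr_char_conj[of g \<nu> \<pi>] gS p nu by (simp add: partitions_def)
next
  fix g assume g: "g \<in> Stab n w0"
  then have gS: "g \<in> Sym n" by (rule Stab_Sym)
  show "\<pi> \<circ> (inv \<pi> \<circ> g \<circ> \<pi>) \<circ> inv \<pi> = g" using p by (simp add: fun_eq_iff)
  have "w (inv \<pi> (g (\<pi> x))) = w x" if x: "x \<in> {1..n}" for x
  proof -
    have y: "\<pi> x \<in> {1..n}" using Sym_in[OF p] x by blast
    then have gy: "g (\<pi> x) \<in> {1..n}" using Sym_in[OF gS] by blast
    have "w (inv \<pi> (g (\<pi> x))) = w0 (g (\<pi> x))" using w[OF inv_in[OF p gy]] p by simp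
    also have "\<dots> = w0 (\<pi> x)" using g y unfolding Stab_def by blast
    finally show ?thesis using w[OF x] by simp
  qed
  then show "inv \<pi> \<circ> g \<circ> \<pi> \<in> Stab n w"
    using gS p by (simp add: Stab_def comp_Sym inv_Sym)
qed

lemma card_Sym: "card (Sym n) = fact n"
  by (simp add: Sym_def card_permutations)

lemma content_word_eq_comp:
  assumes "w \<in> content_words n k \<alpha>" "w0 \<in> content_words n k \<alpha>"
  obtains \<pi> where "\<pi> \<in> Sym n" "\<And>x. x \<in> {1..n} \<Longrightarrow> w x = w0 (\<pi> x)"
proof -
  have "image_mset w (mset_set {1..n}) = image_mset w0 (mset_set {1..n})"
  proof (rule multiset_eqI)
    fix i
    have c: "count (image_mset v (mset_set {1..n})) i = card {x \<in> {1..n}. v x = i}" for v :: "nat \<Rightarrow> nat"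
      by (simp add: count_image_mset_eq_card_vimage)
    show "count (image_mset w (mset_set {1..n})) i = count (image_mset w0 (mset_set {1..n})) i"
    proof (cases "i < k")
      case True
      then have "int (card {x \<in> {1..n}. w x = i}) = \<alpha> i" "int (card {x \<in> {1..n}. w0 x = i}) = \<alpha> i"
        using assms unfolding content_words_def by blast+
      then show ?thesis unfolding c by linarith
    next
      case False
      have "{x \<in> {1..n}. v x = i} = {}" if "v \<in> content_words n k \<alpha>" for v
      proof -
        have "v \<in> {1..n} \<rightarrow>\<^sub>E {..<k}" using that unfolding content_words_def by blast
        then have "v x < k" if "x \<in> {1..n}" for x using PiE_mem that by blast
        then show ?thesis using False by blast
      qed
      then show ?thesis unfolding c using assms by (simp only:)
    qed
  qed
  then obtain \<pi> where "\<pi> permutes {1..n}" "\<forall>x\<in>{1..n}. w x = w0 (\<pi> x)"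
    using image_mset_eq_implies_permutes[of "{1..n}" w w0] by auto
  then show ?thesis using that by (auto simp: Sym_def)
qed

text \<open>Orbit and stabilizer: \<open>\<pi>\<close> maps to the word
  \<open>w0 \<circ> \<pi>\<close>, this reaches every word of the same content, and the fibres are
  cosets of the stabilizer.\<close>

lemma card_content_words_Stab:
  assumes w0: "w0 \<in> content_words n k \<alpha>"
  shows "card (content_words n k \<alpha>) * card (Stab n w0) = fact n"
proof -
  let ?F = "\<lambda>w. {\<pi> \<in> Sym n. \<forall>x\<in>{1..n}. w x = w0 (\<pi> x)}"
  have fib: "card (?F w) = card (Stab n w0)" if w: "w \<in> content_words n k \<alpha>" for w
  proof -
    obtain \<pi> where p: "\<pi> \<in> Sym n" "\<And>x. x \<in> {1..n} \<Longrightarrow> w x = w0 (\<pi> x)"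
      using content_word_eq_comp[OF w w0] by blast
    have "bij_betw (\<lambda>g. g \<circ> \<pi>) (Stab n w0) (?F w)"
    proof (rule bij_betw_byWitness[where f' = "\<lambda>g. g \<circ> inv \<pi>"])
      show "\<forall>g\<in>Stab n w0. g \<circ> \<pi> \<circ> inv \<pi> = g" "\<forall>g\<in>?F w. g \<circ> inv \<pi> \<circ> \<pi> = g"
        using p(1) by (simp_all add: Sym_cancel)
      show "(\<lambda>g. g \<circ> \<pi>) ` Stab n w0 \<subseteq> ?F w"
      proof clarify
        fix g assume g: "g \<in> Stab n w0"
        have "w x = w0 (g (\<pi> x))" if x: "x \<in> {1..n}" for x
        proof -
          have "\<pi> x \<in> {1..n}" using Sym_in[OF p(1)] x by blast
          then show ?thesis using g p(2)[OF x] unfolding Stab_def by simp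
        qed
        then show "g \<circ> \<pi> \<in> Sym n \<and> (\<forall>x\<in>{1..n}. w x = w0 ((g \<circ> \<pi>) x))"
          using comp_Sym[OF Stab_Sym[OF g] p(1)] by simp
      qed
      show "(\<lambda>g. g \<circ> inv \<pi>) ` ?F w \<subseteq> Stab n w0"
      proof clarify
        fix g assume g: "g \<in> Sym n" "\<forall>x\<in>{1..n}. w x = w0 (g x)"
        have "w0 (g (inv \<pi> x)) = w0 x" if x: "x \<in> {1..n}" for x
          using g(2) inv_in[OF p(1) x] p(2)[OF inv_in[OF p(1) x]] Sym_inv(4)[OF p(1)] by metis
        then show "g \<circ> inv \<pi> \<in> Stab n w0"
          using comp_Sym[OF g(1) inv_Sym[OF p(1)]] by (simp add: Stab_def)
      qed
    qed
    then show ?thesis using bij_betw_same_card by force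
  qed
  have "Sym n = (\<Union>w\<in>content_words n k \<alpha>. ?F w)"
  proof (intro equalityI subsetI)
    fix \<pi> assume p: "\<pi> \<in> Sym n"
    let ?w = "restrict (\<lambda>x. w0 (\<pi> x)) {1..n}"
    have "card {x \<in> {1..n}. ?w x = i} = card {x \<in> {1..n}. w0 x = i}" for i
    proof (rule bij_betw_same_card)
      show "bij_betw \<pi> {x \<in> {1..n}. ?w x = i} {x \<in> {1..n}. w0 x = i}"
      proof (rule bij_betw_byWitness[where f' = "inv \<pi>"])
        show "\<pi> ` {x \<in> {1..n}. ?w x = i} \<subseteq> {x \<in> {1..n}. w0 x = i}"
          using Sym_in[OF p] by (auto simp del: atLeastAtMost_iff)
        show "inv \<pi> ` {x \<in> {1..n}. w0 x = i} \<subseteq> {x \<in> {1..n}. ?w x = i}"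
          using inv_in[OF p] p by (auto simp del: atLeastAtMost_iff)
      qed (use p in auto)
    qed
    moreover have "?w \<in> {1..n} \<rightarrow>\<^sub>E {..<k}"
      using w0 Sym_in[OF p] PiE_mem[of w0 "{1..n}" "\<lambda>_. {..<k}"]
        by (auto simp: content_words_def simp del: atLeastAtMost_iff)
    ultimately have "?w \<in> content_words n k \<alpha>" using w0 unfolding content_words_def by simp
    then show "\<pi> \<in> (\<Union>w\<in>content_words n k \<alpha>. ?F w)" using p by (intro UN_I[of ?w]) auto
  qed auto
  then have "fact n = card (\<Union>w\<in>content_words n k \<alpha>. ?F w)" by (metis card_Sym)
  also have "\<dots> = (\<Sum>w\<in>content_words n k \<alpha>. card (?F w))"
  proof (rule card_UN_disjoint)
    show "\<forall>w\<in>content_words n k \<alpha>. \<forall>w'\<in>content_words n k \<alpha>. w \<noteq> w' \<longrightarrow> ?F w \<inter> ?F w' = {}"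
    proof (intro ballI impI)
      fix w w' assume w: "w \<in> content_words n k \<alpha>" "w' \<in> content_words n k \<alpha>" "w \<noteq> w'"
      then have "w \<in> extensional {1..n}" "w' \<in> extensional {1..n}" by (auto simp: content_words_def PiE_def)
      then obtain x where "x \<in> {1..n}" "w x \<noteq> w' x" using w(3) by (metis extensionalityI)
      then show "?F w \<inter> ?F w' = {}" by fastforce
    qed
  qed (auto intro: finite_subset[OF _ finite_Sym[of n]])
  also have "\<dots> = (\<Sum>w\<in>content_words n k \<alpha>. card (Stab n w0))" by (rule sum.cong[OF refl fib])
  also have "\<dots> = card (content_words n k \<alpha>) * card (Stab n w0)" by simp
  finally show ?thesis by simp
qed

text \<open>The words of content \<nu> are the rearrangements of the row word of the tableau, whose
  stabilizer is the row group. Each contributes the order of that group, and the orbit size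
  completes it to \<open>fact n\<close>.\<close>

lemma sum_irr_char_word_count_diag:
  assumes nu: "\<nu> \<in> partitions n" and "n \<le> k"
  shows "(\<Sum>g\<in>Sym n. irr_char \<nu> g * of_int (word_count k (cycle_list n g) (\<lambda>i. int (part \<nu> i)))) = fact n"
proof -
  have n: "sum_list \<nu> = n" using nu by (simp add: partitions_def)
  have len: "length \<nu> \<le> k" using length_le_sum_list[of \<nu>] assms by (auto simp: partitions_def)
  let ?W = "content_words n k (\<lambda>i. int (part \<nu> i))"
  let ?w = "restrict (trow \<nu>) {1..n}"
  have "trow \<nu> x < k" if "x \<in> {1..n}" for x using tab_bounds(2)[of x \<nu>] that n len by simp
  moreover have "card {x \<in> {1..n}. ?w x = i} = part \<nu> i" for i
  proof -
    have "{x \<in> {1..n}. ?w x = i} = {x \<in> {1..n}. trow \<nu> x = i}"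
      by (intro Collect_cong) (auto simp del: atLeastAtMost_iff)
    then show ?thesis using card_trow[of \<nu> i] n by simp
  qed
  ultimately have w0: "?w \<in> ?W" unfolding content_words_def by (simp del: atLeastAtMost_iff)
  have S: "Stab n ?w = row_group \<nu>"
    unfolding row_group_eq n Stab_def using Sym_in by (auto simp del: atLeastAtMost_iff)
  have "(\<Sum>g\<in>Stab n w. irr_char \<nu> g) = of_nat (card (row_group \<nu>))" if w: "w \<in> ?W" for w
  proof -
    obtain \<pi> where p: "\<pi> \<in> Sym n" "\<And>x. x \<in> {1..n} \<Longrightarrow> w x = ?w (\<pi> x)"
      using content_word_eq_comp[OF w w0] by blast
    have "(\<Sum>g\<in>Stab n w. irr_char \<nu> g) = (\<Sum>g\<in>Stab n ?w. irr_char \<nu> g)"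
      by (rule sum_Stab_comp[OF nu p(1)]) (rule p(2))
    then show ?thesis using S sum_row_group_irr_char[OF nu] by simp
  qed
  then have "(\<Sum>w\<in>?W. \<Sum>g\<in>Stab n w. irr_char \<nu> g) = of_nat (card ?W * card (Stab n ?w))" using S by simp
  also have "\<dots> = fact n" unfolding card_content_words_Stab[OF w0] by simp
  finally show ?thesis unfolding sum_word_count .
qed

section \<open>Partial sums of permutations\<close>

lemma sum_card_le_sum_nats:
  "finite A \<Longrightarrow> card A = m \<Longrightarrow> (\<Sum>i<m. i) \<le> \<Sum> (A :: nat set)"
proof (induction m arbitrary: A)
  case (Suc m)
  let ?a = "Max A"
  have ne: "A \<noteq> {}" using Suc.prems by auto
  have "A \<subseteq> {..?a}" using Suc.prems by auto
  then have "card A \<le> Suc ?a" using card_mono[of "{..?a}" A] by simp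
  then have "m \<le> ?a" using Suc.prems by simp
  moreover have "(\<Sum>i<m. i) \<le> \<Sum> (A - {?a})"
    using Suc.prems ne by (intro Suc.IH) simp_all
  moreover have "\<Sum> A = ?a + \<Sum> (A - {?a})"
    using Suc.prems ne by (intro sum.remove) auto
  ultimately show ?case by simp
qed simp

text \<open>Consequently every content \<open>part \<nu> i - i + \<sigma> i\<close> in the
  determinantal expansion has partial sums at least those of \<nu>, which is the triangularity
  needed below.\<close>

lemma sum_permutation_ge:
  assumes "\<sigma> permutes {..<k::nat}"
  shows "(\<Sum>i<m. i) \<le> (\<Sum>i<m. \<sigma> i)"
  using sum_card_le_sum_nats[of "\<sigma> ` {..<m}" m] permutes_inj_on[OF assms, of "{..<m}"]
  by (simp add: card_image sum.reindex)

lemma permutes_eq_id: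
  assumes "\<sigma> permutes {..<k::nat}" "\<And>m. m \<le> k \<Longrightarrow> (\<Sum>i<m. \<sigma> i) \<le> (\<Sum>i<m. i)"
  shows "\<sigma> = id"
proof
  fix i show "\<sigma> i = id i"
  proof (cases "i < k")
    case True
    have eq: "(\<Sum>i<m. \<sigma> i) = (\<Sum>i<m. i)" if "m \<le> k" for m
      using assms(2)[OF that] sum_permutation_ge[OF assms(1), of m] by simp
    show ?thesis using eq[of i] eq[of "Suc i"] True by simp
  qed (use assms(1) in \<open>simp add: permutes_not_in\<close>)
qed

section \<open>The Frobenius formula\<close>

lemma sum_irr_char_frob:
  "(\<Sum>g\<in>Sym n. c g * of_int (frob k (cycle_list n g) \<beta>)) =
   (\<Sum>\<sigma> | \<sigma> permutes {..<k}. of_int (sign \<sigma>) *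
      (\<Sum>g\<in>Sym n. c g * of_int (word_count k (cycle_list n g) (\<lambda>i. \<beta> i + int (\<sigma> i))) :: complex))"
  unfolding frob_eq_word_count
  by (simp add: sum_distrib_left mult_ac) (rule sum.swap)

lemma sum_beads_add:
  "(\<Sum>i<m. beads f i + int (\<sigma> i)) = int (\<Sum>i<m. f i) + (int (\<Sum>i<m. \<sigma> i) - int (\<Sum>i<m. i))"
  by (simp add: beads_def sum.distrib sum_subtractf)

lemma sum_conj_part: "(\<Sum>j<m. conj_part k f j) = (\<Sum>i<k. min m (f i))"
proof -
  have "(\<Sum>j<m. conj_part k f j) = (\<Sum>j<m. \<Sum>i<k. if j < f i then 1 else 0)"
  proof (rule sum.cong[OF refl])
    fix j
    have "{i. i < k \<and> j < f i} = {i \<in> {..<k}. j < f i}" by auto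
    then show "conj_part k f j = (\<Sum>i<k. if j < f i then 1 else 0)"
      by (simp add: conj_part_def flip: sum.inter_filter)
  qed
  also have "\<dots> = (\<Sum>i<k. \<Sum>j<m. if j < f i then 1 else 0)" by (rule sum.swap)
  also have "\<dots> = (\<Sum>i<k. min m (f i))"
  proof (rule sum.cong[OF refl])
    fix i
    have "{j \<in> {..<m}. j < f i} = {..<min m (f i)}" by auto
    then show "(\<Sum>j<m. if j < f i then 1 else 0) = min m (f i)"
      by (subst sum.inter_filter[symmetric]) auto
  qed
  finally show ?thesis .
qed

text \<open>Truncation at \<open>m = f l\<close> turns the hypothesis on conjugates into the reverse dominance at \<open>l\<close>.\<close>

lemma dominance_antisym:
  fixes f g :: "nat \<Rightarrow> nat"
  assumes anti: "antimono f" and tot: "(\<Sum>i<k. f i) = (\<Sum>i<k. g i)"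
    and fk: "\<And>i. f i \<le> k"
    and le: "\<And>m. m \<le> k \<Longrightarrow> (\<Sum>i<m. f i) \<le> (\<Sum>i<m. g i)"
    and conj: "\<And>m. m \<le> k \<Longrightarrow> (\<Sum>i<k. min m (f i)) \<le> (\<Sum>i<k. min m (g i))"
    and "i < k"
  shows "f i = g i"
proof -
  have eq: "(\<Sum>i<l. f i) = (\<Sum>i<l. g i)" if l: "l \<le> k" for l
  proof (cases "l = k")
    case False
    then have lk: "l < k" using l by simp
    let ?m = "f l"
    have split: "(\<Sum>i<k. h i) = (\<Sum>i<l. h i) + (\<Sum>i\<in>{l..<k}. h i)" for h :: "nat \<Rightarrow> int"
      using lk by (metis atLeast0LessThan less_imp_le_nat sum.atLeastLessThan_concat zero_le)
    \<comment> \<open>At this cut-off the excess of \<open>f\<close> comes from the first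
      \<open>l\<close> rows alone, whereas for \<open>g\<close> those rows give only a lower bound
      for the excess.\<close>
    have "(\<Sum>i<k. int (f i) - int (min ?m (f i))) = (\<Sum>i<l. int (f i) - int ?m)"
    proof -
      have "(\<Sum>i\<in>{l..<k}. int (f i) - int (min ?m (f i))) = 0"
        using antimonoD[OF anti, of l] by (intro sum.neutral) (auto simp: min_absorb2)
      moreover have "(\<Sum>i<l. int (f i) - int (min ?m (f i))) = (\<Sum>i<l. int (f i) - int ?m)"
        using antimonoD[OF anti, of _ l] by (intro sum.cong refl) (auto simp: min_absorb1)
      ultimately show ?thesis using split[of "\<lambda>i. int (f i) - int (min ?m (f i))"] by simp
    qed
    moreover have "(\<Sum>i<l. int (g i) - int ?m) \<le> (\<Sum>i<k. int (g i) - int (min ?m (g i)))"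
    proof -
      have "0 \<le> (\<Sum>i\<in>{l..<k}. int (g i) - int (min ?m (g i)))" by (intro sum_nonneg) auto
      moreover have "(\<Sum>i<l. int (g i) - int ?m) \<le> (\<Sum>i<l. int (g i) - int (min ?m (g i)))"
        by (intro sum_mono) auto
      ultimately show ?thesis using split[of "\<lambda>i. int (g i) - int (min ?m (g i))"] by simp
    qed
    moreover have "(\<Sum>i<k. int (g i) - int (min ?m (g i))) \<le> (\<Sum>i<k. int (f i) - int (min ?m (f i)))"
    proof -
      have "int (\<Sum>i<k. f i) = int (\<Sum>i<k. g i)" "int (\<Sum>i<k. min ?m (f i)) \<le> int (\<Sum>i<k. min ?m (g i))"
        using tot conj[OF fk[of l]] by (simp_all only: of_nat_le_iff)
      then show ?thesis unfolding sum_subtractf of_nat_sum by linarith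
    qed
    ultimately have "(\<Sum>i<l. int (g i) - int ?m) \<le> (\<Sum>i<l. int (f i) - int ?m)" by linarith
    then have "int (\<Sum>i<l. g i) \<le> int (\<Sum>i<l. f i)" unfolding sum_subtractf of_nat_sum by linarith
    then show ?thesis using le[OF l] by linarith
  qed (use tot in simp)
  show ?thesis using eq[of i] eq[of "Suc i"] assms(6) by simp
qed

lemma part_inject:
  assumes "0 \<notin> set \<theta>" "0 \<notin> set \<nu>" "\<And>i. part \<theta> i = part \<nu> i"
  shows "\<theta> = \<nu>"
proof -
  have pos: "i < length \<kappa> \<longleftrightarrow> part \<kappa> i \<noteq> 0" if "0 \<notin> set \<kappa>" for \<kappa> i
  proof (cases "i < length \<kappa>")
    case True
    then have "\<kappa> ! i \<in> set \<kappa>" by simp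
    then have "\<kappa> ! i \<noteq> 0" using that by metis
    then show ?thesis using True by (simp add: part_def)
  qed (simp add: part_def)
  have "i < length \<theta> \<longleftrightarrow> i < length \<nu>" for i using pos[OF assms(1)] pos[OF assms(2)] assms(3) by simp
  then have len: "length \<theta> = length \<nu>" by (metis less_irrefl_nat linorder_neqE_nat)
  then show ?thesis
    by (rule nth_equalityI) (use assms(3) len in \<open>metis part_def\<close>)
qed

lemma sum_irr_char_frob_beads:
  assumes lam: "\<theta> \<in> partitions n" and nu: "\<nu> \<in> partitions n" and k: "n \<le> k"
  shows "(\<Sum>g\<in>Sym n. irr_char \<nu> g * of_int (frob k (cycle_list n g) (beads (part \<theta>)))) =
    (if \<theta> = \<nu> then fact n else 0)"
proof -
  let ?f = "part \<theta>"
  have sums: "sum_list \<theta> = n" "sum_list \<nu> = n" using lam nu by (simp_all add: partitions_def)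
  have z: "0 \<notin> set \<theta>" "0 \<notin> set \<nu>" using lam nu by (simp_all add: partitions_def)
  have len: "length \<theta> \<le> k" "length \<nu> \<le> k" using length_le_sum_list z sums k by (metis order_trans)+
  let ?T = "\<lambda>\<sigma>. \<Sum>g\<in>Sym n. irr_char \<nu> g * of_int (word_count k (cycle_list n g) (\<lambda>i. beads ?f i + int (\<sigma> i)))"
  have exp: "(\<Sum>g\<in>Sym n. irr_char \<nu> g * of_int (frob k (cycle_list n g) (beads ?f))) =
      (\<Sum>\<sigma> | \<sigma> permutes {..<k}. of_int (sign \<sigma>) * ?T \<sigma>)" by (rule sum_irr_char_frob)
  have T0: "?T \<sigma> = 0" if "\<sigma> permutes {..<k}" "m \<le> k"
    "int (\<Sum>i<m. part \<nu> i) < int (\<Sum>i<m. ?f i) + (int (\<Sum>i<m. \<sigma> i) - int (\<Sum>i<m. i))" for \<sigma> m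
    by (rule sum_irr_char_word_count_eq_0[OF nu k that(2)]) (use that(3) in \<open>simp only: sum_beads_add\<close>)
  show ?thesis
  proof (cases "\<theta> = \<nu>")
    case True
    \<comment> \<open>For any other \<sigma> some partial sum of the content strictly exceeds that
      of \<nu>, and the inner product vanishes.\<close>
    have "(\<Sum>\<sigma> | \<sigma> permutes {..<k}. of_int (sign \<sigma>) * ?T \<sigma>) = (\<Sum>\<sigma>\<in>{id}. of_int (sign \<sigma>) * ?T \<sigma>)"
    proof (rule sum.mono_neutral_right)
      show "{id} \<subseteq> {\<sigma>. \<sigma> permutes {..<k}}" by (simp add: permutes_id)
      show "\<forall>\<sigma>\<in>{\<sigma>. \<sigma> permutes {..<k}} - {id}. of_int (sign \<sigma>) * ?T \<sigma> = 0"
      proof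
        fix \<sigma> assume s: "\<sigma> \<in> {\<sigma>. \<sigma> permutes {..<k}} - {id}"
        then obtain m where "m \<le> k" "(\<Sum>i<m. i) < (\<Sum>i<m. \<sigma> i)"
          using permutes_eq_id[of \<sigma> k] by (metis DiffE mem_Collect_eq not_le singletonI)
        then have "int (\<Sum>i<m. part \<nu> i) < int (\<Sum>i<m. ?f i) + (int (\<Sum>i<m. \<sigma> i) - int (\<Sum>i<m. i))"
          unfolding True by linarith
        then have "?T \<sigma> = 0" using s \<open>m \<le> k\<close> by (intro T0) auto
        then show "of_int (sign \<sigma>) * ?T \<sigma> = 0" by simp
      qed
    qed simp
    also have "\<dots> = fact n"
      using sum_irr_char_word_count_diag[OF nu k] True by (simp add: beads_def)
    finally show ?thesis using exp True by simp
  next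
    case False
    show ?thesis
    proof (cases "\<exists>m\<le>k. (\<Sum>i<m. part \<nu> i) < (\<Sum>i<m. ?f i)")
      case True
      then obtain m where m: "m \<le> k" "(\<Sum>i<m. part \<nu> i) < (\<Sum>i<m. ?f i)" by blast
      have "?T \<sigma> = 0" if "\<sigma> permutes {..<k}" for \<sigma>
      proof (rule T0[OF that m(1)])
        show "int (\<Sum>i<m. part \<nu> i) < int (\<Sum>i<m. ?f i) + (int (\<Sum>i<m. \<sigma> i) - int (\<Sum>i<m. i))"
          using m(2) sum_permutation_ge[OF that, of m] by linarith
      qed
      then show ?thesis using exp False by simp
    next
      case dom: False
      let ?g = "conj_part k ?f"
      have anti: "antimono ?f" by (rule part_antimono[OF lam])
      have fle: "?f i \<le> k" for i using part_le[of \<theta> i] sums k by simp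
      \<comment> \<open>Here \<nu> weakly dominates \<theta>. If in addition all partial sums of the
        conjugate of \<theta> were at most those of the conjugate of \<nu>, the two partitions would
        agree.\<close>
      have "\<exists>m\<le>k. (\<Sum>i<k. min m (part \<nu> i)) < (\<Sum>i<k. min m (?f i))"
      proof (rule ccontr)
        assume "\<not> ?thesis"
        then have "?f i = part \<nu> i" if "i < k" for i
          using dom anti fle sum_part[OF len(1)] sum_part[OF len(2)] sums that
          by (intro dominance_antisym[of ?f k "part \<nu>"]) (auto simp: not_less)
        moreover have "?f i = part \<nu> i" if "\<not> i < k" for i using that len by (simp add: part_def)
        ultimately have "\<theta> = \<nu>" using part_inject[OF z] by blast
        then show False using False by simp
      qed
      then obtain m where m: "m \<le> k" "(\<Sum>i<k. min m (part \<nu> i)) < (\<Sum>j<m. ?g j)"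
        unfolding sum_conj_part by blast
      \<comment> \<open>Independent of \<open>g\<close>: the factor \<open>(-1)\<close> to the
        number of cycles equals \<open>(-1) ^ n * sign g\<close>, and its second half becomes the
        sign twist.\<close>
      let ?c = "sign (merge_beads k (\<lambda>i. - int i) (\<lambda>i. - int i)) * (-1) ^ n * sign (merge_beads k (beads ?f) (beads ?g))"
      have "(\<Sum>g\<in>Sym n. irr_char \<nu> g * of_int (frob k (cycle_list n g) (beads ?f))) =
        (\<Sum>g\<in>Sym n. of_int ?c * (of_int (sign g) * irr_char \<nu> g * of_int (frob k (cycle_list n g) (beads ?g))))"
      proof (rule sum.cong[OF refl])
        fix g assume g: "g \<in> Sym n"
        show "irr_char \<nu> g * of_int (frob k (cycle_list n g) (beads ?f)) =
          of_int ?c * (of_int (sign g) * irr_char \<nu> g * of_int (frob k (cycle_list n g) (beads ?g)))"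
          unfolding frob_complementary[OF complementary_conj[OF anti fle] cycle_list(1)[OF g]] cycle_list(3)[OF g]
          by (simp add: mult_ac)
      qed
      also have "\<dots> = of_int ?c * (\<Sum>g\<in>Sym n. of_int (sign g) * irr_char \<nu> g * of_int (frob k (cycle_list n g) (beads ?g)))"
        by (simp only: sum_distrib_left)
      also have "(\<Sum>g\<in>Sym n. of_int (sign g) * irr_char \<nu> g * of_int (frob k (cycle_list n g) (beads ?g)))
        = 0"
        unfolding sum_irr_char_frob
      proof (rule sum.neutral, rule ballI)
        fix \<sigma> assume "\<sigma> \<in> {\<sigma>. \<sigma> permutes {..<k}}"
        then have s: "\<sigma> permutes {..<k}" by simp
        have "int (\<Sum>i<k. min m (part \<nu> i)) < (\<Sum>i<m. beads ?g i + int (\<sigma> i))"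
          unfolding sum_beads_add using m(2) sum_permutation_ge[OF s, of m] by linarith
        then show "of_int (sign \<sigma>) * (\<Sum>g\<in>Sym n. of_int (sign g) * irr_char \<nu> g *
            of_int (word_count k (cycle_list n g) (\<lambda>i. beads ?g i + int (\<sigma> i)))) = 0"
          using sum_sign_irr_char_word_count_eq_0[OF nu k m(1)] by simp
      qed
      finally show ?thesis using False by simp
    qed
  qed
qed

section \<open>Sorting bead configurations into partitions\<close>

lemma part_exists:
  assumes "antimono f" "\<And>i. k \<le> i \<Longrightarrow> f i = (0::nat)"
  obtains \<theta> where "sorted_wrt (\<ge>) \<theta>" "0 \<notin> set \<theta>" "part \<theta> = f" "length \<theta> \<le> k"
proof -
  define l where "l = (LEAST i. f i = 0)"
  have l: "f l = 0" unfolding l_def by (rule LeastI[of _ k]) (simp add: assms(2))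
  have lk: "l \<le> k" unfolding l_def by (rule Least_le) (simp add: assms(2))
  have nz: "f i \<noteq> 0" if "i < l" for i using not_less_Least that unfolding l_def by blast
  let ?l = "map f [0..<l]"
  have "sorted_wrt (\<ge>) ?l" using assms(1) by (auto simp: sorted_wrt_iff_nth_less antimono_def)
  moreover have "0 \<notin> set ?l"
  proof
    assume "0 \<in> set ?l" then obtain i where "i < l" "f i = 0" by auto
    then show False using nz by blast
  qed
  moreover have "part ?l = f"
  proof
    fix i
    show "part ?l i = f i"
    proof (cases "i < l")
      case False
      then have "f i \<le> f l" using assms(1) by (simp add: antimono_def)
      then show ?thesis using False l by (simp add: part_def)
    qed (simp add: part_def)
  qed
  ultimately show ?thesis using that[of ?l] lk by simp
qed

lemma decreasing_enumeration:
  fixes A :: "int set"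
  assumes "finite A" "card A = k"
  obtains L where "\<And>i j. i < j \<Longrightarrow> j < k \<Longrightarrow> L j < L i" "L ` {..<k} = A"
proof -
  let ?L = "rev (sorted_list_of_set A)"
  have len: "length ?L = k" using assms by simp
  have s: "sorted_wrt (<) (sorted_list_of_set A)" by (rule strict_sorted_list_of_set)
  have "sorted_wrt (\<lambda>x y. y < x) ?L" using s by (simp add: sorted_wrt_rev)
  then have "?L ! j < ?L ! i" if "i < j" "j < k" for i j
    using sorted_wrt_nth_less[of "\<lambda>x y. y < x" ?L i j] that len by simp
  moreover have "(!) ?L ` {..<k} = A"
  proof -
    have "(!) xs ` {..<length xs} = set xs" for xs :: "int list" by (auto simp: set_conv_nth)
    from this[of ?L] show ?thesis unfolding len using assms(1) by simp
  qed
  ultimately show ?thesis using that by blast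
qed

text \<open>Distinct integers in decreasing order drop by at least 1 at each step, so adding the
  index gives a weakly decreasing sequence. The lower bound on the beads makes it
  nonnegative.\<close>

lemma beads_sortable:
  assumes inj: "inj_on \<beta> {..<k}" and low: "\<And>i. i < k \<Longrightarrow> - int k < \<beta> i" and sum: "(\<Sum>i<k. \<beta> i + int i) = int n"
  obtains \<theta> \<sigma> where "\<theta> \<in> partitions n" "length \<theta> \<le> k" "\<sigma> permutes {..<k}" "\<And>i. i < k
    \<Longrightarrow> \<beta> i = beads (part \<theta>) (\<sigma> i)"
proof -
  obtain L where L: "\<And>i j. i < j \<Longrightarrow> j < k \<Longrightarrow> L j < L i" "L ` {..<k} = \<beta> ` {..<k}"
    using decreasing_enumeration[of "\<beta> ` {..<k}" k] inj by (auto simp: card_image)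
  have ge: "L i + int i \<ge> 0" if "i < k" for i
  proof -
    have "L i + int i \<ge> L j + int j" if "i \<le> j" "j < k" for j
      using that
    proof (induction j rule: dec_induct)
      case (step j)
      then show ?case using L(1)[of j "Suc j"] by simp
    qed simp
    from this[of "k - 1"] have "L i + int i \<ge> L (k - 1) + int (k - 1)" using that by simp
    moreover have "L (k - 1) \<in> \<beta> ` {..<k}" using L(2) that by auto
    then have "- int k < L (k - 1)" using low by auto
    ultimately show ?thesis using that by linarith
  qed
  define f where "f i = (if i < k then nat (L i + int i) else 0)" for i
  have "antimono f"
  proof (rule antimonoI)
    fix i j :: nat assume "i \<le> j"
    then show "f j \<le> f i"
    proof (induction j rule: dec_induct)
      case (step j)
      have "f (Suc j) \<le> f j" using L(1)[of j "Suc j"] by (auto simp: f_def)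
      then show ?case using step.IH by simp
    qed simp
  qed
  then obtain \<theta> where lam: "sorted_wrt (\<ge>) \<theta>" "0 \<notin> set \<theta>" "part \<theta> = f" "length \<theta> \<le> k"
    by (rule part_exists[of f k]) (simp add: f_def)
  have Lb: "L i = beads f i" if "i < k" for i using ge[OF that] that by (simp add: f_def beads_def)
  have injL: "inj_on L {..<k}" by (rule linorder_inj_onI) (use L(1) in fastforce)+
  define \<sigma> where "\<sigma> i = (if i < k then the_inv_into {..<k} L (\<beta> i) else i)" for i
  have s: "\<sigma> i < k" "L (\<sigma> i) = \<beta> i" if "i < k" for i
  proof -
    have "\<beta> i \<in> L ` {..<k}" using L(2) that by auto
    then show "\<sigma> i < k" "L (\<sigma> i) = \<beta> i"
      using the_inv_into_into[OF injL, of "\<beta> i" "{..<k}"] f_the_inv_into_f[OF injL] that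
        by (auto simp: \<sigma>_def)
  qed
  have "\<sigma> permutes {..<k}"
  proof (rule permutes_if_inj_on)
    show "inj_on \<sigma> {..<k}"
      using s(2) inj by (metis (no_types, lifting) inj_onD inj_onI lessThan_iff)
  qed (use s in \<open>auto simp: \<sigma>_def\<close>)
  moreover have "\<beta> i = beads (part \<theta>) (\<sigma> i)" if "i < k" for i using s[OF that] Lb lam(3) by simp
  moreover have "\<theta> \<in> partitions n"
  proof -
    have "int (sum_list \<theta>) = (\<Sum>i<k. int (f i))" using sum_part[OF lam(4)] lam(3) by (metis of_nat_sum)
    also have "\<dots> = (\<Sum>i<k. L i + int i)" using Lb by (simp add: beads_def)
    also have "\<dots> = (\<Sum>i<k. L i) + (\<Sum>i<k. int i)" by (simp add: sum.distrib)
    also have "(\<Sum>i<k. L i) = \<Sum> (L ` {..<k})" by (simp add: sum.reindex[OF injL])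
    also have "\<dots> = (\<Sum>i<k. \<beta> i)" unfolding L(2) by (simp add: sum.reindex[OF inj])
    finally show ?thesis using sum lam by (simp add: partitions_def sum.distrib)
  qed
  ultimately show ?thesis using that lam(4) by blast
qed

lemma inj_beads:
  assumes "antimono f"
  shows "inj (beads f)"
proof (rule linorder_inj_onI)
  fix x y :: nat assume "x < y"
  then have "f y \<le> f x" using assms by (simp add: antimono_def)
  then show "beads f x \<noteq> beads f y" using \<open>x < y\<close> by (simp add: beads_def)
qed auto

text \<open>Both sides evaluate the sum of \<open>F h \<beta> * C \<beta>\<close> over the box, up
  to the common factor \<open>k!\<close>. Summing over \<beta> first leaves the permutations with
  the cycle type of \<open>h\<close>, by column orthogonality; summing over the group first leaves
  the rearrangements of the beads of \<nu>.\<close>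

lemma frob_irr_char_proportional:
  assumes nu: "\<nu> \<in> partitions n" and h: "h \<in> Sym n" and k: "2 * n \<le> k"
  shows "fact n * of_int (frob k (cycle_list n h) (beads (part \<nu>))) =
    of_nat (centralizer_order (cycle_list n h) (cycle_type n h) * card {g \<in> Sym n. cycle_type n g
      = cycle_type n h}) * irr_char \<nu> h"
proof -
  let ?B = "{..<k} \<rightarrow>\<^sub>E {- int k<..int n}"
  have finB: "finite ?B" by (intro finite_PiE) auto
  define F where "F g \<beta> = (of_int (frob k (cycle_list n g) \<beta>) :: complex)" for g \<beta>
  define C where "C \<beta> = (\<Sum>g\<in>Sym n. irr_char \<nu> g * F g \<beta>)" for \<beta>
  let ?b = "beads (part \<nu>)"
  let ?Z = "centralizer_order (cycle_list n h) (cycle_type n h)" and ?cl = "{g \<in> Sym n. cycle_type n g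
    = cycle_type n h}"
  have nk: "n \<le> k" using k by simp
  have orth: "(\<Sum>\<beta>\<in>?B. F h \<beta> * F g \<beta>) = of_int (fact k * int (centralizer_order (cycle_list n h) (cycle_type n g)))"
    if "g \<in> Sym n" for g
    using frob_column_orthogonality[of "cycle_list n h" "cycle_list n g" n k]
      cycle_list(1,2)[OF h] cycle_list(1,2)[OF that] k
    by (simp add: F_def flip: of_int_mult of_int_sum)
  have "(\<Sum>\<beta>\<in>?B. F h \<beta> * C \<beta>) = (\<Sum>g\<in>Sym n. irr_char \<nu> g * (\<Sum>\<beta>\<in>?B. F h \<beta> * F g \<beta>))"
    unfolding C_def by (simp add: sum_distrib_left mult_ac) (rule sum.swap)
  also have "\<dots> = (\<Sum>g\<in>Sym n. irr_char \<nu> g * of_int (fact k * int (centralizer_order (cycle_list n h) (cycle_type n g))))"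
    using orth by simp
  also have "\<dots> = (\<Sum>g\<in>?cl. irr_char \<nu> h * (fact k * of_nat ?Z))"
  proof (rule sum.mono_neutral_cong_right)
    show "\<forall>g\<in>Sym n - ?cl. irr_char \<nu> g * of_int (fact k * int (centralizer_order (cycle_list n h) (cycle_type n g))) = 0"
      using centralizer_order_eq_0[of _ "cycle_list n h"] by simp
    show "irr_char \<nu> g * of_int (fact k * int (centralizer_order (cycle_list n h) (cycle_type n g)))
      = irr_char \<nu> h * (fact k * of_nat ?Z)"
      if "g \<in> ?cl" for g
      using that irr_char_cycle_type[OF nu _ h, of g] by simp
  qed auto
  also have "\<dots> = fact k * (of_nat (?Z * card ?cl) * irr_char \<nu> h)" by simp
  finally have 1: "(\<Sum>\<beta>\<in>?B. F h \<beta> * C \<beta>) = fact k * (of_nat (?Z * card ?cl) * irr_char \<nu> h)" .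
  have Fcong: "F g \<beta> = of_int (sign \<sigma>) * F g \<gamma>"
    if "\<sigma> permutes {..<k}" "\<And>i. i < k \<Longrightarrow> \<beta> i = \<gamma> (\<sigma> i)" for g \<beta> \<gamma> \<sigma>
  proof -
    have "frob k (cycle_list n g) \<beta> = frob k (cycle_list n g) (\<gamma> \<circ> \<sigma>)"
      by (rule frob_cong) (simp add: that(2))
    then show ?thesis unfolding F_def frob_comp[OF that(1)] by simp
  qed
  have Ccong: "C \<beta> = of_int (sign \<sigma>) * C \<gamma>" if "\<sigma> permutes {..<k}" "\<And>i. i < k \<Longrightarrow> \<beta> i = \<gamma> (\<sigma> i)" for \<beta> \<gamma> \<sigma>
  proof -
    have "F g \<beta> = of_int (sign \<sigma>) * F g \<gamma>" for g by (rule Fcong[OF that(1)]) (rule that(2))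
    then show ?thesis unfolding C_def by (simp add: sum_distrib_left mult_ac)
  qed
  have Cb: "C (beads (part \<theta>)) = (if \<theta> = \<nu> then fact n else 0)" if "\<theta> \<in> partitions n" for \<theta>
    using sum_irr_char_frob_beads[OF that nu nk] by (simp add: C_def F_def)
  let ?P = "{\<sigma>. \<sigma> permutes {..<k}}"
  define e where "e \<sigma> = restrict (\<lambda>i. ?b (\<sigma> i)) {..<k}" for \<sigma>
  have e_eq: "e \<sigma> i = ?b (\<sigma> i)" if "i < k" for \<sigma> i using that by (simp add: e_def)
  have inje: "inj_on e ?P"
  proof (rule inj_onI)
    fix \<sigma> \<tau> assume st: "\<sigma> \<in> ?P" "\<tau> \<in> ?P" "e \<sigma> = e \<tau>"
    show "\<sigma> = \<tau>"
    proof
      fix i show "\<sigma> i = \<tau> i"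
      proof (cases "i < k")
        case True
        then have "?b (\<sigma> i) = ?b (\<tau> i)" using st(3) e_eq by metis
        then show ?thesis using inj_beads[OF part_antimono[OF nu]] by (simp add: inj_eq)
      next
        case False
        then have "\<sigma> i = i" "\<tau> i = i"
          using st(1,2) permutes_not_in[of \<sigma> "{..<k}" i] permutes_not_in[of \<tau> "{..<k}" i] by auto
        then show ?thesis by simp
      qed
    qed
  qed
  have eB: "e \<sigma> \<in> ?B" if s: "\<sigma> \<in> ?P" for \<sigma>
  proof -
    have "?b (\<sigma> i) \<in> {- int k<..int n}" if "i < k" for i
    proof -
      have "\<sigma> i < k" using s that permutes_in_image[of \<sigma> "{..<k}" i] by simp
      then show ?thesis using part_le[of \<nu> "\<sigma> i"] nu by (simp add: beads_def partitions_def)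
    qed
    then show ?thesis by (auto simp: e_def)
  qed
  have "(\<Sum>\<beta>\<in>?B. F h \<beta> * C \<beta>) = (\<Sum>\<beta>\<in>e ` ?P. F h \<beta> * C \<beta>)"
  proof (rule sum.mono_neutral_right[OF finB])
    show "e ` ?P \<subseteq> ?B" using eB by blast
    show "\<forall>\<beta>\<in>?B - e ` ?P. F h \<beta> * C \<beta> = 0"
    proof
      fix \<beta> assume b: "\<beta> \<in> ?B - e ` ?P"
      show "F h \<beta> * C \<beta> = 0"
      proof (cases "F h \<beta> = 0")
        case False
        then have nz: "frob k (cycle_list n h) \<beta> \<noteq> 0" by (auto simp: F_def)
        have inj: "inj_on \<beta> {..<k}" using frob_eq_0_not_inj nz by blast
        \<comment> \<open>Wherever the first factor does not vanish, \<beta> rearranges the beads of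
          some partition of \<open>n\<close>, and \<open>C\<close> vanishes there unless this
          partition is \<nu>.\<close>
        obtain \<theta> \<sigma> where ls: "\<theta> \<in> partitions n" "length \<theta> \<le> k" "\<sigma> permutes {..<k}" "\<And>i. i < k
          \<Longrightarrow> \<beta> i = beads (part \<theta>) (\<sigma> i)"
          using beads_sortable[OF inj frob_nonzero_lower[OF nz], of n] frob_nonzero_sum[OF nz] cycle_list(2)[OF h] by auto
        have "\<theta> \<noteq> \<nu>"
        proof
          assume "\<theta> = \<nu>"
          moreover have "\<beta> \<in> extensional {..<k}" using b by (auto simp: PiE_def)
          ultimately have "\<beta> = e \<sigma>" using ls(4) by (auto simp: e_def extensional_def fun_eq_iff)
          then show False using b ls(3) by blast
        qed
        moreover have "C \<beta> = of_int (sign \<sigma>) * C (beads (part \<theta>))" by (rule Ccong[OF ls(3)]) (rule ls(4))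
        ultimately show ?thesis using Cb[OF ls(1)] by simp
      qed simp
    qed
  qed
  also have "\<dots> = (\<Sum>\<sigma>\<in>?P. F h (e \<sigma>) * C (e \<sigma>))" by (simp add: sum.reindex[OF inje])
  also have "\<dots> = (\<Sum>\<sigma>\<in>?P. F h ?b * fact n)"
  proof (rule sum.cong[OF refl])
    fix \<sigma> assume "\<sigma> \<in> ?P"
    then have s: "\<sigma> permutes {..<k}" by simp
    have "(of_int (sign \<sigma>) * of_int (sign \<sigma>) :: complex) = 1" by (simp flip: of_int_mult)
    then show "F h (e \<sigma>) * C (e \<sigma>) = F h ?b * fact n"
      using Fcong[OF s, of "e \<sigma>" ?b h] Ccong[OF s, of "e \<sigma>" ?b] e_eq Cb[OF nu] by (simp add: mult_ac)
  qed
  also have "\<dots> = fact k * (fact n * F h ?b)" by (simp add: card_permutations)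
  finally show ?thesis using 1 by (simp add: F_def)
qed

section \<open>Normalization on the trivial character\<close>

lemma word_count_nonneg:
  assumes "word_count k \<mu> \<alpha> \<noteq> 0" "i < k"
  shows "0 \<le> \<alpha> i"
  using assms(1)
proof (induction \<mu> arbitrary: \<alpha>)
  case Nil
  then show ?case using assms(2) by (auto split: if_splits)
next
  case (Cons r \<mu>)
  then obtain j where "word_count k \<mu> (\<alpha>(j := \<alpha> j - int r)) \<noteq> 0"
    by (auto elim!: sum.not_neutral_contains_not_neutral)
  from Cons.IH[OF this] show ?case by (auto split: if_splits)
qed

lemma word_count_single:
  assumes "0 \<notin> set \<mu>" "0 < k" "\<And>i. i < k \<Longrightarrow> \<alpha> i = (if i = 0 then int (sum_list \<mu>) else 0)"
  shows "word_count k \<mu> \<alpha> = 1"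
  using assms(1,3)
proof (induction \<mu> arbitrary: \<alpha>)
  case Nil
  then show ?case by simp
next
  case (Cons r \<mu>)
  have "word_count k (r # \<mu>) \<alpha> = (\<Sum>i<k. if i = 0 then 1 else 0)"
    unfolding word_count.simps
  proof (rule sum.cong[OF refl])
    fix i assume i: "i \<in> {..<k}"
    show "word_count k \<mu> (\<alpha>(i := \<alpha> i - int r)) = (if i = 0 then 1 else 0)"
    proof (cases "i = 0")
      case True
      have "word_count k \<mu> (\<alpha>(i := \<alpha> i - int r)) = 1"
        using Cons.prems True by (intro Cons.IH) auto
      then show ?thesis using True by simp
    next
      case False
      have "r > 0" using Cons.prems by auto
      then have "(\<alpha>(i := \<alpha> i - int r)) i < 0" using Cons.prems(2)[of i] i False by simp
      then have "word_count k \<mu> (\<alpha>(i := \<alpha> i - int r)) = 0"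
        using word_count_nonneg[of k \<mu> "\<alpha>(i := \<alpha> i - int r)" i] i by force
      then show ?thesis using False by simp
    qed
  qed
  also have "\<dots> = 1" using assms(2) by simp
  finally show ?case .
qed

text \<open>For \<sigma> other than \<open>id\<close> some partial sum of the content exceeds the
  total \<open>n\<close>, so a later entry is negative and the word count is 0. The term for
  \<open>id\<close> counts the one constant word.\<close>

lemma frob_single_row:
  assumes mu: "0 \<notin> set \<mu>" "sum_list \<mu> = n" and k: "0 < k"
  shows "frob k \<mu> (beads (\<lambda>i. if i = 0 then n else 0)) = 1"
proof -
  let ?f = "\<lambda>i. if i = 0 then n else (0::nat)"
  have pos: "int (\<Sum>i<m. ?f i) = (if m = 0 then 0 else int n)" for m :: nat
    by (induction m) auto
  have "frob k \<mu> (beads ?f) = (\<Sum>\<sigma>\<in>{id}. sign \<sigma> * word_count k \<mu> (\<lambda>i. beads ?f i + int (\<sigma> i)))"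
    unfolding frob_eq_word_count
  proof (rule sum.mono_neutral_right)
    show "{id} \<subseteq> {\<sigma>. \<sigma> permutes {..<k}}" by (simp add: permutes_id)
    show "\<forall>\<sigma>\<in>{\<sigma>. \<sigma> permutes {..<k}} - {id}. sign \<sigma> * word_count k \<mu> (\<lambda>i. beads ?f i + int (\<sigma> i)) = 0"
    proof
      fix \<sigma> assume s: "\<sigma> \<in> {\<sigma>. \<sigma> permutes {..<k}} - {id}"
      then obtain m where m: "m \<le> k" "(\<Sum>i<m. i) < (\<Sum>i<m. \<sigma> i)"
        using permutes_eq_id[of \<sigma> k] by (metis DiffE mem_Collect_eq not_le singletonI)
      then have "m \<noteq> 0" by (cases m) auto
      let ?a = "\<lambda>i. beads ?f i + int (\<sigma> i)"
      have "(\<Sum>i<k. int (\<sigma> i)) = (\<Sum>i<k. int i)"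
        using s sum.reindex_bij_betw[OF permutes_imp_bij[of \<sigma> "{..<k}"], of int] by simp
      then have tot: "(\<Sum>i<k. ?a i) = int n"
        unfolding sum_beads_add pos using k by simp
      have "int n < (\<Sum>i<m. ?a i)" 
        unfolding sum_beads_add pos using m(2) \<open>m \<noteq> 0\<close> by (simp del: of_nat_sum)
      moreover have "(\<Sum>i<k. ?a i) = (\<Sum>i<m. ?a i) + (\<Sum>i\<in>{m..<k}. ?a i)"
        using sum.atLeastLessThan_concat[OF zero_le m(1), of ?a] unfolding atLeast0LessThan by (rule sym)
      ultimately have neg: "(\<Sum>i\<in>{m..<k}. ?a i) < 0" using tot by linarith
      have "\<not> (\<forall>i\<in>{m..<k}. 0 \<le> ?a i)"
      proof
        assume "\<forall>i\<in>{m..<k}. 0 \<le> ?a i"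
        then have "0 \<le> (\<Sum>i\<in>{m..<k}. ?a i)" by (intro sum_nonneg) blast
        then show False using neg by linarith
      qed
      then obtain i where i: "i < k" "\<not> 0 \<le> ?a i" by (metis atLeastLessThan_iff)
      have "word_count k \<mu> ?a = 0" by (rule ccontr) (use word_count_nonneg[OF _ i(1)] i(2) in blast)
      then show "sign \<sigma> * word_count k \<mu> ?a = 0" by (simp only: mult_zero_right)
    qed
  qed simp
  also have "\<dots> = 1" using word_count_single[OF mu(1) k, of "\<lambda>i. beads ?f i + int (id i)"] mu(2)
    by (simp add: beads_def)
  finally show ?thesis .
qed

theorem irr_char_eq_frob_cycle_list:
  assumes nu: "\<nu> \<in> partitions n" and h: "h \<in> Sym n" and k: "2 * n \<le> k" "0 < k"
  shows "irr_char \<nu> h = of_int (frob k (cycle_list n h) (beads (part \<nu>)))"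
proof -
  define c where "c = (of_nat (centralizer_order (cycle_list n h) (cycle_type n h) * card {g \<in> Sym n. cycle_type n g = cycle_type n h}) :: complex)"
  have scaled: "fact n * of_int (frob k (cycle_list n h) (beads (part \<kappa>))) = c * irr_char \<kappa> h"
    if "\<kappa> \<in> partitions n" for \<kappa>
    unfolding c_def by (rule frob_irr_char_proportional[OF that h k(1)])
  \<comment> \<open>The one-row partition of \<open>n\<close>; it is the empty list for
    \<open>n = 0\<close> because parts are positive.\<close>
  let ?o = "if n = 0 then [] else [n]"
  have o: "?o \<in> partitions n" by (simp add: partitions_def)
  have "part ?o = (\<lambda>i. if i = 0 then n else 0)" by (auto simp: part_def fun_eq_iff)
  then have "frob k (cycle_list n h) (beads (part ?o)) = 1"
    using frob_single_row[OF cycle_list(1,2)[OF h] k(2)] by simp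
  moreover have "irr_char ?o h = 1"
  proof (rule irr_char_single_row[OF o _ h])
    fix x assume "x \<in> {1..n}"
    then show "trow ?o x = 0" using tab_bounds(2)[of x ?o] by (auto split: if_splits)
  qed
  ultimately have "c = fact n" using scaled[OF o] by simp
  then show ?thesis using scaled[OF nu] by simp
qed

corollary irr_char_eq_frob:
  assumes "\<nu> \<in> partitions n" "h \<in> Sym n" "2 * n \<le> k" "0 < k" "mset \<mu> = cycle_type n h"
  shows "irr_char \<nu> h = of_int (frob k \<mu> (beads (part \<nu>)))"
  using irr_char_eq_frob_cycle_list[OF assms(1-4)] frob_mset_cong[of \<mu> "cycle_list n h" k] assms(5) by simp

section \<open>Rim hooks and beads\<close>

text \<open>Moving the new value from place \<open>i\<close> up to place \<open>a\<close> takes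
  \<open>i - a\<close> adjacent transpositions, each contributing one sign. For rim hooks this
  number is the leg length.\<close>

lemma frob_shift:
  assumes "a \<le> i" "i < k"
  shows "frob k \<mu> (\<lambda>j. if j < a then b j else if j = a then x else if j \<le> i then b (j - 1) else b j) =
    (-1) ^ (i - a) * frob k \<mu> (b(i := x))"
  using assms(1)
proof (induction a rule: inc_induct)
  case base
  have "(\<lambda>j. if j < i then b j else if j = i then x else if j \<le> i then b (j - 1) else b j) = b(i := x)"
    by (auto simp: fun_eq_iff)
  then show ?case by (simp only: diff_self_eq_0 power_0 mult_1_left)
next
  case (step a)
  let ?c = "\<lambda>a j. if j < a then b j else if j = a then x else if j \<le> i then b (j - 1) else b j"
  have "?c a = ?c (Suc a) \<circ> transpose a (Suc a)"
  proof
    fix j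
    consider "j = a" | "j = Suc a" | "j \<noteq> a" "j \<noteq> Suc a" by blast
    then show "?c a j = (?c (Suc a) \<circ> transpose a (Suc a)) j"
      using step.hyps by cases auto
  qed
  then have "frob k \<mu> (?c a) = - frob k \<mu> (?c (Suc a))"
    using frob_transpose[of a k "Suc a" \<mu> "?c (Suc a)"] step.hyps assms(2) by simp
  moreover have "i - a = Suc (i - Suc a)" using step.hyps by simp
  ultimately show ?case using step.IH by (simp del: fun_upd_apply)
qed

text \<open>Describes adding to \<open>f\<close> a rim hook that occupies the rows \<open>a\<close>
  to \<open>i\<close>. By the last clause consecutive rows of the hook overlap in exactly one
  column: at least one by connectedness, at most one because there is no square.\<close>

definition hook_shape :: "(nat \<Rightarrow> nat) \<Rightarrow> nat \<Rightarrow> nat \<Rightarrow> (nat \<Rightarrow> nat) \<Rightarrow> bool" where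
  "hook_shape f a i h \<longleftrightarrow> a \<le> i \<and> f a < h a \<and> (\<forall>j<a. h j = f j) \<and> (\<forall>j>i. h j = f j) \<and>
     (\<forall>j. a \<le> j \<and> j < i \<longrightarrow> h (Suc j) = f j + 1)"

lemma hook_shape_rows:
  assumes "hook_shape f a i h" "antimono f"
  shows "{j. f j < h j} = {a..i}"
proof (intro equalityI subsetI)
  fix j assume j: "j \<in> {j. f j < h j}"
  show "j \<in> {a..i}"
  proof (rule ccontr)
    assume "j \<notin> {a..i}"
    then have "j < a \<or> i < j" by auto
    then show False using j assms(1) by (auto simp: hook_shape_def)
  qed
next
  fix j assume j: "j \<in> {a..i}"
  show "j \<in> {j. f j < h j}"
  proof (cases "j = a")
    case True then show ?thesis using assms(1) by (simp add: hook_shape_def)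
  next
    case False
    then obtain l where l: "j = Suc l" "a \<le> l" "l < i" using j by (cases j) auto
    then have "h j = f l + 1" using assms(1) by (simp add: hook_shape_def)
    moreover have "f j \<le> f l" using antimonoD[OF assms(2), of l j] l by simp
    ultimately show ?thesis by simp
  qed
qed

text \<open>Below its top row, each new row length in the hook is the old length of the row above
  plus 1, so the difference telescopes.\<close>

lemma hook_shape_sum:
  assumes s: "hook_shape f a i h" and "i < k"
  shows "int (\<Sum>j<k. h j) - int (\<Sum>j<k. f j) = beads h a - beads f i"
proof -
  have "int (\<Sum>j<k. h j) - int (\<Sum>j<k. f j) = (\<Sum>j<k. int (h j) - int (f j))"
    by (simp add: sum_subtractf)
  also have "\<dots> = (\<Sum>j\<in>{a..i}. int (h j) - int (f j))"
  proof (rule sum.mono_neutral_right)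
    show "\<forall>j\<in>{..<k} - {a..i}. int (h j) - int (f j) = 0"
      using s by (auto simp: hook_shape_def not_le)
  qed (use assms(2) in auto)
  also have "\<dots> = int (h a) - int (f i) + int (i - a)"
  proof -
    have "(\<Sum>j\<in>{a..l}. int (h j) - int (f j)) = int (h a) - int (f l) + int (l - a)" if "a \<le> l" "l \<le> i" for l
      using that
    proof (induction l rule: dec_induct)
      case (step l)
      then have "h (Suc l) = f l + 1" using s by (simp add: hook_shape_def)
      then show ?case using step by (simp add: sum.nat_ivl_Suc')
    qed simp
    then show ?thesis using s by (simp add: hook_shape_def)
  qed
  also have "\<dots> = beads h a - beads f i"
    using s by (simp add: beads_def hook_shape_def of_nat_diff)
  finally show ?thesis .
qed

text \<open>The extra 1 in \<open>hook_shape\<close> compensates the shift of the row index: the old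
  beads \<open>a\<close> to \<open>i - 1\<close> reappear one index later, and only bead
  \<open>i\<close> changes its value.\<close>

lemma hook_shape_beads:
  assumes s: "hook_shape f a i h" and top: "beads h a = beads f i + int r"
  shows "beads h j = (if j < a then beads f j else if j = a then beads f i + int r
    else if j \<le> i then beads f (j - 1) else beads f j)"
proof -
  consider "j < a" | "j = a" | l where "j = Suc l" "a \<le> l" "l < i" | "i < j" "a < j"
  proof (cases "a < j \<and> j \<le> i")
    case True
    then have "j = Suc (j - 1)" "a \<le> j - 1" "j - 1 < i" by auto
    then show ?thesis using that by blast
  next
    case False
    moreover have "a \<le> i" using s by (simp add: hook_shape_def)
    ultimately have "j < a \<or> j = a \<or> (i < j \<and> a < j)" by linarith
    then show ?thesis using that by blast
  qed
  then show ?thesis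
  proof cases
    case 3
    then have "h j = f l + 1" using s by (simp add: hook_shape_def)
    then show ?thesis using 3 by (simp add: beads_def)
  qed (use s top in \<open>auto simp: hook_shape_def beads_def\<close>)
qed

lemma frob_hook_shape:
  assumes s: "hook_shape f a i h" and top: "beads h a = beads f i + int r" and "i < k"
  shows "frob k \<mu> (beads h) = (-1) ^ (i - a) * frob k \<mu> ((beads f)(i := beads f i + int r))"
proof -
  have "beads h = (\<lambda>j. if j < a then beads f j else if j = a then beads f i + int r
    else if j \<le> i then beads f (j - 1) else beads f j)"
    using hook_shape_beads[OF s top] by blast
  moreover have "a \<le> i" using s by (simp add: hook_shape_def)
  ultimately show ?thesis using frob_shift[of a i k \<mu> "beads f" "beads f i + int r"] assms(3) by simp
qed

lemma beads_strict:
  assumes "antimono f" "i < j"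
  shows "beads f j < beads f i"
  using antimonoD[OF assms(1), of i j] assms(2) by (simp add: beads_def)

text \<open>The raised bead lies strictly between the old beads \<open>a - 1\<close> and
  \<open>a\<close>. So it meets no old bead, and \<open>a\<close> is determined by \<open>i\<close>
  and \<open>r\<close>.\<close>

lemma hook_shape_separation:
  assumes s: "hook_shape f a i h" and top: "beads h a = beads f i + int r"
    and f: "antimono f" and h: "antimono h"
  shows "j < a \<Longrightarrow> beads f i + int r < beads f j"
    and "a \<le> j \<Longrightarrow> beads f j < beads f i + int r"
proof -
  have ai: "a \<le> i" "f a < h a" using s by (simp_all add: hook_shape_def)
  show "beads f i + int r < beads f j" if "j < a"
    using beads_strict[OF h that] hook_shape_beads[OF s top, of j] top that by simp
  \<comment> \<open>The shape forces \<open>r\<close> to be positive.\<close>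
  have r: "beads f i < beads f i + int r"
  proof (cases "a = i")
    case True
    then have "beads f i < beads h a" using ai by (simp add: beads_def)
    then show ?thesis using top by simp
  next
    case False
    then have "beads h i < beads h a" using beads_strict[OF h, of a i] ai by simp
    moreover have "beads h i = beads f (i - 1)" using hook_shape_beads[OF s top, of i] False ai by simp
    moreover have "beads f i < beads f (i - 1)" using beads_strict[OF f, of "i - 1" i] False ai by simp
    ultimately show ?thesis using top by simp
  qed
  show "beads f j < beads f i + int r" if "a \<le> j"
  proof (cases "j < i")
    case True
    have "beads h (Suc j) = beads f j" using hook_shape_beads[OF s top, of "Suc j"] True that by simp
    then show ?thesis using beads_strict[OF h, of a "Suc j"] top that by simp
  next
    case False
    then have "beads f j \<le> beads f i" using beads_strict[OF f, of i j] by (cases "i = j") auto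
    then show ?thesis using r by simp
  qed
qed

lemma mem_diagram_diff:
  "(j, c) \<in> diagram \<nu> - diagram \<rho> \<longleftrightarrow> part \<rho> j \<le> c \<and> c < part \<nu> j"
  by (auto simp: mem_diagram)

lemma diagram_subset_iff: "diagram \<rho> \<subseteq> diagram \<nu> \<longleftrightarrow> (\<forall>j. part \<rho> j \<le> part \<nu> j)"
  by (auto simp: subset_iff mem_diagram) (meson not_le order.irrefl order.strict_trans2)+

lemma rows_diagram_diff: "fst ` (diagram \<nu> - diagram \<rho>) = {j. part \<rho> j < part \<nu> j}"
proof (intro equalityI subsetI)
  fix j assume "j \<in> {j. part \<rho> j < part \<nu> j}"
  then have "(j, part \<rho> j) \<in> diagram \<nu> - diagram \<rho>" by (simp only: mem_diagram_diff) simp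
  then show "j \<in> fst ` (diagram \<nu> - diagram \<rho>)" by force
next
  fix j assume "j \<in> fst ` (diagram \<nu> - diagram \<rho>)"
  then obtain c where "(j, c) \<in> diagram \<nu> - diagram \<rho>" by auto
  then show "j \<in> {j. part \<rho> j < part \<nu> j}" by (simp only: mem_diagram_diff) simp
qed

lemma rtrancl_crossing:
  assumes "(u, v) \<in> E\<^sup>*" "P u" "\<not> P v"
  obtains x y where "(x, y) \<in> E" "P x" "\<not> P y"
proof -
  have "P v \<or> (\<exists>x y. (x, y) \<in> E \<and> P x \<and> \<not> P y)"
    using assms(1)
  proof (induction rule: rtrancl_induct)
    case base then show ?case using assms(2) by simp
  next
    case (step y z) then show ?case by blast
  qed
  then show ?thesis using assms(3) that by blast
qed

text \<open>A path from the top row of the hook to its bottom row must step across the line between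
  any two consecutive rows, so these overlap in at least one column; an overlap of two columns would
  contain a square.\<close>

lemma rim_hook_imp_hook_shape:
  assumes nu: "\<nu> \<in> partitions n" and rho: "\<rho> \<in> partitions m"
    and rim: "rim_hook (diagram \<nu> - diagram \<rho>)" and sub: "diagram \<rho> \<subseteq> diagram \<nu>"
  obtains a i where "hook_shape (part \<rho>) a i (part \<nu>)" "i < length \<nu>"
proof -
  let ?S = "diagram \<nu> - diagram \<rho>" and ?f = "part \<rho>" and ?h = "part \<nu>"
  let ?R = "{j. ?f j < ?h j}"
  have conn: "connected_boxes ?S" and no_square: "\<not> (\<exists>i j. {(i, j), (Suc i, j), (i, Suc j), (Suc i, Suc j)} \<subseteq> ?S)"
    using rim by (simp_all add: rim_hook_def)
  have le: "?f j \<le> ?h j" for j using sub by (simp add: diagram_subset_iff)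
  have lt: "j < length \<nu>" if "j \<in> ?R" for j using that by (auto simp: part_def split: if_splits)
  have fin: "finite ?R" by (rule finite_subset[of _ "{..<length \<nu>}"]) (use lt in auto)
  have ne: "?R \<noteq> {}" using conn unfolding rows_diagram_diff[symmetric] by (simp add: connected_boxes_def)
  define a where "a = Min ?R"
  define i where "i = Max ?R"
  have aR: "a \<in> ?R" and iR: "i \<in> ?R" using fin ne by (simp_all add: a_def i_def del: mem_Collect_eq)
  have bounds: "a \<le> j \<and> j \<le> i" if "j \<in> ?R" for j using fin that
    by (simp add: a_def i_def del: mem_Collect_eq)
  have "?h (Suc j) = ?f j + 1" if j: "a \<le> j" "j < i" for j
  proof -
    let ?E = "{(x, y). x \<in> ?S \<and> y \<in> ?S \<and> adjacent x y}"
    have "(a, ?f a) \<in> ?S" "(i, ?f i) \<in> ?S" using aR iR by (simp_all only: mem_diagram_diff) auto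
    then have path: "((a, ?f a), (i, ?f i)) \<in> ?E\<^sup>*" using conn unfolding connected_boxes_def by blast
    \<comment> \<open>The step of the path that crosses the line below row \<open>j\<close>; being
      adjacent, its two boxes lie in one column.\<close>
    obtain x y where xy: "(x, y) \<in> ?E" "fst x \<le> j" "\<not> fst y \<le> j"
      by (rule rtrancl_crossing[OF path, of "\<lambda>x. fst x \<le> j"]) (use j in auto)
    have "fst x = j" "fst y = Suc j" "snd x = snd y"
      using xy by (auto simp: adjacent_def)
    then have "(j, snd x) \<in> ?S" "(Suc j, snd x) \<in> ?S" using xy(1)
      by (auto simp: prod_eq_iff) (metis prod.collapse)+
    then have "?f j \<le> snd x" "snd x < ?h (Suc j)" by (simp_all only: mem_diagram_diff)
    then have ge: "?f j + 1 \<le> ?h (Suc j)" by simp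
    have "\<not> ?f j + 2 \<le> ?h (Suc j)"
    proof
      assume two: "?f j + 2 \<le> ?h (Suc j)"
      have "?h (Suc j) \<le> ?h j" "?f (Suc j) \<le> ?f j"
        using antimonoD[OF part_antimono[OF nu], of j "Suc j"] antimonoD[OF part_antimono[OF rho], of j "Suc j"] by simp_all
      then have "{(j, ?f j), (Suc j, ?f j), (j, Suc (?f j)), (Suc j, Suc (?f j))} \<subseteq> ?S"
        using two by (simp only: insert_subset mem_diagram_diff) simp
      then show False using no_square by blast
    qed
    then show ?thesis using ge by simp
  qed
  moreover have "?h j = ?f j" if "j < a \<or> i < j" for j
  proof -
    have "j \<notin> ?R" using bounds[of j] that by auto
    then show ?thesis using le[of j] by simp
  qed
  ultimately have "hook_shape ?f a i ?h" using bounds[OF iR] aR by (simp add: hook_shape_def)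
  then show ?thesis using that lt[OF iR] by blast
qed

lemma hook_shape_imp_rim_hook:
  assumes nu: "\<nu> \<in> partitions n" and rho: "\<rho> \<in> partitions m"
    and s: "hook_shape (part \<rho>) a i (part \<nu>)"
  shows "rim_hook (diagram \<nu> - diagram \<rho>)" "diagram \<rho> \<subseteq> diagram \<nu>"
proof -
  let ?S = "diagram \<nu> - diagram \<rho>" and ?f = "part \<rho>" and ?h = "part \<nu>"
  have anti: "antimono ?f" by (rule part_antimono[OF rho])
  have rows: "{j. ?f j < ?h j} = {a..i}" by (rule hook_shape_rows[OF s anti])
  have next_row: "?h (Suc j) = ?f j + 1" if "a \<le> j" "j < i" for j using s that by (simp add: hook_shape_def)
  have "?f j \<le> ?h j" for j
  proof (cases "j \<in> {a..i}")
    case True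
    then have "j \<in> {j. ?f j < ?h j}" unfolding rows .
    then show ?thesis by simp
  next
    case False
    then have "j < a \<or> i < j" by auto
    then show ?thesis using s by (auto simp: hook_shape_def)
  qed
  then show sub: "diagram \<rho> \<subseteq> diagram \<nu>" by (simp add: diagram_subset_iff)
  have "skew_diagram ?S" using nu rho sub unfolding skew_diagram_def by blast
  moreover have "\<not> (\<exists>x y. {(x, y), (Suc x, y), (x, Suc y), (Suc x, Suc y)} \<subseteq> ?S)"
  proof clarify
    fix x y assume "{(x, y), (Suc x, y), (x, Suc y), (Suc x, Suc y)} \<subseteq> ?S"
    then have "(x, y) \<in> ?S" "(Suc x, y) \<in> ?S" "(Suc x, Suc y) \<in> ?S" by blast+
    then have 1: "?f x \<le> y" "y < ?h x" "?f (Suc x) \<le> y" "y < ?h (Suc x)" "Suc y < ?h (Suc x)"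
      by (simp_all only: mem_diagram_diff)
    then have "x \<in> {j. ?f j < ?h j}" "Suc x \<in> {j. ?f j < ?h j}" by auto
    then have "a \<le> x" "x < i" unfolding rows by auto
    then show False using next_row[of x] 1 by simp
  qed
  moreover have "connected_boxes ?S"
  proof -
    let ?E = "{(x, y). x \<in> ?S \<and> y \<in> ?S \<and> adjacent x y}"
    have symE: "sym (?E\<^sup>*)" by (rule sym_rtrancl) (auto simp: sym_def adjacent_def)
    have start: "(j, ?f j) \<in> ?S" if "j \<in> {a..i}" for j
      using that rows by (simp only: mem_diagram_diff) blast
    have horiz: "((j, ?f j), (j, c)) \<in> ?E\<^sup>*" if "?f j \<le> c" "c < ?h j" for j c
      using that
    proof (induction c rule: dec_induct)
      case base then show ?case by simp
    next
      case (step c)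
      then have "(j, c) \<in> ?S" "(j, Suc c) \<in> ?S" by (simp_all only: mem_diagram_diff) auto
      then have "((j, c), (j, Suc c)) \<in> ?E" by (simp add: adjacent_def)
      then show ?case using step by (meson Suc_lessD rtrancl.rtrancl_into_rtrancl)
    qed
    \<comment> \<open>From the first new box of row \<open>j\<close> the path steps down into the
      single overlap column, then goes left to the first new box of the next row.\<close>
    have vert: "((a, ?f a), (j, ?f j)) \<in> ?E\<^sup>*" if "a \<le> j" "j \<le> i" for j
      using that
    proof (induction j rule: dec_induct)
      case base then show ?case by simp
    next
      case (step j)
      have le: "?f (Suc j) \<le> ?f j" using antimonoD[OF anti, of j "Suc j"] by simp
      have "(Suc j, ?f j) \<in> ?S" using next_row[of j] step le by (simp only: mem_diagram_diff) simp
      moreover have "(j, ?f j) \<in> ?S" using start step by simp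
      ultimately have "((j, ?f j), (Suc j, ?f j)) \<in> ?E" by (simp add: adjacent_def)
      moreover have "((Suc j, ?f (Suc j)), (Suc j, ?f j)) \<in> ?E\<^sup>*"
        using horiz[OF le] next_row[of j] step by simp
      ultimately show ?case using step symE
        by (meson Suc_leD rtrancl.rtrancl_into_rtrancl rtrancl_trans symD)
    qed
    have base: "((a, ?f a), b) \<in> ?E\<^sup>*" if b: "b \<in> ?S" for b
    proof -
      obtain j c where jc: "b = (j, c)" by (cases b)
      then have "?f j \<le> c" "c < ?h j" using b by (simp_all only: mem_diagram_diff)
      moreover from this have "j \<in> {j. ?f j < ?h j}" by simp
      then have "a \<le> j" "j \<le> i" unfolding rows by auto
      ultimately show ?thesis unfolding jc using vert horiz by (meson rtrancl_trans)
    qed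
    have "?S \<noteq> {}" using start[of a] s by (auto simp: hook_shape_def)
    then show ?thesis unfolding connected_boxes_def using base symE by (meson rtrancl_trans symD)
  qed
  ultimately show "rim_hook ?S" by (simp add: rim_hook_def)
qed

lemma hook_shape_unique:
  assumes s: "hook_shape f a i h" and s': "hook_shape f a' i h'"
    and f: "antimono f" and h: "antimono h" "antimono h'"
    and top: "beads h a = beads f i + int r" "beads h' a' = beads f i + int r"
  shows "h = h'"
proof -
  note sep = hook_shape_separation[OF s top(1) f h(1)] and sep' = hook_shape_separation[OF s' top(2) f h(2)]
  have "\<not> a < a'" "\<not> a' < a" using sep(2)[of a] sep'(1)[of a] sep(1)[of a'] sep'(2)[of a'] by auto
  then have "a = a'" by simp
  then have "beads h j = beads h' j" for j
    using hook_shape_beads[OF s top(1)] hook_shape_beads[OF s' top(2)] by simp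
  then show ?thesis by (simp add: beads_def fun_eq_iff)
qed

lemma hook_shape_exists:
  assumes f: "antimono f" and fk: "\<And>j. k \<le> j \<Longrightarrow> f j = 0" and i: "i < k" and "0 < r"
    and free: "beads f i + int r \<notin> beads f ` {..<k}"
  obtains a h where "hook_shape f a i h" "antimono h" "beads h a = beads f i + int r"
proof -
  let ?X = "beads f i + int r"
  \<comment> \<open>The place where the raised bead has to be inserted to keep the beads
    decreasing.\<close>
  define a where "a = (LEAST j. beads f j < ?X)"
  have ex: "beads f i < ?X" using assms(4) by simp
  have ai: "a \<le> i" unfolding a_def by (rule Least_le) (rule ex)
  have aX: "beads f a < ?X" unfolding a_def by (rule LeastI) (rule ex)
  have low: "?X < beads f j" if "j < a" for j
  proof -
    have "\<not> beads f j < ?X" using not_less_Least that unfolding a_def by blast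
    moreover have "beads f j \<in> beads f ` {..<k}" using that ai i by simp
    then have "beads f j \<noteq> ?X" using free by metis
    ultimately show ?thesis by simp
  qed
  \<comment> \<open>\<open>hook_shape_beads\<close> read backwards, from beads to row
    lengths.\<close>
  define h where "h j = (if j < a then f j else if j
    = a then nat (?X + int a) else if j \<le> i then f (j - 1) + 1 else f j)" for j
  have Xa: "int (f a) < ?X + int a" using aX by (simp add: beads_def)
  have ha: "int (h a) = ?X + int a" "f a < h a" using Xa by (auto simp: h_def)
  have s: "hook_shape f a i h" using ai ha(2) by (auto simp: hook_shape_def h_def)
  have top: "beads h a = ?X" using ha by (simp add: beads_def)
  have fmono: "f (Suc j) \<le> f j" for j using antimonoD[OF f, of j "Suc j"] by simp
  have hS: "h (Suc j) \<le> h j" for j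
  proof -
    consider "Suc j < a" | "Suc j = a" | "j = a" "a < i" | "j = a" "a
      = i" | "a < j" "j < i" | "a < j" "i \<le> j" using ai by linarith
    then show ?thesis
    proof cases
      case 1 then show ?thesis using fmono by (simp add: h_def)
    next
      case 2
      then have "?X < beads f j" using low by simp
      then have "int (h a) \<le> int (f j)" unfolding ha(1) using 2 by (simp add: beads_def)
      then have "h a \<le> f j" by linarith
      moreover have "h j = f j" using 2 by (simp add: h_def)
      ultimately show ?thesis using 2 by simp
    next
      case 3 then show ?thesis using ha(2) by (auto simp: h_def)
    next
      case 4 then show ?thesis using ha(2) fmono[of j] by (auto simp: h_def)
    next
      case 5
      then show ?thesis using fmono[of "j - 1"] by (auto simp: h_def)
    next
      case 6
      then show ?thesis using fmono[of j] fmono[of "j - 1"] by (auto simp: h_def)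
    qed
  qed
  have "antimono h" unfolding antimono_iff_le_Suc using hS by blast
  then show ?thesis using that s top by blast
qed

text \<open>A hook of length \<open>r\<close> corresponds to the bead that it raises, whose index is
  the lowest row of the hook. A bead that would land on another one belongs to no hook, and its term
  vanishes as well.\<close>

lemma sum_hook_extensions:
  assumes r: "1 \<le> r" "r \<le> n" and rho: "\<rho> \<in> partitions (n - r)" and k: "n \<le> k"
  shows "(\<Sum>\<nu>\<in>hook_extensions \<rho> n. (-1) ^ leg_length (diagram \<nu> - diagram \<rho>) * frob k \<mu> (beads (part \<nu>))) =
    (\<Sum>i<k. frob k \<mu> ((beads (part \<rho>))(i := beads (part \<rho>) i + int r)))"
proof -
  let ?f = "part \<rho>" and ?b = "beads (part \<rho>)"
  have f: "antimono ?f" by (rule part_antimono[OF rho])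
  have rsum: "sum_list \<rho> = n - r" and rz: "0 \<notin> set \<rho>" using rho by (simp_all add: partitions_def)
  have rlen: "length \<rho> \<le> k" using length_le_sum_list[OF rz] rsum k by simp
  have fk: "?f j = 0" if "k \<le> j" for j using that rlen by (simp add: part_def)
  define I where "I = {i. i < k \<and> ?b i + int r \<notin> ?b ` {..<k}}"
  define idx where "idx \<nu> = Max {j. ?f j < part \<nu> j}" for \<nu>
  have info: "\<exists>a. hook_shape ?f a (idx \<nu>) (part \<nu>) \<and> idx \<nu> < k \<and> beads (part \<nu>) a = ?b (idx \<nu>) + int r
      \<and> antimono (part \<nu>) \<and> leg_length (diagram \<nu> - diagram \<rho>) = idx \<nu> - a \<and> 0 \<notin> set \<nu>"
    if v: "\<nu> \<in> hook_extensions \<rho> n" for \<nu>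
  proof -
    have nu: "\<nu> \<in> partitions n" "diagram \<rho> \<subseteq> diagram \<nu>" "rim_hook (diagram \<nu> - diagram \<rho>)"
      using v by (simp_all add: hook_extensions_def)
    have vsum: "sum_list \<nu> = n" and vz: "0 \<notin> set \<nu>" using nu(1) by (simp_all add: partitions_def)
    have vlen: "length \<nu> \<le> k" using length_le_sum_list[OF vz] vsum k by simp
    obtain a i where s: "hook_shape ?f a i (part \<nu>)" "i < length \<nu>"
      using rim_hook_imp_hook_shape[OF nu(1) rho nu(3,2)] .
    have ai: "a \<le> i" using s(1) by (simp add: hook_shape_def)
    note rows = hook_shape_rows[OF s(1) f]
    have "idx \<nu> = i" unfolding idx_def rows using ai by (intro Max_eqI) auto
    moreover have "beads (part \<nu>) a = ?b i + int r"
      using hook_shape_sum[OF s(1), of k] s(2) vlen sum_part[OF rlen] sum_part[OF vlen] rsum vsum r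
      by simp
    moreover have "leg_length (diagram \<nu> - diagram \<rho>) = i - a"
      unfolding leg_length_def rows_diagram_diff rows using ai by simp
    ultimately show ?thesis using s vlen part_antimono[OF nu(1)] vz by auto
  qed
  have bij: "bij_betw idx (hook_extensions \<rho> n) I"
  proof (rule bij_betw_imageI)
    show "inj_on idx (hook_extensions \<rho> n)"
    proof (rule inj_onI)
      fix \<nu> \<nu>' assume v: "\<nu> \<in> hook_extensions \<rho> n" "\<nu>' \<in> hook_extensions \<rho> n" "idx \<nu> = idx \<nu>'"
      obtain a where a: "hook_shape ?f a (idx \<nu>) (part \<nu>)" "beads (part \<nu>) a = ?b (idx \<nu>) + int r"
          "antimono (part \<nu>)" "0 \<notin> set \<nu>" using info[OF v(1)] by blast
      obtain a' where a': "hook_shape ?f a' (idx \<nu>) (part \<nu>')" "beads (part \<nu>') a' = ?b (idx \<nu>) + int r"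
          "antimono (part \<nu>')" "0 \<notin> set \<nu>'" using info[OF v(2)] v(3) by auto
      have "part \<nu> = part \<nu>'" by (rule hook_shape_unique[OF a(1) a'(1) f a(3) a'(3) a(2) a'(2)])
      then show "\<nu> = \<nu>'" using part_inject[OF a(4) a'(4)] by simp
    qed
    show "idx ` hook_extensions \<rho> n = I"
    proof (intro equalityI subsetI)
      fix i assume "i \<in> idx ` hook_extensions \<rho> n"
      then obtain \<nu> where v: "\<nu> \<in> hook_extensions \<rho> n" "i = idx \<nu>" by blast
      obtain a where a: "hook_shape ?f a i (part \<nu>)" "i < k" "beads (part \<nu>) a = ?b i + int r"
          "antimono (part \<nu>)" using info[OF v(1)] v(2) by blast
      note sep = hook_shape_separation[OF a(1,3) f a(4)]
      have "?b i + int r \<noteq> ?b j" for j using sep[of j] by (cases "j < a") auto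
      then show "i \<in> I" using a(2) by (auto simp: I_def)
    next
      fix i assume "i \<in> I"
      then have i: "i < k" "?b i + int r \<notin> ?b ` {..<k}" by (simp_all add: I_def)
      obtain a h where h: "hook_shape ?f a i h" "antimono h" "beads h a = ?b i + int r"
        using hook_shape_exists[OF f fk i(1) _ i(2)] r by auto
      have hk: "h j = 0" if "k \<le> j" for j using h(1) fk[OF that] that i(1) by (simp add: hook_shape_def)
      obtain \<nu> where v: "sorted_wrt (\<ge>) \<nu>" "0 \<notin> set \<nu>" "part \<nu> = h" "length \<nu> \<le> k"
        using part_exists[OF h(2) hk] .
      have ai: "a \<le> i" using h(1) by (simp add: hook_shape_def)
      have "int (\<Sum>j<k. h j) - int (\<Sum>j<k. ?f j) = int r" using hook_shape_sum[OF h(1) i(1)] h(3) by simp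
      moreover have "(\<Sum>j<k. h j) = sum_list \<nu>" "(\<Sum>j<k. ?f j) = n - r"
        using sum_part[OF rlen] sum_part[OF v(4)] v(3) rsum by simp_all
      ultimately have "sum_list \<nu> = n" using r by linarith
      then have nu: "\<nu> \<in> partitions n" using v by (simp add: partitions_def)
      note rim = hook_shape_imp_rim_hook[OF nu rho, of a i, unfolded v(3), OF h(1)]
      have "card (diagram \<nu> - diagram \<rho>) = n - sum_list \<rho>"
        using rim(2) \<open>sum_list \<nu> = n\<close> by (simp add: card_Diff_subset card_diagram)
      then have ext: "\<nu> \<in> hook_extensions \<rho> n" using nu rim by (simp add: hook_extensions_def)
      have "idx \<nu> = i" unfolding idx_def v(3) hook_shape_rows[OF h(1) f] using ai
        by (intro Max_eqI) auto
      then show "i \<in> idx ` hook_extensions \<rho> n" using ext by blast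
    qed
  qed
  have "(\<Sum>i<k. frob k \<mu> (?b(i := ?b i + int r))) = (\<Sum>i\<in>I. frob k \<mu> (?b(i := ?b i + int r)))"
  proof (rule sum.mono_neutral_right)
    show "\<forall>i\<in>{..<k} - I. frob k \<mu> (?b(i := ?b i + int r)) = 0"
    proof
      fix i assume "i \<in> {..<k} - I"
      then obtain j where j: "i < k" "j < k" "?b i + int r = ?b j" by (auto simp: I_def)
      then have "j \<noteq> i" using r by auto
      then show "frob k \<mu> (?b(i := ?b i + int r)) = 0" using j by (intro frob_eq_0_collision[of i k j]) auto
    qed
  qed (auto simp: I_def)
  also have "\<dots> = (\<Sum>\<nu>\<in>hook_extensions \<rho> n. frob k \<mu> (?b(idx \<nu> := ?b (idx \<nu>) + int r)))"
    by (rule sum.reindex_bij_betw[OF bij, symmetric])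
  also have "\<dots> = (\<Sum>\<nu>\<in>hook_extensions \<rho> n. (-1) ^ leg_length (diagram \<nu> - diagram \<rho>) * frob k \<mu> (beads (part \<nu>)))"
  proof (rule sum.cong[OF refl])
    fix \<nu> assume "\<nu> \<in> hook_extensions \<rho> n"
    then obtain a where a: "hook_shape ?f a (idx \<nu>) (part \<nu>)" "idx \<nu> < k" "beads (part \<nu>) a
      = ?b (idx \<nu>) + int r"
      "leg_length (diagram \<nu> - diagram \<rho>) = idx \<nu> - a" using info by blast
    show "frob k \<mu> (?b(idx \<nu> := ?b (idx \<nu>) + int r)) =
      (-1) ^ leg_length (diagram \<nu> - diagram \<rho>) * frob k \<mu> (beads (part \<nu>))"
      unfolding frob_hook_shape[OF a(1,3,2)] a(4)
        by (simp flip: power_add mult.assoc mult_2 del: fun_upd_apply)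
  qed
  finally show ?thesis by simp
qed

section \<open>Evaluation of \<open>psi\<close>\<close>

lemma cycle_class_iff:
  assumes "\<mu> \<in> partitions n"
  shows "g \<in> cycle_class \<mu> \<longleftrightarrow> g \<in> Sym n \<and> mset \<mu> = cycle_type n g"
  using assms by (auto simp: cycle_class_def partitions_def)

lemma psi_eq:
  assumes r: "1 \<le> r" "r \<le> n" and rho: "\<rho> \<in> partitions (n - r)" and mu: "\<mu> \<in> partitions n"
    and g: "g \<in> cycle_class \<mu>"
  shows "psi \<rho> n g = of_int (int r * int (count_list \<mu> r) * frob (2 * n) (remove1 r \<mu>) (beads (part \<rho>)))"
proof -
  \<comment> \<open>Enough beads for \<open>irr_char_eq_frob\<close>, and at least \<open>n\<close>
    of them belong to empty rows of \<rho>.\<close>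
  let ?k = "2 * n" and ?b = "beads (part \<rho>)"
  have gS: "g \<in> Sym n" "mset \<mu> = cycle_type n g" using g cycle_class_iff[OF mu] by auto
  have msum: "sum_list \<mu> = n" and mz: "0 \<notin> set \<mu>" using mu by (simp_all add: partitions_def)
  have rlen: "length \<rho> \<le> n" using length_le_sum_list[of \<rho>] rho by (auto simp: partitions_def)
  have "psi \<rho> n g = (\<Sum>\<nu>\<in>hook_extensions \<rho> n. of_int ((-1) ^ leg_length (diagram \<nu> - diagram \<rho>) * frob ?k \<mu> (beads (part \<nu>))))"
    unfolding psi_def
  proof (rule sum.cong[OF refl])
    fix \<nu> assume "\<nu> \<in> hook_extensions \<rho> n"
    then have nu: "\<nu> \<in> partitions n" by (simp add: hook_extensions_def)
    show "(-1) ^ leg_length (diagram \<nu> - diagram \<rho>) * irr_char \<nu> g =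
      of_int ((-1) ^ leg_length (diagram \<nu> - diagram \<rho>) * frob ?k \<mu> (beads (part \<nu>)))"
      using irr_char_eq_frob[OF nu gS(1) _ _ gS(2), of ?k] r by simp
  qed
  also have "\<dots> = of_int (\<Sum>i<?k. frob ?k \<mu> (?b(i := ?b i + int r)))"
    using sum_hook_extensions[OF r rho, of ?k \<mu>] by (simp only: of_int_sum[symmetric] le_add2 mult_2)
  also have "(\<Sum>i<?k. frob ?k \<mu> (?b(i := ?b i + int r)))
    = int r * int (count_list \<mu> r) * frob ?k (remove1 r \<mu>) ?b"
  proof (rule sum_frob_raise[OF mz _ r])
    show "s \<le> n" if "s \<in> set \<mu>" for s using member_le_sum_list[OF that] msum by simp
    show "- int ?k < ?b i" if "i < ?k" for i using that by (simp add: beads_def)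
    show "\<exists>i<?k. ?b i = v" if v: "- int ?k < v" "v \<le> - int ?k + int n" for v
    \<comment> \<open>From index \<open>n\<close> on the rows of \<rho> are empty, so the bead with
      index \<open>- v\<close> sits at \<open>v\<close>.\<close>
    proof (intro exI[of _ "nat (- v)"] conjI)
      have "length \<rho> \<le> nat (- v)" using v rlen by simp
      then show "?b (nat (- v)) = v" using v by (simp add: beads_def part_def)
    qed (use v in simp)
  qed
  finally show ?thesis .
qed

theorem theorem3p1:
  fixes n r :: nat and \<rho> \<mu> :: "nat list"
  assumes "1 \<le> r" and "r \<le> n"
    and "\<rho> \<in> partitions (n - r)"
    and "\<mu> \<in> partitions n"
  shows "(\<forall>\<mu>'\<in>partitions (n - r). mset \<mu> = add_mset r (mset \<mu>') \<longrightarrow>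
            (\<forall>g\<in>cycle_class \<mu>. \<forall>h\<in>cycle_class \<mu>'.
               psi \<rho> n g = of_nat r * of_nat (count_list \<mu> r) * irr_char \<rho> h)) \<and>
         (count_list \<mu> r = 0 \<longrightarrow> (\<forall>g\<in>cycle_class \<mu>. psi \<rho> n g = 0))"
proof (intro conjI ballI impI)
  fix \<mu>' g h
  assume mu': "\<mu>' \<in> partitions (n - r)" "mset \<mu> = add_mset r (mset \<mu>')"
    and g: "g \<in> cycle_class \<mu>" and h: "h \<in> cycle_class \<mu>'"
  have "mset (remove1 r \<mu>) = cycle_type (n - r) h"
    using mu' h cycle_class_iff[OF mu'(1)] by simp
  then have "irr_char \<rho> h = of_int (frob (2 * n) (remove1 r \<mu>) (beads (part \<rho>)))"
    using assms(1,2) h cycle_class_iff[OF mu'(1)] by (intro irr_char_eq_frob[OF assms(3)]) auto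
  then show "psi \<rho> n g = of_nat r * of_nat (count_list \<mu> r) * irr_char \<rho> h"
    using psi_eq[OF assms g] by simp
next
  fix g assume "count_list \<mu> r = 0" "g \<in> cycle_class \<mu>"
  then show "psi \<rho> n g = 0" using psi_eq[OF assms] by simp
qed

end
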